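(* Let $\mathbb{G}$ be a homogeneous group of homogeneous dimension $Q$ and let $|\cdot|$ be an arbitrary homogeneous quasi-norm on $\mathbb{G}$. Let $0<\lambda<Q$, let $1<p\leq q<\infty$, let $p'$ be defined by $\frac{1}{p}+\frac{1}{p'}=1$, and let $\alpha,\beta\in\mathbb{R}$ satisfy $$\alpha<\frac{Q}{p'},\qquad \beta<\frac{Q}{q},\qquad \alpha+\beta\geq 0,\qquad \frac{1}{q}=\frac{1}{p}+\frac{\alpha+\beta+\lambda}{Q}-1 .$$ Then there is a positive constant $C$ such that for all measurable functions $u$ on $\mathbb{G}$ with $|x|^{\alpha}u\in L^{p}(\mathbb{G})$, $$\||x|^{-\beta}I_{\lambda,|\cdot|}u\|_{L^{q}(\mathbb{G})}\leq C\,\||x|^{\alpha}u\|_{L^{p}(\mathbb{G})},$$ where $C$ is independent of $u$ and $$I_{\lambda,|\cdot|}u(x)=\int_{\mathbb{G}}\frac{u(y)}{|y^{-1}x|^{\lambda}}\,dy .$$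
   Context: A homogeneous (Lie) group $\mathbb{G}$ is a Lie group on $\mathbb{R}^{N}$ (i.e. with underlying manifold $\mathbb{R}^N$) equipped with dilations $D_{\lambda}:\mathbb{R}^{N}\to\mathbb{R}^{N}$, $D_{\lambda}(x):=(\lambda^{\nu_{1}}x_{1},\ldots,\lambda^{\nu_{N}}x_{N})$, with $\nu_{1},\ldots,\nu_{N}>0$, such that $D_{\lambda}$ is an automorphism of the group $\mathbb{G}$ for each $\lambda>0$. One writes $\lambda x$ for $D_{\lambda}(x)$. The identity element of $\mathbb{G}$ is $0$. The homogeneous dimension of $\mathbb{G}$ is $Q:=\nu_{1}+\cdots+\nu_{N}$. A homogeneous quasi-norm on $\mathbb{G}$ is a continuous non-negative function $\mathbb{G}\ni x\mapsto |x|\in[0,\infty)$ such that (i) $|x|=|x^{-1}|$ for all $x\in\mathbb{G}$; (ii) $|\lambda x|=\lambda|x|$ for all $x\in\mathbb{G}$ and $\lambda>0$; (iii) $|x|=0$ if and only if $x=0$. Here $y^{-1}x$ denotes the product in $\mathbb{G}$ of the group inverse of $y$ with $x$; $dx$, $dy$ denote integration with respect to the Haar measure on $\mathbb{G}$, and $L^{p}(\mathbb{G})$ is the Lebesgue space with respect to this measure. In the norms, $|x|^{-\beta}I_{\lambda,|\cdot|}u$ and $|x|^{\alpha}u$ denote the functions $x\mapsto |x|^{-\beta}I_{\lambda,|\cdot|}u(x)$ and $x\mapsto|x|^{\alpha}u(x)$. *)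

theory Defs
  imports "HOL-Analysis.Analysis" "HOL-Algebra.Group"
begin

text \<open>
  \<open>C\<^sup>k\<close> on a Euclidean space: the derivative of order \<open>k + 1\<close> is tested on each direction \<open>v\<close>,
  which in finite dimension amounts to continuity of the derivative as a linear map.
\<close>

primrec C_k :: "nat \<Rightarrow> ('a::euclidean_space \<Rightarrow> 'b::real_normed_vector) \<Rightarrow> bool" where
  "C_k 0 f \<longleftrightarrow> continuous_on UNIV f"
| "C_k (Suc k) f \<longleftrightarrow>
    (\<forall>x. f differentiable (at x)) \<and> (\<forall>v. C_k k (\<lambda>x. frechet_derivative f (at x) v))"

definition smooth :: "('a::euclidean_space \<Rightarrow> 'b::real_normed_vector) \<Rightarrow> bool" where
  "smooth f \<longleftrightarrow> (\<forall>k. C_k k f)"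

definition dilation :: "('n \<Rightarrow> real) \<Rightarrow> real \<Rightarrow> real ^ 'n \<Rightarrow> real ^ 'n" where
  "dilation \<nu> r x = (\<chi> i. r powr \<nu> i * x $ i)"

definition homogeneous_dim :: "('n::finite \<Rightarrow> real) \<Rightarrow> real" where
  "homogeneous_dim \<nu> = (\<Sum>i\<in>UNIV. \<nu> i)"

locale homogeneous_group = group G
  for G :: "(real ^ 'n) monoid" (structure) +
  fixes \<nu> :: "'n \<Rightarrow> real"
  assumes carrier_eq: "carrier G = UNIV"
    and one_eq: "\<one> = 0"
    and smooth_mult: "smooth (\<lambda>(x, y). x \<otimes> y)"
    and smooth_inv: "smooth (\<lambda>x. inv x)"
    and exponents_pos: "\<nu> i > 0"
    and dilation_automorphism: "r > 0 \<Longrightarrow> dilation \<nu> r \<in> iso G G"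

locale homogeneous_quasi_norm = homogeneous_group G \<nu>
  for G :: "(real ^ 'n) monoid" (structure) and \<nu> :: "'n \<Rightarrow> real" +
  fixes qn :: "real ^ 'n \<Rightarrow> real"
  assumes qn_continuous: "continuous_on UNIV qn"
    and qn_nonneg: "0 \<le> qn x"
    and qn_inv: "qn (inv x) = qn x"
    and qn_dilation: "r > 0 \<Longrightarrow> qn (dilation \<nu> r x) = r * qn x"
    and qn_eq_0_iff: "qn x = 0 \<longleftrightarrow> x = 0"

text \<open>
  Left Haar measures on the Borel sets. Regularity is not listed: on \<open>\<real>\<^sup>N\<close> every Borel measure
  that is finite on compact sets is regular. Homogeneous groups are unimodular, so left and
  right Haar measures coincide.
  The Lebesgue spaces and integrals are taken over \<open>completion M\<close> (for \<open>lborel\<close> this is \<open>lebesgue\<close>),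
  so that functions need not be Borel.
\<close>

definition haar_measure :: "(real ^ 'n) monoid \<Rightarrow> (real ^ 'n) measure \<Rightarrow> bool" where
  "haar_measure G M \<longleftrightarrow>
    sets M = sets borel \<and>
    (\<forall>a. distr M borel (\<lambda>x. a \<otimes>\<^bsub>G\<^esub> x) = M) \<and>
    (\<forall>K. compact K \<longrightarrow> emeasure M K < \<infinity>) \<and>
    emeasure M UNIV \<noteq> 0"

definition Lp_member :: "'a measure \<Rightarrow> real \<Rightarrow> ('a \<Rightarrow> complex) \<Rightarrow> bool" where
  "Lp_member M p f \<longleftrightarrow>
    f \<in> borel_measurable M \<and> integrable M (\<lambda>x. norm (f x) powr p)"

text \<open>Only meaningful for functions satisfying \<open>Lp_member\<close>; otherwise the integral is 0 by convention.\<close>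

definition Lp_norm :: "'a measure \<Rightarrow> real \<Rightarrow> ('a \<Rightarrow> complex) \<Rightarrow> real" where
  "Lp_norm M p f = (LINT x|M. norm (f x) powr p) powr (1 / p)"

text \<open>
  The integrand of \<open>I\<^sub>\<lambda> u (x)\<close>, as a function of \<open>y\<close>. At \<open>y = x\<close>, where the quasi-norm vanishes,
  it takes the value 0; points are null sets, so this does not affect the integral.
\<close>

definition riesz_integrand ::
  "(real ^ 'n) monoid \<Rightarrow> (real ^ 'n \<Rightarrow> real) \<Rightarrow> real \<Rightarrow> (real ^ 'n \<Rightarrow> complex) \<Rightarrow>
    real ^ 'n \<Rightarrow> real ^ 'n \<Rightarrow> complex" where
  "riesz_integrand G qn l u x y = u y / complex_of_real (qn (inv\<^bsub>G\<^esub> y \<otimes>\<^bsub>G\<^esub> x) powr l)"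

text \<open>
  Where the integrand is not integrable, the Bochner integral below is 0 by convention, so
  results about \<open>riesz_potential\<close> have to assert integrability separately.
\<close>

definition riesz_potential ::
  "(real ^ 'n) monoid \<Rightarrow> (real ^ 'n) measure \<Rightarrow> (real ^ 'n \<Rightarrow> real) \<Rightarrow> real \<Rightarrow>
    (real ^ 'n \<Rightarrow> complex) \<Rightarrow> real ^ 'n \<Rightarrow> complex" where
  "riesz_potential G M qn l u x = (LINT y|M. riesz_integrand G qn l u x y)"

text \<open>
  The function \<open>x \<mapsto> |x|\<^sup>a f(x)\<close>. Since \<open>0 powr a = 0\<close> for every \<open>a\<close>, it is 0 at the origin,
  a null set.
\<close>

definition weighted ::
  "(real ^ 'n \<Rightarrow> real) \<Rightarrow> real \<Rightarrow> (real ^ 'n \<Rightarrow> complex) \<Rightarrow> real ^ 'n \<Rightarrow> complex" where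
  "weighted qn a f x = complex_of_real (qn x powr a) * f x"

end

theory Submission
  imports Defs
begin

text \<open>
  By dilation invariance the Jacobians of right translations and of the inversion are constant of
  modulus 1, so Lebesgue measure is a Haar measure, and every Haar measure is a multiple of it.
  Hence \<open>|x|\<close>, \<open>|y\<^sup>-\<^sup>1x|\<close> as a function of \<open>y\<close> and \<open>|y\<^sup>-\<^sup>1x|\<close> as a function of \<open>x\<close> all have the law
  \<open>V r\<^sup>Q\<^sup>-\<^sup>1 dr\<close>. This and the quasi-triangle inequality are all that the estimates use.

  The kernel \<open>|x|\<^sup>-\<^sup>\<beta> |y\<^sup>-\<^sup>1x|\<^sup>-\<^sup>\<lambda> |y|\<^sup>-\<^sup>\<alpha>\<close> is dominated by two Hardy kernels (where \<open>|y\<^sup>-\<^sup>1x|\<close> is comparable to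
  the larger one of \<open>|x|\<close> and \<open>|y|\<close>) and a kernel living where \<open>|x|\<close> and \<open>|y|\<close> are comparable. The Hardy kernels
  are bounded by the Schur test with power weights. The third one is at most the convolution kernel of
  the Hardy-Littlewood-Sobolev inequality if \<open>p < q\<close>, and satisfies the Schur test with weight 1
  if \<open>p = q\<close>. The Hardy-Littlewood-Sobolev inequality itself follows from splitting both the kernel and the
  function at heights tied to the level of the superlevel set being measured.
\<close>


section \<open>Change of variables with unit Jacobian\<close>

text \<open>The relation between the exponents is forced by scaling, and each inequality secures one
  convergence: \<open>\<alpha> < Q / p'\<close> makes |y|^-\<alpha> locally an L^p' function,
  \<open>\<beta> < Q / q\<close> makes |x|^-\<beta> locally an L^q function, and
  \<open>\<alpha> + \<beta> \<ge> 0\<close> allows |x| to be traded for |y^-1 x| where the latter is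
  smaller. The obstacle is that the Schur test only maps L^p to L^p, whereas \<open>p < q\<close> is
  allowed. For the Hardy kernels the gap is closed by a Hoelder bound of order |x|^(-Q/q) at every
  point, whose power q - p supplies the weight missing from degree -Q. The middle kernel is singular
  at y = x and its sections need not lie in L^p', so no such bound is available and superlevel sets
  have to be estimated instead. For p = q the convolution kernel would have the exponent -Q, which
  is not locally integrable; there the power of |x| must be kept. All estimates are for nonnegative
  functions with extended real integrals, and integrability is read off from finiteness at the
  end.\<close>

text \<open>The change of variables theorems of the library require a well-ordered index type.\<close>

typedef 'a wellordered = "UNIV :: 'a set" ..

text \<open>Any injection serves: the induced order is only there to meet the class constraint and
  never enters a statement about vectors.\<close>

definition index_of :: "'a::finite \<Rightarrow> nat" where
  "index_of = (SOME f. inj f)"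

lemma inj_index_of: "inj (index_of :: 'a::finite \<Rightarrow> nat)"
proof -
  have "\<exists>f :: 'a \<Rightarrow> nat. inj f"
    using finite_imp_inj_to_nat_seg[of "UNIV :: 'a set"] by auto
  then show ?thesis
    unfolding index_of_def by (rule someI_ex)
qed

instance wellordered :: (finite) finite
proof
  have "(UNIV :: 'a wellordered set) = range Abs_wellordered"
    by (metis Rep_wellordered_inverse surjI)
  then show "finite (UNIV :: 'a wellordered set)"
    by (metis finite finite_imageI)
qed

instantiation wellordered :: (finite) wellorder
begin

definition "x \<le> y \<longleftrightarrow> index_of (Rep_wellordered x) \<le> index_of (Rep_wellordered y)"
definition "x < y \<longleftrightarrow> index_of (Rep_wellordered x) < index_of (Rep_wellordered y)"

instance
proof
  fix x y z :: "'a wellordered" and P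
  show "x \<le> y \<Longrightarrow> y \<le> x \<Longrightarrow> x = y"
    by (metis Rep_wellordered_inject antisym inj_index_of injD less_eq_wellordered_def)
  show "P x" if "\<And>x. (\<And>y. y < x \<Longrightarrow> P y) \<Longrightarrow> P x"
  proof (induction x rule: measure_induct_rule[of "\<lambda>x. index_of (Rep_wellordered x)"])
    case (less x)
    show ?case
      by (rule that, rule less.IH) (simp add: less_wellordered_def)
  qed
qed (auto simp: less_eq_wellordered_def less_wellordered_def)

end

definition to_wo :: "real ^ 'n \<Rightarrow> real ^ 'n wellordered" where
  "to_wo x = (\<chi> i. x $ Rep_wellordered i)"

definition from_wo :: "real ^ 'n wellordered \<Rightarrow> real ^ 'n" where
  "from_wo x = (\<chi> i. x $ Abs_wellordered i)"

lemma from_to_wo [simp]: "from_wo (to_wo x) = x"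
  and to_from_wo [simp]: "to_wo (from_wo y) = y"
  by (auto simp: to_wo_def from_wo_def vec_eq_iff Abs_wellordered_inverse Rep_wellordered_inverse)

lemma linear_to_wo: "linear to_wo" and linear_from_wo: "linear from_wo"
  by (auto simp: to_wo_def from_wo_def vec_eq_iff intro!: linearI)

lemma measurable_wo [measurable]: "to_wo \<in> borel \<rightarrow>\<^sub>M borel" "from_wo \<in> borel \<rightarrow>\<^sub>M borel"
  by (simp_all add: borel_measurable_continuous_onI linear_continuous_on linear_to_wo linear_from_wo linear_linear)

lemma bij_Abs_wellordered: "bij (Abs_wellordered :: 'n \<Rightarrow> _)"
  by (rule bijI') (metis Abs_wellordered_inverse UNIV_I, metis Rep_wellordered_inverse)

lemma prod_Basis_cart: "(\<Prod>b\<in>Basis. x \<bullet> b) = (\<Prod>i\<in>UNIV. x $ i)" for x :: "real ^ 'n"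
proof -
  have "(Basis :: (real ^ 'n) set) = range (\<lambda>i. axis i 1)"
    by (auto simp: Basis_vec_def)
  moreover have "(\<Prod>b\<in>range (\<lambda>i. axis i 1). x \<bullet> b) = (\<Prod>i\<in>UNIV. x $ i)"
    by (subst prod.reindex) (auto simp: inj_on_def axis_eq_axis inner_axis)
  ultimately show ?thesis by metis
qed

text \<open>Renaming coordinates takes a box to a box with the same side lengths, and boxes
  determine Lebesgue measure.\<close>

lemma distr_lborel_to_wo: "distr lborel borel (to_wo :: real ^ 'n \<Rightarrow> _) = lborel"
proof (rule lborel_eqI[symmetric])
  fix l u :: "real ^ 'n wellordered"
  assume le: "\<And>b. b \<in> Basis \<Longrightarrow> l \<bullet> b \<le> u \<bullet> b"
  have le': "l $ i \<le> u $ i" for i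
    using le[of "axis i 1"] by (auto simp: inner_axis Basis_vec_def)
  have eq: "to_wo -` box l u = box (from_wo l) (from_wo u :: real ^ 'n)"
    apply (auto simp: mem_box_cart to_wo_def from_wo_def)
    apply (metis Abs_wellordered_inverse UNIV_I)
    apply (metis Abs_wellordered_inverse UNIV_I)
    by (metis Rep_wellordered_inverse)+
  have "emeasure (distr lborel borel to_wo) (box l u) = emeasure lborel (box (from_wo l) (from_wo u :: real ^ 'n))"
    by (simp add: emeasure_distr eq)
  also have "\<dots> = (\<Prod>b\<in>Basis. (from_wo u - from_wo l :: real ^ 'n) \<bullet> b)"
  proof (rule emeasure_lborel_box)
    fix b :: "real ^ 'n" assume "b \<in> Basis"
    then obtain i where "b = axis i 1" by (auto simp: Basis_vec_def)
    then show "from_wo l \<bullet> b \<le> from_wo u \<bullet> b" using le' by (simp add: inner_axis from_wo_def)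
  qed
  also have "(\<Prod>b\<in>Basis. (from_wo u - from_wo l :: real ^ 'n) \<bullet> b) = (\<Prod>i\<in>UNIV. u $ i - l $ i)"
    unfolding prod_Basis_cart by (simp add: from_wo_def vector_minus_component prod.reindex_bij_betw[OF bij_Abs_wellordered, of "\<lambda>i. u $ i - l $ i"])
  also have "\<dots> = (\<Prod>b\<in>Basis. (u - l) \<bullet> b)" unfolding prod_Basis_cart by simp
  finally show "emeasure (distr lborel borel (to_wo :: real ^ 'n \<Rightarrow> _)) (box l u) = ennreal (\<Prod>b\<in>Basis. (u - l) \<bullet> b)" .
qed simp

lemma distr_lborel_from_wo: "distr lborel borel (from_wo :: _ \<Rightarrow> real ^ 'n) = lborel"
proof -
  have "distr lborel borel (from_wo :: _ \<Rightarrow> real ^ 'n)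
      = distr (distr lborel borel to_wo) borel (from_wo :: _ \<Rightarrow> real ^ 'n)"
    by (simp add: distr_lborel_to_wo)
  also have "\<dots> = lborel"
    by (subst distr_distr) (auto simp: o_def distr_id2)
  finally show ?thesis .
qed

text \<open>Differentiability is asked of the inverse \<open>f\<close>, because the preimage of a
  box under \<open>g\<close> is the image of that box under \<open>f\<close>, and the change of
  variables formula measures images.\<close>

lemma distr_lborel_unimodular_wo:
  fixes f g :: "real ^ 'm::{finite,wellorder} \<Rightarrow> real ^ 'm::_"
  assumes der: "\<And>x. (f has_derivative f' x) (at x)"
    and det: "\<And>x. \<bar>det (matrix (f' x))\<bar> = 1"
    and fg: "\<And>x. f (g x) = x" and gf: "\<And>x. g (f x) = x"
    and [measurable]: "g \<in> borel \<rightarrow>\<^sub>M borel"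
  shows "distr lborel borel g = lborel"
proof (rule lborel_eqI[symmetric])
  fix l u :: "real ^ 'm::_"
  assume le: "\<And>b. b \<in> Basis \<Longrightarrow> l \<bullet> b \<le> u \<bullet> b"
  have inj: "inj_on f (box l u)" by (metis gf inj_on_def)
  have vim: "g -` box l u = f ` box l u"
    by (auto simp: gf) (metis fg imageI)
  have der': "(f has_derivative f' x) (at x within box l u)" for x
    using der has_derivative_at_withinI by blast
  have int: "(\<lambda>x. \<bar>det (matrix (f' x))\<bar>) integrable_on box l u"
    by (simp add: det integrable_on_const)
  have "f ` box l u \<in> lmeasurable"
    using measurable_differentiable_image_eq[of "box l u" f f'] der' inj int by simp
  moreover have "measure lebesgue (f ` box l u) = integral (box l u) (\<lambda>x. \<bar>det (matrix (f' x))\<bar>)"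
    using measure_differentiable_image_eq[of "box l u" f f'] der' inj int by simp
  moreover have "integral (box l u) (\<lambda>x. \<bar>det (matrix (f' x))\<bar>) = measure lebesgue (box l u)"
    unfolding det by (rule lmeasure_integral[symmetric]) simp
  ultimately have "emeasure lebesgue (f ` box l u) = emeasure lebesgue (box l u)"
    using emeasure_eq_measure2[of "f ` box l u" lebesgue]
      emeasure_eq_measure2[of "box l u" lebesgue] by simp
  \<comment> \<open>The formula for images only yields a Lebesgue set. As a preimage under
    \<open>g\<close> the image is Borel, so its \<open>lebesgue\<close> and \<open>lborel\<close>
    measures may be identified.\<close>
  moreover have "f ` box l u \<in> sets borel"
    unfolding vim[symmetric] by (rule measurable_sets_borel[of g borel]) auto
  ultimately have "emeasure lborel (f ` box l u) = emeasure lborel (box l u)"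
    by simp
  then show "emeasure (distr lborel borel g) (box l u) = ennreal (\<Prod>b\<in>Basis. (u - l) \<bullet> b)"
    using le by (simp add: emeasure_distr vim)
qed simp

text \<open>The determinant of \<open>f\<close>, up to the proof that reindexing does not change it.\<close>

definition jac :: "(real ^ 'n \<Rightarrow> real ^ 'n) \<Rightarrow> real" where
  "jac f = det (matrix (to_wo \<circ> f \<circ> from_wo))"

lemma jac_id: "jac (\<lambda>x :: real ^ 'n. x) = 1"
proof -
  have eq: "to_wo \<circ> (\<lambda>x. x) \<circ> from_wo = (id :: real ^ 'n wellordered \<Rightarrow> _)"
    by auto
  show ?thesis
    unfolding jac_def eq matrix_id_mat_1 by (rule det_I)
qed

lemma jac_compose:
  assumes "linear f" "linear g"
  shows "jac (f \<circ> g) = jac f * jac g"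
proof -
  have eq: "to_wo \<circ> (f \<circ> g) \<circ> from_wo = (to_wo \<circ> f \<circ> from_wo) \<circ> (to_wo \<circ> g \<circ> from_wo)"
    by (auto simp: o_def)
  show ?thesis
    unfolding jac_def eq det_mul[symmetric]
    by (subst matrix_compose) (auto intro!: linear_compose linear_to_wo linear_from_wo assms)
qed

lemma distr_lborel_unimodular:
  fixes f g :: "real ^ 'n \<Rightarrow> real ^ 'n"
  assumes der: "\<And>x. (f has_derivative f' x) (at x)"
    and det: "\<And>x. \<bar>jac (f' x)\<bar> = 1"
    and fg: "\<And>x. f (g x) = x" and gf: "\<And>x. g (f x) = x"
    and [measurable]: "g \<in> borel \<rightarrow>\<^sub>M borel"
  shows "distr lborel borel g = lborel"
proof -
  have *: "distr lborel borel (to_wo \<circ> g \<circ> from_wo) = lborel"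
  proof (rule distr_lborel_unimodular_wo)
    fix x
    have l: "(from_wo has_derivative from_wo) (at z)" "(to_wo has_derivative to_wo) (at z')" for z z'
      using linear_from_wo linear_to_wo by (auto intro: linear_imp_has_derivative)
    show "(to_wo \<circ> f \<circ> from_wo has_derivative to_wo \<circ> f' (from_wo x) \<circ> from_wo) (at x)"
      by (intro diff_chain_at l der)
    show "\<bar>det (matrix (to_wo \<circ> f' (from_wo x) \<circ> from_wo))\<bar> = 1"
      using det unfolding jac_def by blast
    show "(to_wo \<circ> g \<circ> from_wo) \<in> borel \<rightarrow>\<^sub>M borel"
      unfolding o_def by measurable
  qed (simp_all add: fg gf)
  have "g = from_wo \<circ> (to_wo \<circ> g \<circ> from_wo) \<circ> to_wo"
    by (auto simp: o_def)
  then have "distr lborel borel g = distr (distr (distr lborel borel to_wo) borel (to_wo \<circ> g \<circ> from_wo)) borel from_wo"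
    by (simp add: distr_distr o_assoc)
  also have "\<dots> = lborel"
    by (simp only: distr_lborel_to_wo * distr_lborel_from_wo)
  finally show ?thesis .
qed


section \<open>Haar measure on homogeneous groups\<close>

lemma smooth_differentiable: "smooth f \<Longrightarrow> f differentiable (at x)"
  unfolding smooth_def by (drule spec[of _ "Suc 0"]) simp

lemma smooth_has_derivative: "smooth f \<Longrightarrow> (f has_derivative frechet_derivative f (at x)) (at x)"
  using smooth_differentiable frechet_derivative_works by blast

lemma smooth_continuous_derivative:
  "smooth f \<Longrightarrow> continuous_on UNIV (\<lambda>x. frechet_derivative f (at x) v)"
  unfolding smooth_def by (drule spec[of _ "Suc 0"]) simp

lemma smooth_continuous_on: "smooth f \<Longrightarrow> continuous_on UNIV f"
  unfolding smooth_def by (drule spec[of _ 0]) simp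

text \<open>The determinant is a polynomial in the matrix entries, and each entry is a component of
  \<open>L z v\<close> for a fixed \<open>v\<close>. Hence continuity of the derivative in every
  single direction, as in \<open>C_k\<close>, suffices.\<close>

lemma continuous_on_jac:
  assumes "\<And>v. continuous_on S (\<lambda>z. L z v)"
  shows "continuous_on S (\<lambda>z. jac (L z))"
proof -
  have *: "continuous_on S (\<lambda>z. L z v $ i)" for v i
    using assms by (intro continuous_on_component)
  show ?thesis
    unfolding jac_def det_def matrix_def o_def to_wo_def by (simp, intro continuous_intros *)
qed

lemma linear_dilation: "linear (dilation \<nu> r)"
  by (auto simp: dilation_def vec_eq_iff algebra_simps intro!: linearI)

lemma dilation_0 [simp]: "dilation \<nu> r 0 = 0"
  by (simp add: dilation_def vec_eq_iff)

lemma dilation_1 [simp]: "dilation \<nu> 1 x = x"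
  by (simp add: dilation_def vec_eq_iff)

lemma dilation_dilation:
  "r > 0 \<Longrightarrow> s > 0 \<Longrightarrow> dilation \<nu> r (dilation \<nu> s x) = dilation \<nu> (r * s) x"
  by (simp add: dilation_def vec_eq_iff powr_mult)

lemma dilation_inverse [simp]: "r > 0 \<Longrightarrow> dilation \<nu> r (dilation \<nu> (1 / r) x) = x"
  by (simp add: dilation_dilation)

lemma jac_dilation_nonzero:
  assumes "r > 0"
  shows "jac (dilation \<nu> r) \<noteq> 0"
proof -
  have id: "dilation \<nu> r \<circ> dilation \<nu> (1 / r) = (\<lambda>x. x)"
    using assms by auto
  have "jac (dilation \<nu> r) * jac (dilation \<nu> (1 / r)) = jac (dilation \<nu> r \<circ> dilation \<nu> (1 / r))"
    by (simp add: jac_compose linear_dilation)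
  also have "\<dots> = 1"
    unfolding id by (rule jac_id)
  finally show ?thesis by auto
qed

text \<open>Take Jacobians on both sides of the intertwining relation and cancel the nonzero factor
  of the dilation. For a map that commutes with dilations this makes the Jacobian constant along
  dilation orbits.\<close>

lemma jac_conj_dilation:
  assumes "r > 0" "linear f" "linear g" "g \<circ> dilation \<nu> r = dilation \<nu> r \<circ> f"
  shows "jac g = jac f"
proof -
  have "jac g * jac (dilation \<nu> r) = jac (dilation \<nu> r) * jac f"
    using assms by (metis jac_compose linear_dilation)
  then show ?thesis
    using jac_dilation_nonzero[OF assms(1), of \<nu>] by simp
qed

section \<open>Invariance of Lebesgue measure under right translations and inversion\<close>

context homogeneous_group
begin

lemma one_zero [simp]: "\<one> = 0" and carrier_UNIV [simp]: "carrier G = UNIV"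
  using one_eq carrier_eq by auto

lemma mult_zero [simp]: "x \<otimes> 0 = x" "0 \<otimes> x = x"
  using r_one[of x] l_one[of x] by simp_all

lemma mult_inv [simp]: "inv x \<otimes> x = 0" "x \<otimes> inv x = 0" "inv (inv x) = x" "inv 0 = 0"
  using l_inv[of x] r_inv[of x] inv_inv[of x] inv_one by simp_all

lemma mult_assoc: "x \<otimes> y \<otimes> z = x \<otimes> (y \<otimes> z)"
  using m_assoc[of x y z] by simp

lemma inv_mult_cancel [simp]: "inv x \<otimes> (x \<otimes> y) = y" "x \<otimes> (inv x \<otimes> y) = y"
  by (simp_all add: mult_assoc[symmetric])

lemma dilation_mult: "r > 0 \<Longrightarrow> dilation \<nu> r (x \<otimes> y) = dilation \<nu> r x \<otimes> dilation \<nu> r y"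
  using dilation_automorphism[of r] by (auto simp: iso_def hom_def)

lemma dilation_inv:
  assumes "r > 0"
  shows "dilation \<nu> r (inv x) = inv (dilation \<nu> r x)"
proof -
  have "dilation \<nu> r (inv x) \<otimes> dilation \<nu> r x = 0"
    using assms by (simp flip: dilation_mult)
  then show ?thesis
    using inv_equality[of "dilation \<nu> r (inv x)" "dilation \<nu> r x"] by simp
qed

lemma continuous_on_mult: "continuous_on UNIV (\<lambda>(x, y). x \<otimes> y)"
  using smooth_mult by (rule smooth_continuous_on)

lemma continuous_on_inv: "continuous_on UNIV (\<lambda>x. inv x)"
  using smooth_inv by (rule smooth_continuous_on)

lemma measurable_mult [measurable (raw)]:
  assumes [measurable]: "f \<in> M \<rightarrow>\<^sub>M borel" "g \<in> M \<rightarrow>\<^sub>M borel"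
  shows "(\<lambda>x. f x \<otimes> g x) \<in> M \<rightarrow>\<^sub>M borel"
  using borel_measurable_continuous_Pair[OF assms, of "\<lambda>x y. x \<otimes> y"] continuous_on_mult
  by (simp add: case_prod_unfold)

lemma measurable_inv [measurable (raw)]:
  assumes "f \<in> M \<rightarrow>\<^sub>M borel"
  shows "(\<lambda>x. inv (f x)) \<in> M \<rightarrow>\<^sub>M borel"
  using measurable_compose[OF assms borel_measurable_continuous_onI[OF continuous_on_inv]] .

text \<open>Positivity of the exponents makes every orbit contract to the identity, where the
  Jacobians can be computed.\<close>

lemma dilation_tendsto_0: "((\<lambda>r. dilation \<nu> r x) \<longlongrightarrow> 0) (at_right 0)"
proof (rule vec_tendstoI)
  fix i
  have "((\<lambda>r::real. r powr \<nu> i) \<longlongrightarrow> 0) (at_right 0)"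
    using exponents_pos[of i]
    by (intro tendsto_zero_powrI[where b="\<nu> i"] tendsto_const tendsto_ident_at)
       (auto simp: eventually_at_filter)
  then have "((\<lambda>r. r powr \<nu> i * x $ i) \<longlongrightarrow> 0 * x $ i) (at_right 0)"
    by (intro tendsto_mult tendsto_const)
  then show "((\<lambda>r. dilation \<nu> r x $ i) \<longlongrightarrow> 0 $ i) (at_right 0)"
    by (simp add: dilation_def)
qed

text \<open>The derivative is expressed through that of the joint product because a dilation moves
  \<open>x\<close> and \<open>a\<close> together, so continuity in both variables at once will be
  required.\<close>

lemma has_derivative_right_mult:
  "((\<lambda>x. x \<otimes> a) has_derivative
    (\<lambda>h. frechet_derivative (\<lambda>(x, y). x \<otimes> y) (at (x, a)) (h, 0))) (at x)"
proof -
  have "((\<lambda>x. (x, a)) has_derivative (\<lambda>h. (h, 0))) (at x)"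
    by (auto intro!: derivative_eq_intros)
  from diff_chain_at[OF this smooth_has_derivative[OF smooth_mult]]
  show ?thesis by (simp add: o_def)
qed

text \<open>A continuous dilation-invariant function is constant: let \<open>r \<rightarrow> 0\<close> in \<open>J (dilation \<nu> r z) = J z\<close>.\<close>

lemma jac_right_mult:
  "\<bar>jac (\<lambda>h. frechet_derivative (\<lambda>(x, y). x \<otimes> y) (at (x, a)) (h, 0))\<bar> = 1"
proof -
  define A where "A x a h = frechet_derivative (\<lambda>(x, y). x \<otimes> y) (at (x, a)) (h, 0)" for x a h
  note A = has_derivative_right_mult[folded A_def]
  have lin: "linear (A x a)" for x a
    using has_derivative_linear[OF A] .
  \<comment> \<open>The chain rule is applied to both sides of the automorphism identity; uniqueness
    of derivatives gives the intertwining relation between the derivatives at a point and at its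
    dilate.\<close>
  have scale: "jac (A (dilation \<nu> r x) (dilation \<nu> r a)) = jac (A x a)" if "r > 0" for r x a
  proof (rule jac_conj_dilation[OF that lin lin])
    have D: "(dilation \<nu> r has_derivative dilation \<nu> r) (at z)" for z
      by (rule linear_imp_has_derivative[OF linear_dilation])
    have eq: "(\<lambda>x. x \<otimes> dilation \<nu> r a) \<circ> dilation \<nu> r = dilation \<nu> r \<circ> (\<lambda>x. x \<otimes> a)"
      using that by (auto simp: dilation_mult)
    show "A (dilation \<nu> r x) (dilation \<nu> r a) \<circ> dilation \<nu> r = dilation \<nu> r \<circ> A x a"
      using diff_chain_at[OF D[of x] A[of "dilation \<nu> r a" "dilation \<nu> r x"]] diff_chain_at[OF A[of a x] D]
      unfolding eq by (rule has_derivative_unique)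
  qed
  have "continuous_on UNIV (\<lambda>z. jac (A (fst z) (snd z)))"
    unfolding A_def by (intro continuous_on_jac) (simp add: smooth_continuous_derivative smooth_mult)
  then have "isCont (\<lambda>z. jac (A (fst z) (snd z))) (0, 0)"
    by (simp add: continuous_on_eq_continuous_at)
  from isCont_tendsto_compose[OF this tendsto_Pair[OF dilation_tendsto_0[of x] dilation_tendsto_0[of a]]]
  have "((\<lambda>r. jac (A (dilation \<nu> r x) (dilation \<nu> r a))) \<longlongrightarrow> jac (A 0 0)) (at_right 0)"
    by simp
  then have "((\<lambda>r. jac (A x a)) \<longlongrightarrow> jac (A 0 0)) (at_right (0::real))"
    by (rule Lim_transform_eventually) (auto simp: scale eventually_at_filter)
  then have "jac (A x a) = jac (A 0 0)"
    by (intro tendsto_unique[OF _ tendsto_const]) auto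
  also have "A 0 0 = (\<lambda>h. h)"
    using has_derivative_unique[OF A[of 0 0], of "\<lambda>h. h"] by simp
  finally show ?thesis by (simp add: jac_id A_def)
qed

text \<open>The Jacobian is constant along orbits as for right translations. At 0 the derivative of
  the involution squares to the identity, which leaves the values 1 and -1; for the additive group
  it is (-1)^N, hence the absolute value.\<close>

lemma jac_inv: "\<bar>jac (frechet_derivative (\<lambda>x. inv x) (at x))\<bar> = 1"
proof -
  define A where "A x = frechet_derivative (\<lambda>x. inv x) (at x)" for x
  have A: "((\<lambda>x. inv x) has_derivative A x) (at x)" for x
    unfolding A_def by (rule smooth_has_derivative[OF smooth_inv])
  have lin: "linear (A x)" for x
    using has_derivative_linear[OF A] .
  have scale: "jac (A (dilation \<nu> r x)) = jac (A x)" if "r > 0" for r x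
  proof (rule jac_conj_dilation[OF that lin lin])
    have D: "(dilation \<nu> r has_derivative dilation \<nu> r) (at z)" for z
      by (rule linear_imp_has_derivative[OF linear_dilation])
    have eq: "(\<lambda>x. inv x) \<circ> dilation \<nu> r = dilation \<nu> r \<circ> (\<lambda>x. inv x)"
      using that by (auto simp: dilation_inv)
    show "A (dilation \<nu> r x) \<circ> dilation \<nu> r = dilation \<nu> r \<circ> A x"
      using diff_chain_at[OF D[of x] A] diff_chain_at[OF A[of x] D]
      unfolding eq by (rule has_derivative_unique)
  qed
  have "continuous_on UNIV (\<lambda>z. jac (A z))"
    unfolding A_def by (intro continuous_on_jac smooth_continuous_derivative smooth_inv)
  then have "isCont (\<lambda>z. jac (A z)) 0"
    by (simp add: continuous_on_eq_continuous_at)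
  from isCont_tendsto_compose[OF this dilation_tendsto_0[of x]]
  have "((\<lambda>r. jac (A (dilation \<nu> r x))) \<longlongrightarrow> jac (A 0)) (at_right 0)" .
  then have "((\<lambda>r. jac (A x)) \<longlongrightarrow> jac (A 0)) (at_right (0::real))"
    by (rule Lim_transform_eventually) (auto simp: scale eventually_at_filter)
  then have "jac (A x) = jac (A 0)"
    by (intro tendsto_unique[OF _ tendsto_const]) auto
  moreover have "A 0 \<circ> A 0 = (\<lambda>h. h)"
    using has_derivative_unique[of "\<lambda>x. x", OF _ has_derivative_ident] diff_chain_at[OF A A, of 0]
    by (simp add: o_def)
  then have "jac (A 0) * jac (A 0) = 1"
    using jac_compose[OF lin[of 0] lin[of 0]] by (simp add: jac_id)
  ultimately show ?thesis
    unfolding A_def by (metis abs_mult_self_eq abs_1 abs_square_eq_1 power2_eq_square)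
qed

lemma distr_lborel_right_mult: "distr lborel borel (\<lambda>x. x \<otimes> a) = lborel"
  by (rule distr_lborel_unimodular[OF has_derivative_right_mult[of "inv a"]])
     (use jac_right_mult in \<open>auto simp: mult_assoc\<close>)

lemma distr_lborel_inv: "distr lborel borel (\<lambda>x. inv x) = lborel"
  by (rule distr_lborel_unimodular[OF smooth_has_derivative[OF smooth_inv]])
     (use jac_inv in auto)

lemma nn_integral_right_mult:
  "f \<in> borel_measurable borel \<Longrightarrow> (\<integral>\<^sup>+x. f (x \<otimes> a) \<partial>lborel) = (\<integral>\<^sup>+x. f x \<partial>lborel)"
  using nn_integral_distr[of "\<lambda>x. x \<otimes> a" lborel borel f] by (simp add: distr_lborel_right_mult)

lemma nn_integral_inv:
  "f \<in> borel_measurable borel \<Longrightarrow> (\<integral>\<^sup>+x. f (inv x) \<partial>lborel) = (\<integral>\<^sup>+x. f x \<partial>lborel)"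
  using nn_integral_distr[of "\<lambda>x. inv x" lborel borel f] by (simp add: distr_lborel_inv)

text \<open>Inversion followed by a right translation. Both the double integral in the uniqueness
  proof and the law of |y^-1 x| as a function of \<open>y\<close> rest on this substitution.\<close>

lemma nn_integral_inv_mult:
  "f \<in> borel_measurable borel \<Longrightarrow> (\<integral>\<^sup>+y. f (inv y \<otimes> x) \<partial>lborel) = (\<integral>\<^sup>+x. f x \<partial>lborel)"
  using nn_integral_inv[of "\<lambda>y. f (y \<otimes> x)"] by (simp add: nn_integral_right_mult)

section \<open>Uniqueness of Haar measure\<close>

lemma haar_measure_sigma_finite:
  assumes "haar_measure G M"
  shows "sigma_finite_measure M"
proof
  have sets: "sets M = sets borel" and compact: "\<And>K. compact K \<Longrightarrow> emeasure M K < \<infinity>"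
    using assms by (auto simp: haar_measure_def)
  show "\<exists>A. countable A \<and> A \<subseteq> sets M \<and> \<Union>A = space M \<and> (\<forall>a\<in>A. emeasure M a \<noteq> \<infinity>)"
  proof (intro exI[of _ "range (\<lambda>n::nat. cball 0 (real n))"] conjI)
    show "\<Union> (range (\<lambda>n::nat. cball (0::real ^ 'n) (real n))) = space M"
      using real_arch_simple sets_eq_imp_space_eq[OF sets] by auto
  qed (use compact[OF compact_cball] sets in \<open>auto simp: less_top[symmetric]\<close>)
qed

text \<open>Uniqueness of Haar measure: compute the double integral of \<open>f x * g (y\<^sup>-\<^sup>1 x)\<close> in both orders.\<close>

lemma haar_measure_eq_lborel:
  assumes "haar_measure G M"
  shows "\<exists>c. 0 < c \<and> c < \<infinity> \<and> M = density lborel (\<lambda>_. c)"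
proof -
  have sets [measurable_cong]: "sets M = sets borel"
    and left: "\<And>a. distr M borel (\<lambda>x. a \<otimes> x) = M"
    and compact: "\<And>K. compact K \<Longrightarrow> emeasure M K < \<infinity>"
    and nontriv: "emeasure M UNIV \<noteq> 0"
    using assms by (auto simp: haar_measure_def)
  have space [simp]: "space M = UNIV"
    using sets_eq_imp_space_eq[OF sets] by simp
  interpret M: sigma_finite_measure M
    by (rule haar_measure_sigma_finite[OF assms])
  interpret P: pair_sigma_finite M "lborel :: (real ^ 'n) measure" ..
  have left': "(\<integral>\<^sup>+x. f (a \<otimes> x) \<partial>M) = (\<integral>\<^sup>+x. f x \<partial>M)" if [measurable]: "f \<in> borel_measurable borel" for f a
    using nn_integral_distr[of "\<lambda>x. a \<otimes> x" M borel f] by (simp add: left)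
  have key: "(\<integral>\<^sup>+x. f x \<partial>M) * (\<integral>\<^sup>+y. g y \<partial>lborel) = (\<integral>\<^sup>+x. f x \<partial>lborel) * (\<integral>\<^sup>+y. g y \<partial>M)"
    if [measurable]: "f \<in> borel_measurable borel" "g \<in> borel_measurable borel" for f g
  proof -
    have "(\<integral>\<^sup>+x. f x \<partial>M) * (\<integral>\<^sup>+y. g y \<partial>lborel) = (\<integral>\<^sup>+x. f x * (\<integral>\<^sup>+y. g (inv y \<otimes> x) \<partial>lborel) \<partial>M)"
      by (simp add: nn_integral_inv_mult nn_integral_multc)
    also have "\<dots> = (\<integral>\<^sup>+x. (\<integral>\<^sup>+y. f x * g (inv y \<otimes> x) \<partial>lborel) \<partial>M)"
      by (simp add: nn_integral_cmult)
    also have "\<dots> = (\<integral>\<^sup>+y. (\<integral>\<^sup>+x. f x * g (inv y \<otimes> x) \<partial>M) \<partial>lborel)"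
      by (rule P.Fubini'[symmetric]) measurable
    \<comment> \<open>Substituting \<open>y \<otimes> x\<close> for \<open>x\<close> is the left
      invariance of \<open>M\<close>. The changes of variable before and after it concern
      \<open>lborel\<close> and use only inversion and right translations.\<close>
    also have "\<dots> = (\<integral>\<^sup>+y. (\<integral>\<^sup>+x. f (y \<otimes> x) * g x \<partial>M) \<partial>lborel)"
    proof (rule nn_integral_cong)
      fix y
      show "(\<integral>\<^sup>+x. f x * g (inv y \<otimes> x) \<partial>M) = (\<integral>\<^sup>+x. f (y \<otimes> x) * g x \<partial>M)"
        using left'[of "\<lambda>x. f x * g (inv y \<otimes> x)" y] by simp
    qed
    also have "\<dots> = (\<integral>\<^sup>+x. (\<integral>\<^sup>+y. f (y \<otimes> x) * g x \<partial>lborel) \<partial>M)"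
      by (rule P.Fubini') measurable
    also have "\<dots> = (\<integral>\<^sup>+x. (\<integral>\<^sup>+y. f y \<partial>lborel) * g x \<partial>M)"
      by (simp add: nn_integral_multc nn_integral_right_mult)
    also have "\<dots> = (\<integral>\<^sup>+x. f x \<partial>lborel) * (\<integral>\<^sup>+y. g y \<partial>M)"
      by (simp add: nn_integral_cmult)
    finally show ?thesis .
  qed
  \<comment> \<open>The unit cube has Lebesgue measure 1, so it reads off the factor
    \<open>c\<close>, and its compactness makes \<open>c\<close> finite.\<close>
  define B :: "(real ^ 'n) set" where "B = cbox 0 One"
  have [measurable]: "B \<in> sets borel" by (simp add: B_def)
  have B1: "emeasure lborel B = 1"
    by (simp add: B_def emeasure_lborel_cbox)
  define c where "c = emeasure M B"
  have eq: "emeasure M A = c * emeasure lborel A" if [measurable]: "A \<in> sets borel" for A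
    using key[of "indicator A" "indicator B"] sets
    by (simp add: B1 c_def mult.commute)
  have "c < \<infinity>" unfolding c_def B_def by (rule compact) (rule compact_cbox)
  \<comment> \<open>If \<open>c\<close> were 0, then \<open>M\<close> would vanish on every Borel
    set, including the whole space.\<close>
  moreover have "0 < c"
    using eq[of UNIV] nontriv by (auto simp: zero_less_iff_neq_zero)
  moreover have "M = density lborel (\<lambda>_. c)"
    by (rule measure_eqI) (auto simp: sets eq emeasure_density nn_integral_cmult)
  ultimately show ?thesis by blast
qed

end


section \<open>Polar coordinates\<close>

lemma nn_integral_powr_from_0:
  fixes s b :: real
  assumes "s > 0" "b \<ge> 0"
  shows "(\<integral>\<^sup>+t. ennreal (t powr (s - 1)) * indicator {0<..b} t \<partial>lborel) = ennreal (b powr s / s)"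
proof -
  have "((\<lambda>t. t powr (s - 1)) has_integral (b powr s / s)) {0..b}"
    using has_integral_powr_from_0[of "s - 1" b] assms by simp
  then have "(\<integral>\<^sup>+t. ennreal (indicator {0..b} t * t powr (s - 1)) \<partial>lborel) = ennreal (b powr s / s)"
    by (intro nn_integral_has_integral_lebesgue) auto
  also have "(\<integral>\<^sup>+t. ennreal (indicator {0..b} t * t powr (s - 1)) \<partial>lborel)
      = (\<integral>\<^sup>+t. ennreal (t powr (s - 1)) * indicator {0<..b} t \<partial>lborel)"
    by (intro nn_integral_cong) (auto split: split_indicator)
  finally show ?thesis .
qed

lemma nn_integral_powr_to_inf:
  fixes s b :: real
  assumes "s > 0" "b > 0"
  shows "(\<integral>\<^sup>+t. ennreal (t powr (- s - 1)) * indicator {b..} t \<partial>lborel) = ennreal (b powr (- s) / s)"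
proof -
  have "((\<lambda>t. t powr (- s - 1)) has_integral (b powr (- s) / s)) {b..}"
    using has_integral_powr_to_inf[of "- s - 1" b] assms by simp
  then have "(\<integral>\<^sup>+t. ennreal (indicator {b..} t * t powr (- s - 1)) \<partial>lborel) = ennreal (b powr (- s) / s)"
    by (intro nn_integral_has_integral_lebesgue) auto
  also have "(\<integral>\<^sup>+t. ennreal (indicator {b..} t * t powr (- s - 1)) \<partial>lborel)
      = (\<integral>\<^sup>+t. ennreal (t powr (- s - 1)) * indicator {b..} t \<partial>lborel)"
    by (intro nn_integral_cong) (auto split: split_indicator)
  finally show ?thesis .
qed

text \<open>The law of a homogeneous quasi-norm, see \<open>distr_qn_radial\<close> below; \<open>V / Q\<close> is the measure of
  its unit ball.\<close>

definition radial :: "real \<Rightarrow> real \<Rightarrow> real measure" where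
  "radial V Q = density lborel (\<lambda>r. ennreal (V * r powr (Q - 1)) * indicator {0<..} r)"

lemma sets_radial [measurable_cong, simp]: "sets (radial V Q) = sets borel"
  and space_radial [simp]: "space (radial V Q) = UNIV"
  by (simp_all add: radial_def)

lemma nn_integral_radial:
  assumes "V \<ge> 0" and [measurable]: "f \<in> borel_measurable borel"
  shows "(\<integral>\<^sup>+r. f r \<partial>radial V Q)
    = ennreal V * (\<integral>\<^sup>+r. ennreal (r powr (Q - 1)) * (f r * indicator {0<..} r) \<partial>lborel)"
proof -
  have "(\<integral>\<^sup>+r. f r \<partial>radial V Q)
      = (\<integral>\<^sup>+r. ennreal V * (ennreal (r powr (Q - 1)) * (f r * indicator {0<..} r)) \<partial>lborel)"
    unfolding radial_def using assms(1)
    by (subst nn_integral_density) (auto simp: ennreal_mult mult_ac)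
  then show ?thesis by (simp add: nn_integral_cmult)
qed

lemma ennreal_powr_mult_powr: "ennreal (r powr a) * ennreal (r powr b) = ennreal (r powr (a + b))"
  by (simp add: powr_add ennreal_mult)

text \<open>The power is integrable at 0 for \<open>a < Q\<close> and, in the companion lemma, at
  infinity for \<open>a > Q\<close>. All spatial integrals evaluated in the estimates have one of
  these two shapes.\<close>

lemma nn_integral_radial_atMost:
  assumes "V \<ge> 0" "a < Q" "R \<ge> 0"
  shows "(\<integral>\<^sup>+r. ennreal (r powr (- a)) * indicator {..R} r \<partial>radial V Q)
    = ennreal (V * R powr (Q - a) / (Q - a))"
proof -
  have "ennreal (r powr (Q - 1)) * (ennreal (r powr (- a)) * indicator {..R} r * indicator {0<..} r)
      = ennreal (r powr (Q - a - 1)) * indicator {0<..R} r" for r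
    using ennreal_powr_mult_powr[of r "Q - 1" "- a"]
    by (auto split: split_indicator simp: algebra_simps)
  then have "(\<integral>\<^sup>+r. ennreal (r powr (- a)) * indicator {..R} r \<partial>radial V Q)
      = ennreal V * (\<integral>\<^sup>+r. ennreal (r powr (Q - a - 1)) * indicator {0<..R} r \<partial>lborel)"
    by (subst nn_integral_radial[OF assms(1)]) simp_all
  also have "\<dots> = ennreal V * ennreal (R powr (Q - a) / (Q - a))"
    using nn_integral_powr_from_0[of "Q - a" R] assms by simp
  also have "\<dots> = ennreal (V * R powr (Q - a) / (Q - a))"
    using assms by (simp flip: ennreal_mult)
  finally show ?thesis .
qed

lemma nn_integral_radial_atLeast:
  assumes "V \<ge> 0" "a > Q" "R > 0"
  shows "(\<integral>\<^sup>+r. ennreal (r powr (- a)) * indicator {R..} r \<partial>radial V Q)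
    = ennreal (V * R powr (Q - a) / (a - Q))"
proof -
  have "ennreal (r powr (Q - 1)) * (ennreal (r powr (- a)) * indicator {R..} r * indicator {0<..} r)
      = ennreal (r powr (- (a - Q) - 1)) * indicator {R..} r" for r
    using ennreal_powr_mult_powr[of r "Q - 1" "- a"] assms(3)
    by (auto split: split_indicator simp: algebra_simps)
  then have "(\<integral>\<^sup>+r. ennreal (r powr (- a)) * indicator {R..} r \<partial>radial V Q)
      = ennreal V * (\<integral>\<^sup>+r. ennreal (r powr (- (a - Q) - 1)) * indicator {R..} r \<partial>lborel)"
    by (subst nn_integral_radial[OF assms(1)]) simp_all
  also have "\<dots> = ennreal V * ennreal (R powr (- (a - Q)) / (a - Q))"
    using nn_integral_powr_to_inf[of "a - Q" R] assms by simp
  also have "\<dots> = ennreal (V * R powr (Q - a) / (a - Q))"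
    using assms by (simp flip: ennreal_mult)
  finally show ?thesis .
qed

lemma emeasure_radial_atMost:
  assumes "V \<ge> 0" "Q > 0"
  shows "emeasure (radial V Q) {..R} = ennreal (if R > 0 then V * R powr Q / Q else 0)"
proof -
  have "emeasure (radial V Q) {..R} = (\<integral>\<^sup>+r. indicator {..R} r \<partial>radial V Q)"
    by simp
  also have "\<dots> = ennreal V * (\<integral>\<^sup>+r. ennreal (r powr (Q - 1)) * (indicator {..R} r * indicator {0<..} r) \<partial>lborel)"
    by (rule nn_integral_radial[OF assms(1)]) simp
  also have "(\<integral>\<^sup>+r. ennreal (r powr (Q - 1)) * (indicator {..R} r * indicator {0<..} r) \<partial>lborel)
      = (\<integral>\<^sup>+r. ennreal (r powr (Q - 1)) * indicator {0<..max R 0} r \<partial>lborel)"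
    by (intro nn_integral_cong) (auto split: split_indicator)
  also have "\<dots> = ennreal (max R 0 powr Q / Q)"
    using assms by (intro nn_integral_powr_from_0) auto
  finally show ?thesis
    using assms by (auto simp flip: ennreal_mult)
qed

text \<open>The half-lines form an intersection-stable generator and exhaust the line with finite
  measure, so the distribution function determines the measure.\<close>

lemma eq_radialI:
  assumes "V \<ge> 0" "Q > 0" and sets: "sets M = sets borel"
    and eq: "\<And>R. emeasure M {..R} = ennreal (if R > 0 then V * R powr Q / Q else 0)"
  shows "M = radial V Q"
proof (rule measure_eqI_generator_eq_countable)
  let ?LT = "\<lambda>a::real. {..a}" let ?E = "range ?LT"
  show "Int_stable ?E"
    by (auto simp: Int_stable_def)
  show "?E \<subseteq> Pow UNIV" "sets M = sigma_sets UNIV ?E" "sets (radial V Q) = sigma_sets UNIV ?E"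
    unfolding sets sets_radial borel_eq_atMost by auto
  show "range (\<lambda>n::nat. {..real n}) \<subseteq> ?E" "\<Union>(range (\<lambda>n::nat. {..real n})) = UNIV"
    "countable (range (\<lambda>n::nat. {..real n}))"
    using real_arch_simple by auto
  show "emeasure M a \<noteq> \<infinity>" if "a \<in> range (\<lambda>n::nat. {..real n})" for a
    using that by (auto simp: eq)
qed (auto simp: eq emeasure_radial_atMost assms)


section \<open>Homogeneous quasi-norms\<close>

context homogeneous_group
begin

text \<open>A dilation is diagonal in the standard basis, and the product of its diagonal entries is
  \<open>r powr homogeneous_dim \<nu>\<close>.\<close>

lemma emeasure_lborel_dilation:
  assumes "r > 0" and [measurable]: "A \<in> sets borel"
  shows "emeasure lborel A = ennreal (r powr homogeneous_dim \<nu>) * emeasure lborel (dilation \<nu> r -` A)"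
proof -
  \<comment> \<open>The scale factors have to be a function of the basis vector. This linear form
    takes the value \<open>r powr \<nu> i\<close> at \<open>axis i 1\<close>, so the index need not
    be recovered from the vector.\<close>
  define c where "c b = (\<Sum>i\<in>UNIV. r powr \<nu> i * b $ i)" for b :: "real ^ 'n"
  have c: "c (axis i 1) = r powr \<nu> i" for i
    by (simp add: c_def axis_def if_distrib cong: if_cong)
  have range: "(Basis :: (real ^ 'n) set) = range (\<lambda>i. axis i 1)"
    by (auto simp: Basis_vec_def)
  have inj: "inj (\<lambda>i::'n. axis i (1::real))"
    by (auto simp: inj_on_def axis_eq_axis)
  have D: "0 + (\<Sum>j\<in>Basis. (c j * (x \<bullet> j)) *\<^sub>R j) = dilation \<nu> r x" for x :: "real ^ 'n"
    unfolding range
    by (subst sum.reindex[OF inj], simp add: c inner_axis)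
       (simp add: dilation_def vec_eq_iff axis_def if_distrib cong: if_cong)
  have prod: "(\<Prod>j\<in>Basis. \<bar>c j\<bar>) = r powr homogeneous_dim \<nu>"
    unfolding range using assms
    by (subst prod.reindex[OF inj]) (simp add: c homogeneous_dim_def powr_sum)
  have "c j \<noteq> 0" if "j \<in> Basis" for j
    using that assms unfolding range by (auto simp: c)
  from lborel_affine_euclidean[of c 0, OF this, unfolded D prod]
  have "emeasure lborel A = emeasure (density (distr lborel borel (dilation \<nu> r)) (\<lambda>_. r powr homogeneous_dim \<nu>)) A"
    by simp
  moreover have [measurable]: "dilation \<nu> r \<in> borel \<rightarrow>\<^sub>M borel"
    by (intro borel_measurable_continuous_onI linear_continuous_on) (simp add: linear_linear linear_dilation)
  ultimately show ?thesis
    by (simp add: emeasure_density nn_integral_cmult emeasure_distr)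
qed

end

context homogeneous_quasi_norm
begin

lemma measurable_qn [measurable (raw)]:
  assumes "f \<in> M \<rightarrow>\<^sub>M borel"
  shows "(\<lambda>x. qn (f x)) \<in> M \<rightarrow>\<^sub>M borel"
  using measurable_compose[OF assms borel_measurable_continuous_onI[OF qn_continuous]] .

text \<open>Intermediate value theorem along the orbit, which extends continuously to
  \<open>r = 0\<close> with value 0 because the exponents are positive.\<close>

lemma exists_dilation_norm_eq_1:
  assumes "norm x \<ge> 1"
  shows "\<exists>r. 0 < r \<and> r \<le> 1 \<and> norm (dilation \<nu> r x) = 1"
proof -
  have "continuous_on {0..1} (\<lambda>r. norm (dilation \<nu> r x))"
    unfolding dilation_def using exponents_pos
    by (intro continuous_intros continuous_on_vec_lambda continuous_on_powr') auto
  moreover have "norm (dilation \<nu> 0 x) = 0"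
    by (simp add: dilation_def vec_eq_iff)
  ultimately obtain r where r: "0 \<le> r" "r \<le> 1" "norm (dilation \<nu> r x) = 1"
    using IVT'[of "\<lambda>r. norm (dilation \<nu> r x)" 0 1 1] assms by auto
  moreover have "r \<noteq> 0"
    using r \<open>norm (dilation \<nu> 0 x) = 0\<close> by auto
  ultimately show ?thesis by (intro exI[of _ r]) auto
qed

text \<open>On the Euclidean unit sphere \<open>qn\<close> has a positive minimum \<open>m\<close>.
  If a point of the ball is moved to the sphere by the factor \<open>r\<close>, homogeneity gives
  \<open>m \<le> r\<close>, and undoing the dilation bounds its coordinates by
  \<open>m powr (- \<nu> i)\<close>.\<close>

lemma compact_qn_ball: "compact {x. qn x \<le> 1}"
proof -
  have "sphere 0 1 \<noteq> ({} :: (real ^ 'n) set)"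
    by (metis empty_iff mem_sphere_0 vector_choose_size zero_le_one)
  then obtain z where z: "norm z = 1" "\<And>x. norm x = 1 \<Longrightarrow> qn z \<le> qn x"
    using continuous_attains_inf[OF compact_sphere, of 0 1 qn] qn_continuous
      continuous_on_subset by (metis mem_sphere_0 subset_UNIV)
  define m where "m = qn z"
  have "m > 0"
    using z(1) qn_nonneg[of z] qn_eq_0_iff[of z] by (fastforce simp: m_def)
  have "norm x \<le> 1 + (\<Sum>i\<in>UNIV. m powr (- \<nu> i))" if x: "qn x \<le> 1" for x
  proof (cases "norm x \<le> 1")
    case True
    then show ?thesis by (simp add: add_increasing2 sum_nonneg)
  next
    case False
    then obtain r where r: "0 < r" "r \<le> 1" "norm (dilation \<nu> r x) = 1"
      using exists_dilation_norm_eq_1[of x] by auto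
    have "m \<le> r * qn x"
      using z(2)[OF r(3)] r by (simp add: m_def qn_dilation)
    also have "\<dots> \<le> r"
      using x r by (simp add: mult_left_le)
    finally have "m \<le> r" .
    have "\<bar>x $ i\<bar> \<le> m powr (- \<nu> i)" for i
    proof -
      have "r powr \<nu> i * \<bar>x $ i\<bar> \<le> 1"
        using component_le_norm_cart[of "dilation \<nu> r x" i] r by (simp add: dilation_def abs_mult)
      moreover have "m powr \<nu> i \<le> r powr \<nu> i"
        using \<open>m > 0\<close> \<open>m \<le> r\<close> exponents_pos[of i] by (intro powr_mono2) auto
      ultimately have "m powr \<nu> i * \<bar>x $ i\<bar> \<le> 1"
        by (meson abs_ge_zero mult_right_mono order_trans)
      then show ?thesis
        using \<open>m > 0\<close> by (simp add: powr_minus field_simps)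
    qed
    then have "(\<Sum>i\<in>UNIV. \<bar>x $ i\<bar>) \<le> (\<Sum>i\<in>UNIV. m powr (- \<nu> i))"
      by (intro sum_mono)
    with norm_le_l1_cart[of x] show ?thesis by linarith
  qed
  then have "bounded {x. qn x \<le> 1}"
    unfolding bounded_iff by blast
  moreover have "closed {x. qn x \<le> 1}"
    using closed_Collect_le[OF qn_continuous continuous_on_const] .
  ultimately show ?thesis
    by (simp add: compact_eq_bounded_closed)
qed

text \<open>Dilating by \<open>1 / (qn x + qn y)\<close> brings both points into the compact unit
  ball, on which the continuous function \<open>qn (x \<otimes> y)\<close> is bounded.\<close>

lemma qn_quasi_triangle: "\<exists>A>0. \<forall>x y. qn (x \<otimes> y) \<le> A * (qn x + qn y)"
proof -
  let ?B = "{x. qn x \<le> 1}"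
  have "compact ((\<lambda>(x, y). qn (x \<otimes> y)) ` (?B \<times> ?B))"
  proof (intro compact_continuous_image compact_Times compact_qn_ball)
    have "continuous_on UNIV (\<lambda>z. qn (case z of (x, y) \<Rightarrow> x \<otimes> y))"
      by (rule continuous_on_compose2[OF qn_continuous continuous_on_mult]) auto
    then show "continuous_on (?B \<times> ?B) (\<lambda>(x, y). qn (x \<otimes> y))"
      by (auto simp: case_prod_unfold intro: continuous_on_subset)
  qed
  then obtain A where A: "\<And>x y. qn x \<le> 1 \<Longrightarrow> qn y \<le> 1 \<Longrightarrow> \<bar>qn (x \<otimes> y)\<bar> \<le> A"
    unfolding bounded_iff[THEN iffD1, OF compact_imp_bounded]
    by (force dest!: compact_imp_bounded simp: bounded_iff)
  have "qn (x \<otimes> y) \<le> max A 1 * (qn x + qn y)" for x y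
  proof (cases "qn x + qn y = 0")
    case True
    then have "x = 0" "y = 0"
      using qn_nonneg[of x] qn_nonneg[of y] by (auto simp: qn_eq_0_iff[symmetric])
    then show ?thesis using qn_eq_0_iff[of 0] by simp
  next
    case False
    define s where "s = qn x + qn y"
    have s: "s > 0"
      using False qn_nonneg[of x] qn_nonneg[of y] by (simp add: s_def)
    have "qn (dilation \<nu> (1 / s) x) \<le> 1" "qn (dilation \<nu> (1 / s) y) \<le> 1"
      using s qn_nonneg[of x] qn_nonneg[of y] by (simp_all add: qn_dilation s_def)
    from A[OF this] have "1 / s * qn (x \<otimes> y) \<le> A"
      using s qn_nonneg[of "x \<otimes> y"] by (simp flip: dilation_mult add: qn_dilation)
    then have "qn (x \<otimes> y) \<le> A * s"
      using s by (simp add: field_simps)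
    also have "\<dots> \<le> max A 1 * s"
      using s by (intro mult_right_mono) auto
    finally show ?thesis by (simp add: s_def)
  qed
  then show ?thesis by (intro exI[of _ "max A 1"]) auto
qed

lemma homogeneous_dim_pos: "homogeneous_dim \<nu> > 0"
  unfolding homogeneous_dim_def using exponents_pos by (intro sum_pos) auto

text \<open>Dilation by \<open>R\<close> maps the unit ball onto the ball of radius
  \<open>R\<close>, whose measure therefore grows like \<open>R powr Q\<close>; for
  \<open>R \<le> 0\<close> the ball is contained in the null set of the origin.\<close>

lemma distr_qn_radial:
  assumes "0 < c" "c < \<infinity>"
  shows "\<exists>V\<ge>0. distr (density lborel (\<lambda>_. c)) borel qn = radial V (homogeneous_dim \<nu>)"
proof -
  define Q where "Q = homogeneous_dim \<nu>"
  have Q: "Q > 0" using homogeneous_dim_pos by (simp add: Q_def)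
  define v where "v = emeasure lborel {x. qn x \<le> 1}"
  have "v < \<infinity>"
    unfolding v_def by (rule emeasure_bounded_finite) (rule compact_imp_bounded[OF compact_qn_ball])
  then have "c * v < \<infinity>"
    using assms by (simp add: ennreal_mult_less_top)
  define V where "V = Q * enn2real (c * v)"
  have V: "c * v = ennreal (V / Q)" "V \<ge> 0"
    using \<open>c * v < \<infinity>\<close> Q by (auto simp: V_def)
  have "distr (density lborel (\<lambda>_. c)) borel qn = radial V Q"
  proof (rule eq_radialI)
    fix R :: real
    have "emeasure (distr (density lborel (\<lambda>_. c)) borel qn) {..R} = c * emeasure lborel {x. qn x \<le> R}"
      by (subst emeasure_distr) (auto simp: emeasure_density nn_integral_cmult vimage_def)
    also have "\<dots> = ennreal (if R > 0 then V * R powr Q / Q else 0)"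
    proof (cases "R > 0")
      case True
      have "dilation \<nu> R -` {x. qn x \<le> R} = {x. qn x \<le> 1}"
        using True by (auto simp: qn_dilation)
      then have "c * emeasure lborel {x. qn x \<le> R} = ennreal (R powr Q) * (c * v)"
        using emeasure_lborel_dilation[OF True, of "{x. qn x \<le> R}"] by (simp add: v_def Q_def mult_ac)
      also have "\<dots> = ennreal (V * R powr Q / Q)"
        using V Q by (simp flip: ennreal_mult add: mult_ac)
      finally show ?thesis using True by simp
    next
      case False
      then have "{x. qn x \<le> R} \<subseteq> {0}"
        using qn_nonneg qn_eq_0_iff by (auto, metis less_eq_real_def not_less order_trans)
      then have "emeasure lborel {x. qn x \<le> R} = 0"
        by (metis emeasure_lborel_countable countable_insert countable_empty countable_subset)
      then show ?thesis using False by simp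
    qed
    finally show "emeasure (distr (density lborel (\<lambda>_. c)) borel qn) {..R}
        = ennreal (if R > 0 then V * R powr Q / Q else 0)" .
  qed (use V Q in auto)
  then show ?thesis using V unfolding Q_def by blast
qed

end


section \<open>Hoelder inequality and Schur test\<close>

text \<open>Powers with exponent \<open>p > 0\<close>; for other exponents the value at \<open>\<infinity>\<close> is junk.\<close>

definition epow :: "ennreal \<Rightarrow> real \<Rightarrow> ennreal" where
  "epow x p = (if x = \<infinity> then \<infinity> else ennreal (enn2real x powr p))"

lemma epow_ennreal: "x \<ge> 0 \<Longrightarrow> epow (ennreal x) p = ennreal (x powr p)"
  by (simp add: epow_def)

lemma epow_top [simp]: "epow \<infinity> p = \<infinity>" "epow (top_class.top) p = top_class.top"
  and epow_0 [simp]: "epow 0 p = 0"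
  by (simp_all add: epow_def)

lemma epow_mono: "x \<le> y \<Longrightarrow> p > 0 \<Longrightarrow> epow x p \<le> epow y p"
  by (cases x; cases y) (auto simp: epow_ennreal powr_mono2 top_unique)

lemma epow_mult: "p > 0 \<Longrightarrow> epow (x * y) p = epow x p * epow y p"
  by (cases x; cases y)
     (auto simp: epow_ennreal powr_mult ennreal_mult_top ennreal_top_mult simp flip: ennreal_mult)

lemma measurable_epow [measurable (raw)]:
  assumes [measurable]: "f \<in> borel_measurable M"
  shows "(\<lambda>x. epow (f x) p) \<in> borel_measurable M"
  unfolding epow_def by measurable

text \<open>The sum is at most three times the maximum. This avoids convexity and is used once, to
  separate the three kernels.\<close>

lemma epow_add3_le:
  assumes "p > 0"
  shows "epow (x + y + z) p \<le> ennreal (3 powr p) * (epow x p + epow y p + epow z p)"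
proof -
  define m where "m = max x (max y z)"
  have "x + y + z \<le> m + m + m"
    unfolding m_def by (intro add_mono) (auto simp: le_max_iff_disj)
  also have "\<dots> = ennreal 3 * m"
  proof -
    have "ennreal 3 = 1 + 1 + 1" by simp
    then show ?thesis by (simp only: distrib_right mult_1)
  qed
  finally have "epow (x + y + z) p \<le> epow (ennreal 3 * m) p"
    using assms by (rule epow_mono)
  also have "\<dots> = ennreal (3 powr p) * epow m p"
    using assms by (simp add: epow_mult epow_ennreal flip: ennreal_numeral)
  also have "\<dots> \<le> ennreal (3 powr p) * (epow x p + epow y p + epow z p)"
    unfolding m_def max_def by (intro mult_left_mono) (auto intro: add_increasing add_increasing2)
  finally show ?thesis .
qed

text \<open>Integrate the derivative of t^q from 0 to \<open>z\<close>. The infinite case is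
  included because the function it is applied to is not yet known to be finite.\<close>

lemma epow_layer_cake:
  assumes "q > 0"
  shows "epow z q = (\<integral>\<^sup>+t. ennreal (q * t powr (q - 1)) * indicator {t. 0 < t \<and> ennreal t \<le> z} t \<partial>lborel)"
proof -
  have real: "(\<integral>\<^sup>+t. ennreal (q * t powr (q - 1)) * indicator {0<..b} t \<partial>lborel) = ennreal (b powr q)"
    if "b \<ge> 0" for b
  proof -
    have "(\<integral>\<^sup>+t. ennreal (q * t powr (q - 1)) * indicator {0<..b} t \<partial>lborel)
        = ennreal q * (\<integral>\<^sup>+t. ennreal (t powr (q - 1)) * indicator {0<..b} t \<partial>lborel)"
      using assms by (subst nn_integral_cmult[symmetric]) (auto simp: ennreal_mult mult_ac)
    then show ?thesis
      using nn_integral_powr_from_0[OF assms that] assms by (simp flip: ennreal_mult)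
  qed
  show ?thesis
  proof (cases z)
    case (real r)
    then have "{t. 0 < t \<and> ennreal t \<le> z} = {0<..r}" by auto
    with real show ?thesis using \<open>\<And>b. 0 \<le> b \<Longrightarrow> _ b\<close> by (simp add: epow_ennreal)
  next
    case top
    \<comment> \<open>The range up to \<open>x powr (1 / q)\<close> alone contributes
      \<open>x\<close>, so for infinite \<open>z\<close> the integral exceeds every real
      number.\<close>
    have *: "ennreal x \<le> (\<integral>\<^sup>+t. ennreal (q * t powr (q - 1)) * indicator {t. 0 < t \<and> ennreal t \<le> z} t \<partial>lborel)"
      if "x \<ge> 0" for x
    proof -
      have "ennreal x = (\<integral>\<^sup>+t. ennreal (q * t powr (q - 1)) * indicator {0<..x powr (1 / q)} t \<partial>lborel)"
        using real[of "x powr (1 / q)"] that assms by (simp add: powr_powr)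
      also have "\<dots> \<le> (\<integral>\<^sup>+t. ennreal (q * t powr (q - 1)) * indicator {t. 0 < t \<and> ennreal t \<le> z} t \<partial>lborel)"
        by (intro nn_integral_mono) (auto simp: top split: split_indicator)
      finally show ?thesis .
    qed
    have "(\<integral>\<^sup>+t. ennreal (q * t powr (q - 1)) * indicator {t. 0 < t \<and> ennreal t \<le> z} t \<partial>lborel) = \<infinity>"
    proof (cases "\<integral>\<^sup>+t. ennreal (q * t powr (q - 1)) * indicator {t. 0 < t \<and> ennreal t \<le> z} t \<partial>lborel")
      case (real r)
      with *[of "r + 1"] show ?thesis by simp
    qed simp
    then show ?thesis by (simp add: top)
  qed
qed

lemma conjugate_exponent:
  fixes p p' :: real
  assumes "p > 1" "1 / p + 1 / p' = 1"
  shows "p' = p / (p - 1)" "p' > 1" "p' * (p - 1) = p"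
proof -
  have "1 / p' = (p - 1) / p"
    using assms by (simp add: field_simps)
  then have "p' = 1 / ((p - 1) / p)"
    by (metis div_by_1 divide_divide_eq_right mult_1)
  then show eq: "p' = p / (p - 1)" by simp
  show "p' > 1" "p' * (p - 1) = p"
    using assms(1) by (simp_all add: eq)
qed

lemma conjugate_exponent_split:
  fixes p p' x :: real
  assumes "1 / p + 1 / p' = 1"
  shows "x / p + x / p' = x"
proof -
  have "x / p + x / p' = x * (1 / p + 1 / p')"
    by (simp add: distrib_left)
  then show ?thesis using assms by simp
qed

text \<open>The power form with a real bound for \<open>b\<close> alone is what the Schur test
  integrates: there the integral belonging to \<open>a\<close> may be infinite.\<close>

lemma nn_integral_Holder:
  fixes a b :: "'a \<Rightarrow> real"
  assumes p: "p > 1" "1 / p + 1 / p' = 1"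
    and [measurable]: "a \<in> borel_measurable M" "b \<in> borel_measurable M"
    and nonneg: "\<And>x. a x \<ge> 0" "\<And>x. b x \<ge> 0"
    and B: "B \<ge> 0" "(\<integral>\<^sup>+x. ennreal (b x powr p') \<partial>M) \<le> ennreal B"
  shows "epow (\<integral>\<^sup>+x. ennreal (a x * b x) \<partial>M) p \<le> ennreal (B powr (p - 1)) * (\<integral>\<^sup>+x. ennreal (a x powr p) \<partial>M)"
proof -
  have p': "p' > 1" "p' = p / (p - 1)"
    using conjugate_exponent[OF p] by auto
  define X where "X = (\<integral>\<^sup>+x. ennreal (a x powr p) \<partial>M)"
  \<comment> \<open>Young's inequality will be applied to \<open>a\<close> and \<open>b\<close>
    divided by the bounds for their norms, so the cases of a zero or infinite bound are set
    apart.\<close>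
  consider "X = 0 \<or> B = 0" | "B > 0" "X = \<infinity>" | x where "B > 0" "x > 0" "X = ennreal x"
    using B(1) by (cases X) (auto simp: less_le)
  then show ?thesis
  proof cases
    case 1
    then have "AE x in M. ennreal (a x * b x) = 0"
    proof
      assume "X = 0"
      then have "AE x in M. ennreal (a x powr p) = 0"
        unfolding X_def by (subst (asm) nn_integral_0_iff_AE) auto
      then show ?thesis
        by eventually_elim (auto simp: ennreal_eq_0_iff)
    next
      assume "B = 0"
      then have "AE x in M. ennreal (b x powr p') = 0"
        using B(2) nn_integral_0_iff_AE[of "\<lambda>x. ennreal (b x powr p')" M] by auto
      then show ?thesis
        by eventually_elim (auto simp: ennreal_eq_0_iff)
    qed
    then have "(\<integral>\<^sup>+x. ennreal (a x * b x) \<partial>M) = 0"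
      by (subst nn_integral_0_iff_AE) auto
    then show ?thesis by simp
  next
    case 2
    then show ?thesis by (simp add: X_def[symmetric] ennreal_mult_top)
  next
    case (3 x)
    \<comment> \<open>The norm of \<open>a\<close> times the bound for the norm of \<open>b\<close>,
      which is the expected estimate before raising it to the power \<open>p\<close>.\<close>
    define D where "D = x powr (1 / p) * B powr (1 / p')"
    have "D > 0" using 3 by (simp add: D_def)
    have young: "a t * b t \<le> D / (p * x) * a t powr p + D / (p' * B) * b t powr p'" for t
    proof -
      have "a t / x powr (1 / p) * (b t / B powr (1 / p'))
          \<le> (a t / x powr (1 / p)) powr p / p + (b t / B powr (1 / p')) powr p' / p'"
        using 3 p p' nonneg by (intro Youngs_inequality) auto
      also have "(a t / x powr (1 / p)) powr p = a t powr p / x"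
        using 3 p nonneg by (simp add: powr_divide powr_powr)
      also have "(b t / B powr (1 / p')) powr p' = b t powr p' / B"
        using 3 p'(1) nonneg by (simp add: powr_divide powr_powr)
      finally have "a t * b t / D \<le> a t powr p / (p * x) + b t powr p' / (p' * B)"
        by (simp add: D_def mult_ac)
      then show ?thesis
        using \<open>D > 0\<close> by (simp add: divide_le_eq) (simp add: algebra_simps)
    qed
    have "(\<integral>\<^sup>+t. ennreal (a t * b t) \<partial>M)
        \<le> (\<integral>\<^sup>+t. ennreal (D / (p * x)) * ennreal (a t powr p) + ennreal (D / (p' * B)) * ennreal (b t powr p') \<partial>M)"
      using young 3 p p' \<open>D > 0\<close>
      by (intro nn_integral_mono) (simp flip: ennreal_mult ennreal_plus)
    also have "\<dots> = ennreal (D / (p * x)) * X + ennreal (D / (p' * B)) * (\<integral>\<^sup>+t. ennreal (b t powr p') \<partial>M)"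
      unfolding X_def by (simp add: nn_integral_add nn_integral_cmult)
    also have "\<dots> \<le> ennreal (D / (p * x)) * ennreal x + ennreal (D / (p' * B)) * ennreal B"
      using 3 B by (intro add_mono mult_left_mono) auto
    also have "\<dots> = ennreal D"
    proof -
      have "D / (p * x) * x + D / (p' * B) * B = D * (1 / p + 1 / p')"
        using 3 by (simp add: field_simps)
      then show ?thesis
        using 3 p p' \<open>D > 0\<close> by (simp flip: ennreal_mult ennreal_plus)
    qed
    finally have "epow (\<integral>\<^sup>+t. ennreal (a t * b t) \<partial>M) p \<le> epow (ennreal D) p"
      using p by (intro epow_mono) auto
    also have "\<dots> = ennreal (B powr (p - 1)) * X"
    proof -
      have "D powr p = x * B powr (p / p')"
        using 3 p by (simp add: D_def powr_mult powr_powr)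
      also have "p / p' = p - 1" using p p' by simp
      finally show ?thesis
        using 3 \<open>D > 0\<close> by (simp add: epow_ennreal mult.commute flip: ennreal_mult)
    qed
    finally show ?thesis by (simp add: X_def)
  qed
qed

text \<open>Taking roots for \<open>a\<close> in the unit ball of L^p. This form bounds a kernel
  integral at a single point, with \<open>b\<close> a section of the kernel.\<close>

lemma nn_integral_Holder_le_1:
  fixes a b :: "'a \<Rightarrow> real"
  assumes p: "p > 1" "1 / p + 1 / p' = 1"
    and m: "a \<in> borel_measurable M" "b \<in> borel_measurable M"
    and nonneg: "\<And>x. a x \<ge> 0" "\<And>x. b x \<ge> 0"
    and B: "B \<ge> 0" "(\<integral>\<^sup>+x. ennreal (b x powr p') \<partial>M) \<le> ennreal B"
    and a: "(\<integral>\<^sup>+x. ennreal (a x powr p) \<partial>M) \<le> 1"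
  shows "(\<integral>\<^sup>+x. ennreal (a x * b x) \<partial>M) \<le> ennreal (B powr (1 / p'))"
proof -
  have eq: "(p - 1) * (1 / p) = 1 / p'"
    using p by (simp add: algebra_simps diff_divide_distrib)
  have "epow (\<integral>\<^sup>+x. ennreal (a x * b x) \<partial>M) p \<le> ennreal (B powr (p - 1)) * 1"
    by (rule order_trans[OF nn_integral_Holder[OF p m nonneg B]]) (intro mult_left_mono a, simp)
  then have *: "epow (\<integral>\<^sup>+x. ennreal (a x * b x) \<partial>M) p \<le> ennreal (B powr (p - 1))" by simp
  show ?thesis
  proof (cases "\<integral>\<^sup>+x. ennreal (a x * b x) \<partial>M")
    case (real z)
    with * have "z powr p \<le> B powr (p - 1)" by (simp add: epow_ennreal)
    then have "(z powr p) powr (1 / p) \<le> (B powr (p - 1)) powr (1 / p)"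
      using p by (intro powr_mono2) auto
    then have "z \<le> B powr (1 / p')"
      using p(1) real unfolding powr_powr eq by simp
    then show ?thesis using real by (simp add: ennreal_leI)
  next
    case top
    with * show ?thesis by (simp add: top_unique)
  qed
qed

context sigma_finite_measure
begin

text \<open>Factor the integrand into K^(1/p) f / h and K^(1/p') h. Hoelder's inequality and the
  first bound leave \<open>k x powr p\<close>, which the second bound removes after exchanging the
  integrals. Positivity of \<open>h\<close> is asked only where the kernel is nonzero because power
  weights take the value 0 at the origin.\<close>

lemma Schur_test:
  fixes K :: "'a \<Rightarrow> 'a \<Rightarrow> real" and h k f :: "'a \<Rightarrow> real"
  assumes p: "p > 1" "1 / p + 1 / p' = 1"
    and K_measurable: "(\<lambda>(x, y). K x y) \<in> borel_measurable (M \<Otimes>\<^sub>M M)"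
    and [measurable]: "h \<in> borel_measurable M" "k \<in> borel_measurable M" "f \<in> borel_measurable M"
    and nonneg: "\<And>x y. K x y \<ge> 0" "\<And>x. h x \<ge> 0" "\<And>x. k x \<ge> 0" "\<And>x. f x \<ge> 0"
    and pos: "\<And>x y. K x y \<noteq> 0 \<Longrightarrow> h y > 0"
    and c: "c1 \<ge> 0" "c2 \<ge> 0"
    and 1: "\<And>x. (\<integral>\<^sup>+y. ennreal (K x y * h y powr p') \<partial>M) \<le> ennreal (c1 * k x powr p')"
    and 2: "\<And>y. (\<integral>\<^sup>+x. ennreal (K x y * k x powr p) \<partial>M) \<le> ennreal (c2 * h y powr p)"
  shows "(\<integral>\<^sup>+x. epow (\<integral>\<^sup>+y. ennreal (K x y * f y) \<partial>M) p \<partial>M)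
    \<le> ennreal (c1 powr (p - 1) * c2) * (\<integral>\<^sup>+y. ennreal (f y powr p) \<partial>M)"
proof -
  interpret P: pair_sigma_finite M M ..
  have p': "p' > 0" "p' * (p - 1) = p"
    using conjugate_exponent[OF p] by auto
  have [measurable (raw)]: "(\<lambda>z. K (u z) (v z)) \<in> borel_measurable L"
    if "u \<in> L \<rightarrow>\<^sub>M M" "v \<in> L \<rightarrow>\<^sub>M M" for u v and L :: "'b measure"
    using measurable_compose[OF measurable_Pair[OF that] K_measurable] by simp
  have [measurable (raw)]: "(\<lambda>z. K (u z) (v z)) \<in> borel_measurable L"
    if "u \<in> L \<rightarrow>\<^sub>M M" "v \<in> L \<rightarrow>\<^sub>M M" for u v and L :: "'a measure"
    using measurable_compose[OF measurable_Pair[OF that] K_measurable] by simp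
  have [measurable (raw)]: "(\<lambda>z. K (u z) (v z)) \<in> borel_measurable L"
    if "u \<in> L \<rightarrow>\<^sub>M M" "v \<in> L \<rightarrow>\<^sub>M M" for u v and L :: "('a \<times> 'a) measure"
    using measurable_compose[OF measurable_Pair[OF that] K_measurable] by simp
  have x: "epow (\<integral>\<^sup>+y. ennreal (K x y * f y) \<partial>M) p
      \<le> (\<integral>\<^sup>+y. ennreal (c1 powr (p - 1)) * ennreal (k x powr p * (K x y * f y powr p / h y powr p)) \<partial>M)"
    if [measurable]: "x \<in> space M" for x
  proof -
    define a where "a y = K x y powr (1 / p) * f y / h y" for y
    define b where "b y = K x y powr (1 / p') * h y" for y
    have [measurable]: "a \<in> borel_measurable M" "b \<in> borel_measurable M"
      unfolding a_def b_def by measurable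
    have ab: "K x y * f y = a y * b y" for y
    proof (cases "K x y = 0")
      case False
      have "K x y powr (1 / p) * K x y powr (1 / p') = K x y"
        using p nonneg(1)[of x y] by (simp flip: powr_add)
      then show ?thesis
        using pos[OF False] by (simp add: a_def b_def mult_ac)
    qed (simp add: a_def b_def)
    have "b y powr p' = K x y * h y powr p'" for y
      using p' nonneg by (simp add: b_def powr_mult powr_powr)
    then have B: "(\<integral>\<^sup>+y. ennreal (b y powr p') \<partial>M) \<le> ennreal (c1 * k x powr p')"
      using 1 by simp
    have a_p: "a y powr p = K x y * f y powr p / h y powr p" for y
      using p nonneg by (simp add: a_def powr_divide powr_mult powr_powr)
    have "epow (\<integral>\<^sup>+y. ennreal (K x y * f y) \<partial>M) p
        \<le> ennreal ((c1 * k x powr p') powr (p - 1)) * (\<integral>\<^sup>+y. ennreal (a y powr p) \<partial>M)"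
      unfolding ab using B c nonneg
      by (intro nn_integral_Holder[OF p]) (auto simp: a_def b_def)
    also have "(c1 * k x powr p') powr (p - 1) = c1 powr (p - 1) * k x powr p"
      using c nonneg p' by (simp add: powr_mult powr_powr)
    also have "ennreal (c1 powr (p - 1) * k x powr p) * (\<integral>\<^sup>+y. ennreal (a y powr p) \<partial>M)
        = (\<integral>\<^sup>+y. ennreal (c1 powr (p - 1)) * ennreal (k x powr p * (K x y * f y powr p / h y powr p)) \<partial>M)"
      unfolding a_p[symmetric]
      by (subst nn_integral_cmult[symmetric]) (auto simp: ennreal_mult mult_ac)
    finally show ?thesis .
  qed
  have "(\<integral>\<^sup>+x. epow (\<integral>\<^sup>+y. ennreal (K x y * f y) \<partial>M) p \<partial>M)
      \<le> (\<integral>\<^sup>+x. (\<integral>\<^sup>+y. ennreal (c1 powr (p - 1)) * ennreal (k x powr p * (K x y * f y powr p / h y powr p)) \<partial>M) \<partial>M)"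
    by (intro nn_integral_mono x)
  also have "\<dots> = (\<integral>\<^sup>+y. (\<integral>\<^sup>+x. ennreal (c1 powr (p - 1)) * ennreal (k x powr p * (K x y * f y powr p / h y powr p)) \<partial>M) \<partial>M)"
    by (rule P.Fubini'[symmetric]) measurable
  also have "\<dots> \<le> (\<integral>\<^sup>+y. ennreal (c1 powr (p - 1) * c2) * ennreal (f y powr p) \<partial>M)"
  proof (rule nn_integral_mono)
    fix y assume [measurable]: "y \<in> space M"
    have "(\<integral>\<^sup>+x. ennreal (c1 powr (p - 1)) * ennreal (k x powr p * (K x y * f y powr p / h y powr p)) \<partial>M)
        = (\<integral>\<^sup>+x. ennreal (c1 powr (p - 1) * (f y powr p / h y powr p)) * ennreal (K x y * k x powr p) \<partial>M)"
      using nonneg by (intro nn_integral_cong) (simp flip: ennreal_mult add: mult_ac)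
    also have "\<dots> = ennreal (c1 powr (p - 1) * (f y powr p / h y powr p)) * (\<integral>\<^sup>+x. ennreal (K x y * k x powr p) \<partial>M)"
      by (rule nn_integral_cmult) measurable
    also have "\<dots> \<le> ennreal (c1 powr (p - 1) * (f y powr p / h y powr p)) * ennreal (c2 * h y powr p)"
      by (intro mult_left_mono 2) auto
    \<comment> \<open>If \<open>h y = 0\<close>, division by zero makes the left side 0.\<close>
    also have "\<dots> \<le> ennreal (c1 powr (p - 1) * c2) * ennreal (f y powr p)"
      using c by (cases "h y = 0") (auto simp flip: ennreal_mult simp: mult_ac)
    finally show "(\<integral>\<^sup>+x. ennreal (c1 powr (p - 1)) * ennreal (k x powr p * (K x y * f y powr p / h y powr p)) \<partial>M)
        \<le> ennreal (c1 powr (p - 1) * c2) * ennreal (f y powr p)" .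
  qed
  also have "\<dots> = ennreal (c1 powr (p - 1) * c2) * (\<integral>\<^sup>+y. ennreal (f y powr p) \<partial>M)"
    by (rule nn_integral_cmult) measurable
  finally show ?thesis .
qed

end


section \<open>Hardy kernels\<close>

lemma measurable_indicator_atMost [measurable (raw)]:
  fixes f g :: "'a \<Rightarrow> real"
  assumes [measurable]: "f \<in> borel_measurable M" "g \<in> borel_measurable M"
  shows "(\<lambda>x. indicator {..g x} (f x) :: 'b :: {zero_neq_one, topological_space}) \<in> borel_measurable M"
  unfolding indicator_def by simp measurable

lemma measurable_indicator_atLeast [measurable (raw)]:
  fixes f g :: "'a \<Rightarrow> real"
  assumes [measurable]: "f \<in> borel_measurable M" "g \<in> borel_measurable M"
  shows "(\<lambda>x. indicator {g x..} (f x) :: 'b :: {zero_neq_one, topological_space}) \<in> borel_measurable M"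
  unfolding indicator_def by simp measurable

text \<open>\<open>N x\<close> stands for |x| and \<open>d x y\<close> for |y^-1 x|. Symmetry of
  \<open>d\<close> is not among the axioms; instead its law and the quasi-triangle inequality are
  recorded in both variables.\<close>

locale radial_space = sigma_finite_measure M
  for M :: "'a measure" +
  fixes N :: "'a \<Rightarrow> real" and d :: "'a \<Rightarrow> 'a \<Rightarrow> real" and V Q A :: real
  assumes measurable_N [measurable]: "N \<in> borel_measurable M"
    and measurable_d: "(\<lambda>(x, y). d x y) \<in> borel_measurable (M \<Otimes>\<^sub>M M)"
    and nonneg [simp]: "0 \<le> N x" "0 \<le> d x y"
    and V_nonneg: "0 \<le> V" and Q_pos: "0 < Q" and A_ge_1: "1 \<le> A"
    and space_UNIV [simp]: "space M = UNIV"
    and distr_N: "distr M borel N = radial V Q"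
    and distr_d: "distr M borel (d x) = radial V Q" "distr M borel (\<lambda>x. d x y) = radial V Q"
    and quasi_triangle: "N x \<le> A * (N y + d x y)" "N y \<le> A * (N x + d x y)"
begin

lemma A_pos: "0 < A"
  using A_ge_1 by simp

lemma measurable_d_comp [measurable (raw)]:
  assumes "u \<in> L \<rightarrow>\<^sub>M M" "v \<in> L \<rightarrow>\<^sub>M M"
  shows "(\<lambda>z. d (u z) (v z)) \<in> borel_measurable L"
  using measurable_compose[OF measurable_Pair[OF assms] measurable_d] by simp

lemma nn_integral_powr_atMost:
  assumes [measurable]: "h \<in> borel_measurable M" and "distr M borel h = radial V Q"
    and "a < Q" "R \<ge> 0"
  shows "(\<integral>\<^sup>+x. ennreal (h x powr (- a)) * indicator {..R} (h x) \<partial>M) = ennreal (V * R powr (Q - a) / (Q - a))"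
  using nn_integral_distr[of h M borel "\<lambda>r. ennreal (r powr (- a)) * indicator {..R} r"]
    nn_integral_radial_atMost[of V a Q R] assms V_nonneg by simp

lemma nn_integral_powr_atLeast:
  assumes [measurable]: "h \<in> borel_measurable M" and "distr M borel h = radial V Q"
    and "a > Q" "R > 0"
  shows "(\<integral>\<^sup>+x. ennreal (h x powr (- a)) * indicator {R..} (h x) \<partial>M) = ennreal (V * R powr (Q - a) / (a - Q))"
  using nn_integral_distr[of h M borel "\<lambda>r. ennreal (r powr (- a)) * indicator {R..} r"]
    nn_integral_radial_atLeast[of V Q a R] assms V_nonneg by simp

text \<open>Schur test with weight \<open>N x powr (- s)\<close>. Since the kernel has degree -Q,
  both Schur integrals reproduce the weight; the integral over \<open>y\<close> converges at 0 if
  \<open>a + s * p' < Q\<close>, the one over \<open>x\<close> at infinity if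
  \<open>b + s * p > Q\<close>.\<close>

lemma hardy_inner_Schur:
  assumes p: "p > 1" "1 / p + 1 / p' = 1"
    and ab: "a + b = Q" "a < Q / p'"
  shows "\<exists>C\<ge>0. \<forall>f. f \<in> borel_measurable M \<longrightarrow> (\<forall>x. f x \<ge> 0) \<longrightarrow>
    (\<integral>\<^sup>+x. epow (\<integral>\<^sup>+y. ennreal (N x powr (- b) * N y powr (- a) * indicator {..N x} (N y) * f y) \<partial>M) p \<partial>M)
      \<le> ennreal C * (\<integral>\<^sup>+y. ennreal (f y powr p) \<partial>M)"
proof -
  have p': "p' > 1" "p' * (p - 1) = p"
    using conjugate_exponent[OF p] by auto
  \<comment> \<open>By \<open>1 / p + 1 / p' = 1\<close> this is \<open>a < Q / p'\<close>. It
    leaves room for an \<open>s\<close> meeting both convergence conditions.\<close>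
  have "a / p < (Q - a) / p'"
    using conjugate_exponent_split[OF p(2), of a] ab by (simp add: diff_divide_distrib)
  then obtain s where s: "a / p < s" "s < (Q - a) / p'"
    using dense by blast
  then have s': "a + s * p' < Q" "a < s * p"
    using p p' by (simp_all add: field_simps)
  define K where "K x y = N x powr (- b) * N y powr (- a) * indicator {..N x} (N y)" for x y
  define h where "h x = N x powr (- s)" for x
  have hm: "h \<in> borel_measurable M"
    unfolding h_def by measurable
  define c1 where "c1 = V / (Q - (a + s * p'))"
  define c2 where "c2 = V / (s * p - a)"
  have c: "c1 \<ge> 0" "c2 \<ge> 0"
    using s' V_nonneg by (auto simp: c1_def c2_def)
  have 1: "(\<integral>\<^sup>+y. ennreal (K x y * h y powr p') \<partial>M) \<le> ennreal (c1 * h x powr p')" for x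
  proof -
    have pw: "N y powr (- a) * (N y powr (- s)) powr p' = N y powr (- (a + s * p'))" for y
      by (simp add: powr_powr flip: powr_add)
    have "(\<integral>\<^sup>+y. ennreal (K x y * h y powr p') \<partial>M)
        = (\<integral>\<^sup>+y. ennreal (N x powr (- b)) * (ennreal (N y powr (- (a + s * p'))) * indicator {..N x} (N y)) \<partial>M)"
      unfolding pw[symmetric] K_def h_def
      by (intro nn_integral_cong) (auto simp: ennreal_mult mult_ac split: split_indicator)
    also have "\<dots> = ennreal (N x powr (- b)) * ennreal (V * N x powr (Q - (a + s * p')) / (Q - (a + s * p')))"
      using nn_integral_powr_atMost[OF measurable_N distr_N s'(1), of "N x"]
      by (simp add: nn_integral_cmult)
    also have "\<dots> = ennreal (c1 * (N x powr (- b) * N x powr (Q - (a + s * p'))))"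
      using s' V_nonneg by (simp add: c1_def mult_ac flip: ennreal_mult)
    also have "N x powr (- b) * N x powr (Q - (a + s * p')) = h x powr p'"
    proof -
      have "- b + (Q - (a + s * p')) = - s * p'" using ab by simp
      then show ?thesis by (simp only: h_def powr_powr powr_add[symmetric])
    qed
    finally show ?thesis by simp
  qed
  have 2: "(\<integral>\<^sup>+x. ennreal (K x y * h x powr p) \<partial>M) \<le> ennreal (c2 * h y powr p)" for y
  proof (cases "N y = 0")
    case True
    then show ?thesis by (simp add: K_def)
  next
    case False
    then have pos: "N y > 0" by (simp add: less_le)
    have gt: "b + s * p > Q" using s' ab by simp
    have pw: "N x powr (- b) * (N x powr (- s)) powr p = N x powr (- (b + s * p))" for x
      by (simp add: powr_powr flip: powr_add)
    have "(\<integral>\<^sup>+x. ennreal (K x y * h x powr p) \<partial>M)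
        = (\<integral>\<^sup>+x. ennreal (N y powr (- a)) * (ennreal (N x powr (- (b + s * p))) * indicator {N y..} (N x)) \<partial>M)"
      unfolding pw[symmetric] K_def h_def
      by (intro nn_integral_cong) (auto simp: ennreal_mult mult_ac split: split_indicator)
    also have "\<dots> = ennreal (N y powr (- a)) * ennreal (V * N y powr (Q - (b + s * p)) / (b + s * p - Q))"
      using nn_integral_powr_atLeast[OF measurable_N distr_N gt pos]
      by (simp add: nn_integral_cmult)
    also have "b + s * p - Q = s * p - a" using ab by simp
    also have "ennreal (N y powr (- a)) * ennreal (V * N y powr (Q - (b + s * p)) / (s * p - a))
        = ennreal (c2 * (N y powr (- a) * N y powr (Q - (b + s * p))))"
      using s' V_nonneg by (simp add: c2_def mult_ac flip: ennreal_mult)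
    also have "N y powr (- a) * N y powr (Q - (b + s * p)) = h y powr p"
    proof -
      have "- a + (Q - (b + s * p)) = - s * p" using ab by simp
      then show ?thesis by (simp only: h_def powr_powr powr_add[symmetric])
    qed
    finally show ?thesis by simp
  qed
  have "(\<integral>\<^sup>+x. epow (\<integral>\<^sup>+y. ennreal (K x y * f y) \<partial>M) p \<partial>M)
      \<le> ennreal (c1 powr (p - 1) * c2) * (\<integral>\<^sup>+y. ennreal (f y powr p) \<partial>M)"
    if "f \<in> borel_measurable M" "\<And>x. f x \<ge> 0" for f
  proof (rule Schur_test[OF p, where h = h and k = h])
    show "(\<lambda>(x, y). K x y) \<in> borel_measurable (M \<Otimes>\<^sub>M M)"
      unfolding K_def by measurable
    show "h y > 0" if "K x y \<noteq> 0" for x y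
      using that by (auto simp: K_def h_def less_le)
  qed (use that c 1 2 hm in \<open>auto simp: K_def h_def\<close>)
  then show ?thesis
    using c unfolding K_def by (intro exI[of _ "c1 powr (p - 1) * c2"]) auto
qed

text \<open>Now the \<open>y\<close>-integral extends to infinity and the \<open>x\<close>-integral
  to 0, so the conditions on the weight become \<open>b < s * p'\<close> and
  \<open>b + s * p < Q\<close>. Such an \<open>s\<close> exists because
  \<open>b < Q / p\<close>.\<close>

lemma hardy_outer_Schur:
  assumes p: "p > 1" "1 / p + 1 / p' = 1"
    and ab: "a + b = Q" "b < Q / p"
  shows "\<exists>C\<ge>0. \<forall>f. f \<in> borel_measurable M \<longrightarrow> (\<forall>x. f x \<ge> 0) \<longrightarrow>
    (\<integral>\<^sup>+x. epow (\<integral>\<^sup>+y. ennreal (N x powr (- b) * N y powr (- a) * indicator {N x..} (N y) * f y) \<partial>M) p \<partial>M)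
      \<le> ennreal C * (\<integral>\<^sup>+y. ennreal (f y powr p) \<partial>M)"
proof -
  have p': "p' > 1" "p' * (p - 1) = p"
    using conjugate_exponent[OF p] by auto
  have "b / p' < (Q - b) / p"
    using conjugate_exponent_split[OF p(2), of b] ab by (simp add: diff_divide_distrib)
  then obtain s where s: "b / p' < s" "s < (Q - b) / p"
    using dense by blast
  then have s': "b < s * p'" "b + s * p < Q"
    using p p' by (simp_all add: field_simps)
  define K where "K x y = N x powr (- b) * N y powr (- a) * indicator {N x..} (N y)" for x y
  define h where "h x = N x powr (- s)" for x
  have hm: "h \<in> borel_measurable M"
    unfolding h_def by measurable
  define c1 where "c1 = V / (s * p' - b)"
  define c2 where "c2 = V / (Q - (b + s * p))"
  have c: "c1 \<ge> 0" "c2 \<ge> 0"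
    using s' V_nonneg by (auto simp: c1_def c2_def)
  have 1: "(\<integral>\<^sup>+y. ennreal (K x y * h y powr p') \<partial>M) \<le> ennreal (c1 * h x powr p')" for x
  proof (cases "N x = 0")
    case True
    then show ?thesis by (simp add: K_def)
  next
    case False
    then have pos: "N x > 0" by (simp add: less_le)
    have gt: "a + s * p' > Q" using s' ab by simp
    have pw: "N y powr (- a) * (N y powr (- s)) powr p' = N y powr (- (a + s * p'))" for y
      by (simp add: powr_powr flip: powr_add)
    have "(\<integral>\<^sup>+y. ennreal (K x y * h y powr p') \<partial>M)
        = (\<integral>\<^sup>+y. ennreal (N x powr (- b)) * (ennreal (N y powr (- (a + s * p'))) * indicator {N x..} (N y)) \<partial>M)"
      unfolding pw[symmetric] K_def h_def
      by (intro nn_integral_cong) (auto simp: ennreal_mult mult_ac split: split_indicator)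
    also have "\<dots> = ennreal (N x powr (- b)) * ennreal (V * N x powr (Q - (a + s * p')) / (a + s * p' - Q))"
      using nn_integral_powr_atLeast[OF measurable_N distr_N gt pos]
      by (simp add: nn_integral_cmult)
    also have "a + s * p' - Q = s * p' - b" using ab by simp
    also have "ennreal (N x powr (- b)) * ennreal (V * N x powr (Q - (a + s * p')) / (s * p' - b))
        = ennreal (c1 * (N x powr (- b) * N x powr (Q - (a + s * p'))))"
      using s' V_nonneg by (simp add: c1_def mult_ac flip: ennreal_mult)
    also have "N x powr (- b) * N x powr (Q - (a + s * p')) = h x powr p'"
    proof -
      have "- b + (Q - (a + s * p')) = - s * p'" using ab by simp
      then show ?thesis by (simp only: h_def powr_powr powr_add[symmetric])
    qed
    finally show ?thesis by simp
  qed
  have 2: "(\<integral>\<^sup>+x. ennreal (K x y * h x powr p) \<partial>M) \<le> ennreal (c2 * h y powr p)" for y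
  proof -
    have pw: "N x powr (- b) * (N x powr (- s)) powr p = N x powr (- (b + s * p))" for x
      by (simp add: powr_powr flip: powr_add)
    have "(\<integral>\<^sup>+x. ennreal (K x y * h x powr p) \<partial>M)
        = (\<integral>\<^sup>+x. ennreal (N y powr (- a)) * (ennreal (N x powr (- (b + s * p))) * indicator {..N y} (N x)) \<partial>M)"
      unfolding pw[symmetric] K_def h_def
      by (intro nn_integral_cong) (auto simp: ennreal_mult mult_ac split: split_indicator)
    also have "\<dots> = ennreal (N y powr (- a)) * ennreal (V * N y powr (Q - (b + s * p)) / (Q - (b + s * p)))"
      using nn_integral_powr_atMost[OF measurable_N distr_N s'(2), of "N y"]
      by (simp add: nn_integral_cmult)
    also have "\<dots> = ennreal (c2 * (N y powr (- a) * N y powr (Q - (b + s * p))))"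
      using s' V_nonneg by (simp add: c2_def mult_ac flip: ennreal_mult)
    also have "N y powr (- a) * N y powr (Q - (b + s * p)) = h y powr p"
    proof -
      have "- a + (Q - (b + s * p)) = - s * p" using ab by simp
      then show ?thesis by (simp only: h_def powr_powr powr_add[symmetric])
    qed
    finally show ?thesis by simp
  qed
  have "(\<integral>\<^sup>+x. epow (\<integral>\<^sup>+y. ennreal (K x y * f y) \<partial>M) p \<partial>M)
      \<le> ennreal (c1 powr (p - 1) * c2) * (\<integral>\<^sup>+y. ennreal (f y powr p) \<partial>M)"
    if "f \<in> borel_measurable M" "\<And>x. f x \<ge> 0" for f
  proof (rule Schur_test[OF p, where h = h and k = h])
    show "(\<lambda>(x, y). K x y) \<in> borel_measurable (M \<Otimes>\<^sub>M M)"
      unfolding K_def by measurable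
    show "h y > 0" if "K x y \<noteq> 0" for x y
      using that by (auto simp: K_def h_def less_le)
  qed (use that c 1 2 hm in \<open>auto simp: K_def h_def\<close>)
  then show ?thesis
    using c unfolding K_def by (intro exI[of _ "c1 powr (p - 1) * c2"]) auto
qed

text \<open>The integral of \<open>d x y powr (- l)\<close> over a ball of radius \<open>N x\<close>
  is of order \<open>N x powr (Q - l)\<close> and cancels the first factor, so the weight 1
  suffices. Comparability of the norms gives the same for the integral over
  \<open>x\<close>.\<close>

lemma middle_Schur:
  assumes p: "p > 1" "1 / p + 1 / p' = 1" and l: "l < Q"
  shows "\<exists>C\<ge>0. \<forall>f. f \<in> borel_measurable M \<longrightarrow> (\<forall>x. f x \<ge> 0) \<longrightarrow>
    (\<integral>\<^sup>+x. epow (\<integral>\<^sup>+y. ennreal (N x powr (l - Q) * d x y powr (- l) *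
        (indicator {..N x} (d x y) * indicator {..2 * A * N y} (N x) * indicator {..2 * A * N x} (N y)) * f y) \<partial>M) p \<partial>M)
      \<le> ennreal C * (\<integral>\<^sup>+y. ennreal (f y powr p) \<partial>M)"
proof -
  define K where "K x y = N x powr (l - Q) * d x y powr (- l) *
    (indicator {..N x} (d x y) * indicator {..2 * A * N y} (N x) * indicator {..2 * A * N x} (N y))" for x y
  define c1 where "c1 = V / (Q - l)"
  \<comment> \<open>One factor \<open>(2 * A) powr (Q - l)\<close> comes from replacing
    \<open>N x\<close> by \<open>N y / (2 * A)\<close>, the other from the ball of radius
    \<open>2 * A * N y\<close>.\<close>
  define c2 where "c2 = (2 * A) powr (Q - l) * ((2 * A) powr (Q - l) * V / (Q - l))"
  have c: "c1 \<ge> 0" "c2 \<ge> 0"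
    using l V_nonneg by (auto simp: c1_def c2_def)
  have 1: "(\<integral>\<^sup>+y. ennreal (K x y * 1 powr p') \<partial>M) \<le> ennreal (c1 * 1 powr p')" for x
  proof -
    have "(\<integral>\<^sup>+y. ennreal (K x y * 1 powr p') \<partial>M)
        \<le> (\<integral>\<^sup>+y. ennreal (N x powr (l - Q)) * (ennreal (d x y powr (- l)) * indicator {..N x} (d x y)) \<partial>M)"
      by (intro nn_integral_mono) (auto simp: K_def ennreal_mult split: split_indicator)
    also have "\<dots> = ennreal (N x powr (l - Q)) * ennreal (V * N x powr (Q - l) / (Q - l))"
      using nn_integral_powr_atMost[OF _ distr_d(1) l, of x "N x"]
      by (simp add: nn_integral_cmult)
    also have "\<dots> = ennreal (c1 * (N x powr (l - Q) * N x powr (Q - l)))"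
      using l V_nonneg by (simp add: c1_def flip: ennreal_mult)
    \<comment> \<open>Only an inequality, since the product of the two powers is 0 when
      \<open>N x = 0\<close>.\<close>
    also have "\<dots> \<le> ennreal c1"
      using c by (intro ennreal_leI) (simp add: mult_left_le flip: powr_add)
    finally show ?thesis by simp
  qed
  have 2: "(\<integral>\<^sup>+x. ennreal (K x y * 1 powr p) \<partial>M) \<le> ennreal (c2 * 1 powr p)" for y
  proof -
    have "K x y \<le> (N y / (2 * A)) powr (l - Q) * (d x y powr (- l) * indicator {..2 * A * N y} (d x y))" for x
    proof (cases "K x y = 0")
      case False
      then have le: "d x y \<le> N x" "N x \<le> 2 * A * N y" "N y \<le> 2 * A * N x" and "N x \<noteq> 0"
        by (auto simp: K_def split: split_indicator_asm)
      then have "N y > 0"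
        using A_pos by (metis less_le mult_zero_right nonneg(1) order_antisym)
      \<comment> \<open>The exponent is negative, so it is the lower bound
        \<open>N y / (2 * A) \<le> N x\<close> that counts here.\<close>
      have "N x powr (l - Q) \<le> (N y / (2 * A)) powr (l - Q)"
        using le l \<open>N y > 0\<close> A_pos by (intro powr_mono2') (auto simp: field_simps)
      then show ?thesis
        using le by (auto simp: K_def intro!: mult_mono split: split_indicator)
    qed (simp add: split: split_indicator)
    then have "(\<integral>\<^sup>+x. ennreal (K x y * 1 powr p) \<partial>M)
        \<le> (\<integral>\<^sup>+x. ennreal ((N y / (2 * A)) powr (l - Q)) * (ennreal (d x y powr (- l)) * indicator {..2 * A * N y} (d x y)) \<partial>M)"
      by (intro nn_integral_mono) (auto simp flip: ennreal_mult ennreal_indicator intro!: ennreal_leI)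
    also have "\<dots> = ennreal ((N y / (2 * A)) powr (l - Q)) * ennreal (V * (2 * A * N y) powr (Q - l) / (Q - l))"
      using nn_integral_powr_atMost[OF _ distr_d(2) l, of y "2 * A * N y"] A_pos
      by (simp add: nn_integral_cmult)
    also have "\<dots> = ennreal (c2 * (N y powr (l - Q) * N y powr (Q - l)))"
    proof -
      have "(N y / (2 * A)) powr (l - Q) = (2 * A) powr (Q - l) * N y powr (l - Q)"
        using A_pos powr_minus[of "2 * A" "Q - l"] by (simp add: powr_divide field_simps)
      moreover have "(2 * A * N y) powr (Q - l) = (2 * A) powr (Q - l) * N y powr (Q - l)"
        using A_pos by (simp add: powr_mult)
      ultimately show ?thesis
        using l V_nonneg by (simp add: c2_def mult_ac flip: ennreal_mult)
    qed
    also have "\<dots> \<le> ennreal c2"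
      using c by (intro ennreal_leI) (simp add: mult_left_le flip: powr_add)
    finally show ?thesis by simp
  qed
  have "(\<integral>\<^sup>+x. epow (\<integral>\<^sup>+y. ennreal (K x y * f y) \<partial>M) p \<partial>M)
      \<le> ennreal (c1 powr (p - 1) * c2) * (\<integral>\<^sup>+y. ennreal (f y powr p) \<partial>M)"
    if "f \<in> borel_measurable M" "\<And>x. f x \<ge> 0" for f
  proof (rule Schur_test[OF p, where h = "\<lambda>_. 1" and k = "\<lambda>_. 1"])
    show "(\<lambda>(x, y). K x y) \<in> borel_measurable (M \<Otimes>\<^sub>M M)"
      unfolding K_def by measurable
  qed (use that c 1 2 in \<open>auto simp: K_def\<close>)
  then show ?thesis
    using c unfolding K_def by (intro exI[of _ "c1 powr (p - 1) * c2"]) auto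
qed


text \<open>A pointwise bound of the right homogeneity reduces \<open>L\<^sup>p \<rightarrow> L\<^sup>q\<close> to \<open>L\<^sup>p \<rightarrow> L\<^sup>p\<close>:
  \<open>(Kf)\<^sup>q = (Kf)\<^sup>p (Kf)\<^sup>q\<^sup>-\<^sup>p\<close>, and the second factor is absorbed into a power weight.\<close>

lemma lift_exponent:
  fixes K :: "'a \<Rightarrow> 'a \<Rightarrow> real"
  assumes p: "1 < p" "p < q" and c: "c \<ge> 0"
    and K_measurable: "(\<lambda>(x, y). K x y) \<in> borel_measurable (M \<Otimes>\<^sub>M M)"
    and [measurable]: "f \<in> borel_measurable M"
    and K: "\<And>x y. K x y \<ge> 0" and f: "\<And>x. f x \<ge> 0"
    and bound: "\<And>x. (\<integral>\<^sup>+y. ennreal (K x y * f y) \<partial>M) \<le> ennreal (c * N x powr (- Q / q))"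
  shows "(\<integral>\<^sup>+x. epow (\<integral>\<^sup>+y. ennreal (K x y * f y) \<partial>M) q \<partial>M)
    \<le> ennreal (c powr (q - p)) *
      (\<integral>\<^sup>+x. epow (\<integral>\<^sup>+y. ennreal (N x powr (- (Q / p - Q / q)) * K x y * f y) \<partial>M) p \<partial>M)"
proof -
  \<comment> \<open>Raising \<open>N x powr (- Q / q)\<close> to the power \<open>q - p\<close>
    gives \<open>N x powr (- e * p)\<close>, which is a weight \<open>N x powr (- e)\<close> inside
    the power \<open>p\<close>.\<close>
  define e where "e = Q / p - Q / q"
  have [measurable (raw)]: "(\<lambda>z. K (u z) (v z)) \<in> borel_measurable L"
    if "u \<in> L \<rightarrow>\<^sub>M M" "v \<in> L \<rightarrow>\<^sub>M M" for u v and L :: "'a measure"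
    using measurable_compose[OF measurable_Pair[OF that] K_measurable] by simp
  have [measurable (raw)]: "(\<lambda>z. K (u z) (v z)) \<in> borel_measurable L"
    if "u \<in> L \<rightarrow>\<^sub>M M" "v \<in> L \<rightarrow>\<^sub>M M" for u v and L :: "('a \<times> 'a) measure"
    using measurable_compose[OF measurable_Pair[OF that] K_measurable] by simp
  have "epow (\<integral>\<^sup>+y. ennreal (K x y * f y) \<partial>M) q
      \<le> ennreal (c powr (q - p)) * epow (\<integral>\<^sup>+y. ennreal (N x powr (- e) * K x y * f y) \<partial>M) p" for x
  proof -
    obtain z where z: "z \<ge> 0" "(\<integral>\<^sup>+y. ennreal (K x y * f y) \<partial>M) = ennreal z"
      using bound[of x] by (cases "\<integral>\<^sup>+y. ennreal (K x y * f y) \<partial>M") (auto simp: top_unique)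
    with bound[of x] c have zc: "z \<le> c * N x powr (- Q / q)"
      by (simp add: mult_nonneg_nonneg)
    have "z powr q = z powr (q - p) * z powr p"
      using p by (simp flip: powr_add)
    also have "\<dots> \<le> (c * N x powr (- Q / q)) powr (q - p) * z powr p"
      using z zc p by (intro mult_right_mono powr_mono2) auto
    also have "(c * N x powr (- Q / q)) powr (q - p) = c powr (q - p) * (N x powr (- e)) powr p"
    proof -
      have "- Q / q * (q - p) = - e * p"
        using p by (simp add: e_def field_simps)
      then show ?thesis
        using c by (simp add: powr_mult powr_powr)
    qed
    finally have le: "z powr q \<le> c powr (q - p) * (N x powr (- e) * z) powr p"
      using z by (simp add: powr_mult)
    have "(\<integral>\<^sup>+y. ennreal (N x powr (- e) * K x y * f y) \<partial>M)
        = (\<integral>\<^sup>+y. ennreal (N x powr (- e)) * ennreal (K x y * f y) \<partial>M)"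
      using K f by (intro nn_integral_cong) (simp add: mult.assoc flip: ennreal_mult)
    also have "\<dots> = ennreal (N x powr (- e) * z)"
      using z by (subst nn_integral_cmult) (simp_all add: ennreal_mult)
    finally show ?thesis
      using z le by (simp add: epow_ennreal flip: ennreal_mult)
  qed
  then have "(\<integral>\<^sup>+x. epow (\<integral>\<^sup>+y. ennreal (K x y * f y) \<partial>M) q \<partial>M)
      \<le> (\<integral>\<^sup>+x. ennreal (c powr (q - p)) * epow (\<integral>\<^sup>+y. ennreal (N x powr (- e) * K x y * f y) \<partial>M) p \<partial>M)"
    by (intro nn_integral_mono)
  also have "\<dots> = ennreal (c powr (q - p)) *
      (\<integral>\<^sup>+x. epow (\<integral>\<^sup>+y. ennreal (N x powr (- e) * K x y * f y) \<partial>M) p \<partial>M)"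
    by (rule nn_integral_cmult) measurable
  finally show ?thesis by (simp add: e_def)
qed

text \<open>With \<open>b + e\<close> in place of \<open>b\<close> the kernel has degree -Q and the
  Schur test applies. For \<open>p < q\<close> Hoelder's inequality bounds the integral at
  \<open>x\<close> by \<open>c * N x powr (- Q / q)\<close>, and \<open>lift_exponent\<close> turns
  this into the additional factor \<open>N x powr (- e)\<close>.\<close>

lemma hardy_inner:
  assumes p: "p > 1" "1 / p + 1 / p' = 1" "p \<le> q"
    and ab: "a + b = Q / q + Q / p'" "a < Q / p'"
  shows "\<exists>C\<ge>0. \<forall>f. f \<in> borel_measurable M \<longrightarrow> (\<forall>x. f x \<ge> 0) \<longrightarrow>
    (\<integral>\<^sup>+y. ennreal (f y powr p) \<partial>M) \<le> 1 \<longrightarrow>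
    (\<integral>\<^sup>+x. epow (\<integral>\<^sup>+y. ennreal (N x powr (- b) * N y powr (- a) * indicator {..N x} (N y) * f y) \<partial>M) q \<partial>M)
      \<le> ennreal C"
proof -
  have p': "p' > 1" "p' * (p - 1) = p"
    using conjugate_exponent[OF p(1,2)] by auto
  define e where "e = Q / p - Q / q"
  have pw: "N x powr (- (b + e)) = N x powr (- e) * N x powr (- b)" for x
    by (simp add: add.commute flip: powr_add)
  note Qp = conjugate_exponent_split[OF p(2), of Q]
  obtain C where C: "C \<ge> 0" "\<And>f. f \<in> borel_measurable M \<Longrightarrow> (\<And>x. f x \<ge> 0) \<Longrightarrow>
    (\<integral>\<^sup>+x. epow (\<integral>\<^sup>+y. ennreal (N x powr (- (b + e)) * N y powr (- a) * indicator {..N x} (N y) * f y) \<partial>M) p \<partial>M)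
      \<le> ennreal C * (\<integral>\<^sup>+y. ennreal (f y powr p) \<partial>M)"
    using hardy_inner_Schur[OF p(1,2), of a "b + e"] ab Qp by (auto simp: e_def)
  have C': "(\<integral>\<^sup>+x. epow (\<integral>\<^sup>+y. ennreal (N x powr (- (b + e)) * N y powr (- a) * indicator {..N x} (N y) * f y) \<partial>M) p \<partial>M)
      \<le> ennreal C" if "f \<in> borel_measurable M" "\<And>x. f x \<ge> 0" "(\<integral>\<^sup>+y. ennreal (f y powr p) \<partial>M) \<le> 1" for f
    using C(2)[OF that(1,2)] mult_left_mono[OF that(3), of "ennreal C"] by (auto intro: order_trans)
  show ?thesis
  proof (cases "p = q")
    case True
    then show ?thesis using C(1) C' by (auto simp: e_def)
  next
    case False
    define K where "K x y = N x powr (- b) * N y powr (- a) * indicator {..N x} (N y)" for x y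
    have Km: "(\<lambda>(x, y). K x y) \<in> borel_measurable (M \<Otimes>\<^sub>M M)"
      unfolding K_def by measurable
    have ap': "a * p' < Q"
      using ab p' by (simp add: field_simps)
    \<comment> \<open>The L^p' norm of the section \<open>K x\<close> when \<open>N x = 1\<close>;
      it is finite because \<open>a * p' < Q\<close>.\<close>
    define c where "c = (V / (Q - a * p')) powr (1 / p')"
    have "(\<integral>\<^sup>+x. epow (\<integral>\<^sup>+y. ennreal (K x y * f y) \<partial>M) q \<partial>M) \<le> ennreal (c powr (q - p) * C)"
      if f: "f \<in> borel_measurable M" "\<And>x. f x \<ge> 0" "(\<integral>\<^sup>+y. ennreal (f y powr p) \<partial>M) \<le> 1" for f
    proof -
      have "(\<integral>\<^sup>+y. ennreal (K x y * f y) \<partial>M) \<le> ennreal (c * N x powr (- Q / q))" for x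
      proof -
        define B where "B = N x powr (- (b * p')) * (V * N x powr (Q - a * p') / (Q - a * p'))"
        have "B \<ge> 0" using V_nonneg ap' by (simp add: B_def)
        have "(\<integral>\<^sup>+y. ennreal (K x y powr p') \<partial>M)
            = (\<integral>\<^sup>+y. ennreal (N x powr (- (b * p'))) * (ennreal (N y powr (- (a * p'))) * indicator {..N x} (N y)) \<partial>M)"
          by (intro nn_integral_cong)
             (auto simp: K_def powr_mult powr_powr ennreal_mult split: split_indicator)
        also have "\<dots> = ennreal B"
          using nn_integral_powr_atMost[OF measurable_N distr_N ap', of "N x"] V_nonneg ap'
          by (simp add: nn_integral_cmult B_def flip: ennreal_mult)
        finally have "(\<integral>\<^sup>+y. ennreal (f y * K x y) \<partial>M) \<le> ennreal (B powr (1 / p'))"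
          using f \<open>B \<ge> 0\<close> by (intro nn_integral_Holder_le_1[OF p(1,2)]) (auto simp: K_def)
        also have "B powr (1 / p') = c * N x powr (- Q / q)"
        proof -
          have "B = V / (Q - a * p') * N x powr (Q - a * p' - b * p')"
            by (simp add: B_def mult_ac flip: powr_add)
          then have "B powr (1 / p') = c * N x powr ((Q - a * p' - b * p') * (1 / p'))"
            using V_nonneg ap' by (simp add: powr_mult powr_divide powr_powr c_def)
          also have "(Q - a * p' - b * p') * (1 / p') = Q / p' - (a + b)"
            using p' by (simp add: field_simps)
          finally show ?thesis using ab by simp
        qed
        finally show ?thesis by (simp add: mult.commute)
      qed
      then have "(\<integral>\<^sup>+x. epow (\<integral>\<^sup>+y. ennreal (K x y * f y) \<partial>M) q \<partial>M)
        \<le> ennreal (c powr (q - p)) *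
          (\<integral>\<^sup>+x. epow (\<integral>\<^sup>+y. ennreal (N x powr (- e) * K x y * f y) \<partial>M) p \<partial>M)"
        unfolding e_def using False p f Km
        by (intro lift_exponent) (auto simp: c_def K_def)
      also have "(\<lambda>x y. N x powr (- e) * K x y * f y)
          = (\<lambda>x y. N x powr (- (b + e)) * N y powr (- a) * indicator {..N x} (N y) * f y)"
        by (simp only: pw K_def mult.assoc)
      also have "ennreal (c powr (q - p)) * (\<integral>\<^sup>+x. epow (\<integral>\<^sup>+y. ennreal (N x powr (- (b + e)) * N y powr (- a) * indicator {..N x} (N y) * f y) \<partial>M) p \<partial>M)
          \<le> ennreal (c powr (q - p)) * ennreal C"
        using C'[OF f] by (intro mult_left_mono) auto
      finally show ?thesis by (simp add: ennreal_mult' C)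
    qed
    then show ?thesis
      using C unfolding K_def by (intro exI[of _ "c powr (q - p) * C"]) auto
  qed
qed

text \<open>Here \<open>b < Q / q\<close> acts twice: it gives \<open>b + e < Q / p\<close> for the
  Schur test, and through the relation of the exponents \<open>a > Q / p'\<close>, so that the
  sections are in L^p' at infinity.\<close>

lemma hardy_outer:
  assumes p: "p > 1" "1 / p + 1 / p' = 1" "p \<le> q"
    and ab: "a + b = Q / q + Q / p'" "b < Q / q"
  shows "\<exists>C\<ge>0. \<forall>f. f \<in> borel_measurable M \<longrightarrow> (\<forall>x. f x \<ge> 0) \<longrightarrow>
    (\<integral>\<^sup>+y. ennreal (f y powr p) \<partial>M) \<le> 1 \<longrightarrow>
    (\<integral>\<^sup>+x. epow (\<integral>\<^sup>+y. ennreal (N x powr (- b) * N y powr (- a) * indicator {N x..} (N y) * f y) \<partial>M) q \<partial>M)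
      \<le> ennreal C"
proof -
  have p': "p' > 1" "p' * (p - 1) = p"
    using conjugate_exponent[OF p(1,2)] by auto
  define e where "e = Q / p - Q / q"
  have pw: "N x powr (- (b + e)) = N x powr (- e) * N x powr (- b)" for x
    by (simp add: add.commute flip: powr_add)
  note Qp = conjugate_exponent_split[OF p(2), of Q]
  obtain C where C: "C \<ge> 0" "\<And>f. f \<in> borel_measurable M \<Longrightarrow> (\<And>x. f x \<ge> 0) \<Longrightarrow>
    (\<integral>\<^sup>+x. epow (\<integral>\<^sup>+y. ennreal (N x powr (- (b + e)) * N y powr (- a) * indicator {N x..} (N y) * f y) \<partial>M) p \<partial>M)
      \<le> ennreal C * (\<integral>\<^sup>+y. ennreal (f y powr p) \<partial>M)"
    using hardy_outer_Schur[OF p(1,2), of a "b + e"] ab Qp by (auto simp: e_def)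
  have C': "(\<integral>\<^sup>+x. epow (\<integral>\<^sup>+y. ennreal (N x powr (- (b + e)) * N y powr (- a) * indicator {N x..} (N y) * f y) \<partial>M) p \<partial>M)
      \<le> ennreal C" if "f \<in> borel_measurable M" "\<And>x. f x \<ge> 0" "(\<integral>\<^sup>+y. ennreal (f y powr p) \<partial>M) \<le> 1" for f
    using C(2)[OF that(1,2)] mult_left_mono[OF that(3), of "ennreal C"] by (auto intro: order_trans)
  show ?thesis
  proof (cases "p = q")
    case True
    then show ?thesis using C(1) C' by (auto simp: e_def)
  next
    case False
    define K where "K x y = N x powr (- b) * N y powr (- a) * indicator {N x..} (N y)" for x y
    have Km: "(\<lambda>(x, y). K x y) \<in> borel_measurable (M \<Otimes>\<^sub>M M)"
      unfolding K_def by measurable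
    have "a > Q / p'"
      using ab by simp
    then have ap': "a * p' > Q"
      using p' by (simp add: field_simps)
    define c where "c = (V / (a * p' - Q)) powr (1 / p')"
    have "(\<integral>\<^sup>+x. epow (\<integral>\<^sup>+y. ennreal (K x y * f y) \<partial>M) q \<partial>M) \<le> ennreal (c powr (q - p) * C)"
      if f: "f \<in> borel_measurable M" "\<And>x. f x \<ge> 0" "(\<integral>\<^sup>+y. ennreal (f y powr p) \<partial>M) \<le> 1" for f
    proof -
      have "(\<integral>\<^sup>+y. ennreal (K x y * f y) \<partial>M) \<le> ennreal (c * N x powr (- Q / q))" for x
      proof (cases "N x = 0")
        case True
        then show ?thesis by (simp add: K_def)
      next
        case False
        then have pos: "N x > 0" by (simp add: less_le)
        define B where "B = N x powr (- (b * p')) * (V * N x powr (Q - a * p') / (a * p' - Q))"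
        have "B \<ge> 0" using V_nonneg ap' by (simp add: B_def)
        have "(\<integral>\<^sup>+y. ennreal (K x y powr p') \<partial>M)
            = (\<integral>\<^sup>+y. ennreal (N x powr (- (b * p'))) * (ennreal (N y powr (- (a * p'))) * indicator {N x..} (N y)) \<partial>M)"
          by (intro nn_integral_cong)
             (auto simp: K_def powr_mult powr_powr ennreal_mult split: split_indicator)
        also have "\<dots> = ennreal B"
          using nn_integral_powr_atLeast[OF measurable_N distr_N ap' pos] V_nonneg ap'
          by (simp add: nn_integral_cmult B_def flip: ennreal_mult)
        finally have "(\<integral>\<^sup>+y. ennreal (f y * K x y) \<partial>M) \<le> ennreal (B powr (1 / p'))"
          using f \<open>B \<ge> 0\<close> by (intro nn_integral_Holder_le_1[OF p(1,2)]) (auto simp: K_def)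
        also have "B powr (1 / p') = c * N x powr (- Q / q)"
        proof -
          have "B = V / (a * p' - Q) * N x powr (Q - a * p' - b * p')"
            by (simp add: B_def mult_ac flip: powr_add)
          then have "B powr (1 / p') = c * N x powr ((Q - a * p' - b * p') * (1 / p'))"
            using V_nonneg ap' by (simp add: powr_mult powr_divide powr_powr c_def)
          also have "(Q - a * p' - b * p') * (1 / p') = Q / p' - (a + b)"
            using p' by (simp add: field_simps)
          finally show ?thesis using ab by simp
        qed
        finally show ?thesis by (simp add: mult.commute)
      qed
      then have "(\<integral>\<^sup>+x. epow (\<integral>\<^sup>+y. ennreal (K x y * f y) \<partial>M) q \<partial>M)
        \<le> ennreal (c powr (q - p)) *
          (\<integral>\<^sup>+x. epow (\<integral>\<^sup>+y. ennreal (N x powr (- e) * K x y * f y) \<partial>M) p \<partial>M)"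
        unfolding e_def using False p f Km
        by (intro lift_exponent) (auto simp: c_def K_def)
      also have "(\<lambda>x y. N x powr (- e) * K x y * f y)
          = (\<lambda>x y. N x powr (- (b + e)) * N y powr (- a) * indicator {N x..} (N y) * f y)"
        by (simp only: pw K_def mult.assoc)
      also have "ennreal (c powr (q - p)) * (\<integral>\<^sup>+x. epow (\<integral>\<^sup>+y. ennreal (N x powr (- (b + e)) * N y powr (- a) * indicator {N x..} (N y) * f y) \<partial>M) p \<partial>M)
          \<le> ennreal (c powr (q - p)) * ennreal C"
        using C'[OF f] by (intro mult_left_mono) auto
      finally show ?thesis by (simp add: ennreal_mult' C)
    qed
    then show ?thesis
      using C unfolding K_def by (intro exI[of _ "c powr (q - p) * C"]) auto
  qed
qed

end


section \<open>The Hardy-Littlewood-Sobolev inequality\<close>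

context radial_space
begin

text \<open>At height \<open>t\<close> both the kernel and the function are split, at radius \<open>R = t powr (- q / Q)\<close> and at
  level \<open>s = t powr (q / p)\<close>. Everything except the short-range part of \<open>f * 1{f > s}\<close> is \<open>O(t)\<close>
  pointwise, so only this part matters for the measure of \<open>{x. Tf x > 2ct}\<close>, and it is
  estimated in \<open>L\<^sup>1\<close>.\<close>

lemma hardy_littlewood_sobolev:
  assumes p: "p > 1" "1 / p + 1 / p' = 1" "p < q"
    and m: "m = Q / q + Q / p'"
  shows "\<exists>C\<ge>0. \<forall>f. f \<in> borel_measurable M \<longrightarrow> (\<forall>x. f x \<ge> 0) \<longrightarrow>
    (\<integral>\<^sup>+y. ennreal (f y powr p) \<partial>M) \<le> 1 \<longrightarrow>
    (\<integral>\<^sup>+x. epow (\<integral>\<^sup>+y. ennreal (d x y powr (- m) * f y) \<partial>M) q \<partial>M) \<le> ennreal C"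
proof -
  interpret MM: pair_sigma_finite M M ..
  interpret MB: pair_sigma_finite M "lborel :: real measure" ..
  have p': "p' > 1"
    using conjugate_exponent[OF p(1,2)] by auto
  have q: "q > 1" using p by simp
  note Qp = conjugate_exponent_split[OF p(2), of Q]
  \<comment> \<open>From \<open>p < q\<close> follows \<open>m < Q\<close>, so the kernel is
    integrable near its singularity; \<open>m * p' > Q\<close> puts it in L^p' away from the
    singularity.\<close>
  have "Q / q < Q / p"
    using p Q_pos by (intro divide_strict_left_mono) auto
  then have mQ: "m < Q" using m Qp by simp
  have mp': "m * p' > Q"
    using m p' q Q_pos by (simp add: distrib_right)
  \<comment> \<open>At radius 1, \<open>c1\<close> is the L^p' norm of the far kernel and
    \<open>c2\<close> the integral of the near one. The summand 1 keeps \<open>c\<close> positive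
    even if \<open>V = 0\<close>.\<close>
  define c1 where "c1 = (V / (m * p' - Q)) powr (1 / p')"
  define c2 where "c2 = V / (Q - m)"
  define c where "c = c1 + c2 + 1"
  have c: "c1 \<ge> 0" "c2 \<ge> 0" "c > 0" "c2 \<le> c"
    using V_nonneg mQ by (auto simp: c1_def c2_def c_def add_nonneg_pos)
  \<comment> \<open>The radius balances two terms: the far part has size
    \<open>R t powr (- Q / q) = t\<close>, and since \<open>Q - m = Q / p - Q / q\<close>, the near
    kernel applied to the level \<open>s\<close> has size
    \<open>s * R t powr (Q - m) = t\<close>.\<close>
  define R where "R t = t powr (- q / Q)" for t
  \<comment> \<open>\<open>(2 * c) powr q\<close> undoes the scaling in \<open>z\<close>; the other
    factor is left by the integral over \<open>t\<close>.\<close>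
  define C where "C = (2 * c) powr q * (q / (q - q / p))"
  have e: "q - q / p > 0"
    using p q by (simp add: field_simps)
  have "(\<integral>\<^sup>+x. epow (\<integral>\<^sup>+y. ennreal (d x y powr (- m) * f y) \<partial>M) q \<partial>M) \<le> ennreal C"
    if f[measurable]: "f \<in> borel_measurable M" and f0: "\<And>x. f x \<ge> 0"
      and f1: "(\<integral>\<^sup>+y. ennreal (f y powr p) \<partial>M) \<le> 1" for f
  proof -
    define T where "T x = (\<integral>\<^sup>+y. ennreal (d x y powr (- m) * f y) \<partial>M)" for x
    define F where "F t y = (if t powr (q / p) < f y then f y else 0)" for t y
    define g where "g t x = (\<integral>\<^sup>+y. ennreal (d x y powr (- m) * indicator {..R t} (d x y)) * ennreal (F t y) \<partial>M)" for t x
    have [measurable]: "T \<in> borel_measurable M"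
      unfolding T_def by measurable
    have [measurable]: "F t \<in> borel_measurable M" for t
      unfolding F_def by measurable
    have [measurable]: "g t \<in> borel_measurable M" for t
      unfolding g_def by measurable
    have F0: "F t y \<ge> 0" for t y
      using f0 by (simp add: F_def)
    have T_le: "T x \<le> ennreal (c * t) + g t x" if t: "t > 0" for x t
    proof -
      have R: "R t > 0" using t by (simp add: R_def)
      \<comment> \<open>The two pieces overlap where \<open>d x y = R t\<close>; this is harmless,
        as the kernel only has to be dominated by their sum.\<close>
      define far where "far y = d x y powr (- m) * indicator {R t..} (d x y)" for y
      define near where "near y = d x y powr (- m) * indicator {..R t} (d x y)" for y
      have [measurable]: "far \<in> borel_measurable M" "near \<in> borel_measurable M"
        unfolding far_def near_def by measurable
      have far0: "far y \<ge> 0" "near y \<ge> 0" for y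
        by (auto simp: far_def near_def)
      define s where "s = t powr (q / p)"
      have "s \<ge> 0" by (simp add: s_def)
      \<comment> \<open>On the far piece \<open>f\<close> is kept whole, on the near piece it is
        bounded by \<open>s + F t y\<close>.\<close>
      have "d x y powr (- m) * f y \<le> f y * far y + s * near y + near y * F t y" for y
      proof -
        have "d x y powr (- m) \<le> far y \<or> (far y = 0 \<and> near y = d x y powr (- m))"
          by (auto simp: far_def near_def split: split_indicator)
        moreover have "near y * f y \<le> s * near y + near y * F t y"
        proof -
          have "f y \<le> s + F t y"
            by (simp add: F_def s_def)
          from mult_left_mono[OF this far0(2)[of y]] show ?thesis
            by (simp add: algebra_simps)
        qed
        moreover have "f y * far y \<ge> 0" "s * near y + near y * F t y \<ge> 0"
          using far0[of y] \<open>s \<ge> 0\<close> f0[of y] F0[of t y] by auto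
        ultimately show ?thesis
          using f0[of y] by (auto simp: mult.commute dest: mult_left_mono[of _ _ "f y"])
      qed
      then have "T x \<le> (\<integral>\<^sup>+y. ennreal (f y * far y) + ennreal s * ennreal (near y) + ennreal (near y) * ennreal (F t y) \<partial>M)"
        unfolding T_def using f0 far0 F0 \<open>s \<ge> 0\<close>
        by (intro nn_integral_mono) (simp flip: ennreal_mult ennreal_plus)
      also have "\<dots> = (\<integral>\<^sup>+y. ennreal (f y * far y) \<partial>M) + ennreal s * (\<integral>\<^sup>+y. ennreal (near y) \<partial>M) + g t x"
        unfolding g_def near_def[symmetric] by (simp add: nn_integral_add nn_integral_cmult)
      also have "(\<integral>\<^sup>+y. ennreal (f y * far y) \<partial>M) \<le> ennreal (c1 * t)"
      proof -
        define B where "B = V * R t powr (Q - m * p') / (m * p' - Q)"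
        have B: "B \<ge> 0" using V_nonneg mp' by (simp add: B_def)
        have "(\<integral>\<^sup>+y. ennreal (far y powr p') \<partial>M)
            = (\<integral>\<^sup>+y. ennreal (d x y powr (- (m * p'))) * indicator {R t..} (d x y) \<partial>M)"
          by (intro nn_integral_cong) (auto simp: far_def powr_powr split: split_indicator)
        also have "\<dots> = ennreal B"
          using nn_integral_powr_atLeast[OF _ distr_d(1) mp' R, of x] by (simp add: B_def)
        finally have "(\<integral>\<^sup>+y. ennreal (f y * far y) \<partial>M) \<le> ennreal (B powr (1 / p'))"
          using f0 far0 B f1 by (intro nn_integral_Holder_le_1[OF p(1,2)]) auto
        also have "B powr (1 / p') = c1 * R t powr ((Q - m * p') * (1 / p'))"
          using V_nonneg mp' by (simp add: B_def c1_def powr_mult powr_divide powr_powr)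
        also have "R t powr ((Q - m * p') * (1 / p')) = t"
        proof -
          have "(Q - m * p') * (1 / p') = - Q / q"
            using p' by (simp add: m field_simps)
          then show ?thesis
            using t q Q_pos by (simp add: R_def powr_powr)
        qed
        finally show ?thesis .
      qed
      also have "(\<integral>\<^sup>+y. ennreal (near y) \<partial>M) = ennreal (c2 * R t powr (Q - m))"
        using nn_integral_powr_atMost[OF _ distr_d(1) mQ, of x "R t"] R
        by (simp add: near_def c2_def ennreal_mult ennreal_indicator)
      also have "ennreal s * ennreal (c2 * R t powr (Q - m)) = ennreal (c2 * t)"
      proof -
        have "q / p + (- q / Q) * (Q - m) = 1"
        proof -
          have "(q / Q) * (Q - m) = (q / Q) * (Q / p - Q / q)"
            using Qp m by (metis add_diff_cancel_left' add_diff_add diff_add_cancel diff_diff_eq2)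
          also have "\<dots> = q / p - 1"
            using Q_pos q by (simp add: field_simps)
          finally show ?thesis by simp
        qed
        then have "s * R t powr (Q - m) = t"
          using t by (simp add: s_def R_def powr_powr flip: powr_add)
        then show ?thesis
          using \<open>s \<ge> 0\<close> c by (simp add: mult.left_commute flip: ennreal_mult)
      qed
      also have "ennreal (c1 * t) + ennreal (c2 * t) + g t x \<le> ennreal (c * t) + g t x"
        using c t by (intro add_right_mono) (simp add: c_def distrib_right flip: ennreal_plus)
      finally show ?thesis by (simp add: add_mono)
    qed
    \<comment> \<open>Integrating over \<open>x\<close> first, the near kernel contributes the same
      amount around every \<open>y\<close>.\<close>
    have g_le: "(\<integral>\<^sup>+x. g t x \<partial>M) = ennreal (c2 * t powr (1 - q / p)) * (\<integral>\<^sup>+y. ennreal (F t y) \<partial>M)"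
      if t: "t > 0" for t
    proof -
      have "(\<integral>\<^sup>+x. g t x \<partial>M)
          = (\<integral>\<^sup>+y. (\<integral>\<^sup>+x. ennreal (d x y powr (- m) * indicator {..R t} (d x y)) * ennreal (F t y) \<partial>M) \<partial>M)"
        unfolding g_def by (rule MM.Fubini'[symmetric]) measurable
      also have "\<dots> = (\<integral>\<^sup>+y. ennreal (c2 * R t powr (Q - m)) * ennreal (F t y) \<partial>M)"
      proof (intro nn_integral_cong)
        fix y
        show "(\<integral>\<^sup>+x. ennreal (d x y powr (- m) * indicator {..R t} (d x y)) * ennreal (F t y) \<partial>M)
            = ennreal (c2 * R t powr (Q - m)) * ennreal (F t y)"
          using nn_integral_powr_atMost[OF _ distr_d(2) mQ, of y "R t"]
          by (simp add: nn_integral_multc c2_def ennreal_mult ennreal_indicator R_def)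
      qed
      also have "\<dots> = ennreal (c2 * R t powr (Q - m)) * (\<integral>\<^sup>+y. ennreal (F t y) \<partial>M)"
        by (rule nn_integral_cmult) measurable
      also have "R t powr (Q - m) = t powr (1 - q / p)"
      proof -
        have "(- q / Q) * (Q - m) = (- q / Q) * (Q / p - Q / q)"
          using Qp m by (metis add_diff_cancel_left' add_diff_add diff_add_cancel diff_diff_eq2)
        also have "\<dots> = 1 - q / p"
          using Q_pos q by (simp add: field_simps)
        finally show ?thesis by (simp add: R_def powr_powr)
      qed
      finally show ?thesis .
    qed
    define z where "z x = ennreal (1 / (2 * c)) * T x" for x
    have [measurable]: "z \<in> borel_measurable M"
      unfolding z_def by measurable
    have level: "(\<integral>\<^sup>+x. (if ennreal t \<le> z x then 1 else 0) \<partial>M)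
        \<le> ennreal (t powr (- q / p)) * (\<integral>\<^sup>+y. ennreal (F t y) \<partial>M)" if t: "t > 0" for t
    proof -
      \<comment> \<open>Markov's inequality in pointwise form: \<open>ennreal t \<le> z x\<close>
        means that \<open>T x\<close> is at least \<open>2 * c * t\<close>, of which
        \<open>T_le\<close> attributes at most \<open>c * t\<close> to the terms other than
        \<open>g t x\<close>.\<close>
      have "(if ennreal t \<le> z x then 1 else 0) \<le> ennreal (1 / (c * t)) * g t x" for x
      proof (cases "ennreal t \<le> z x")
        case True
        have "ennreal (2 * c) * ennreal t \<le> ennreal (2 * c) * z x"
          using True by (rule mult_left_mono) simp
        also have "ennreal (2 * c) * z x = T x"
          using c unfolding z_def by (simp flip: mult.assoc ennreal_mult)
        also have "T x \<le> ennreal (c * t) + g t x"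
          by (rule T_le[OF t])
        finally have "ennreal (c * t) + ennreal (c * t) \<le> ennreal (c * t) + g t x"
          using c t by (simp add: mult.assoc flip: ennreal_mult ennreal_plus)
        then have "ennreal (c * t) \<le> g t x"
          by simp
        then have "ennreal (1 / (c * t)) * ennreal (c * t) \<le> ennreal (1 / (c * t)) * g t x"
          by (rule mult_left_mono) simp
        moreover have "ennreal (1 / (c * t)) * ennreal (c * t) = 1"
          using c t by (simp flip: ennreal_mult)
        ultimately show ?thesis using True by simp
      qed simp
      then have "(\<integral>\<^sup>+x. (if ennreal t \<le> z x then 1 else 0) \<partial>M) \<le> (\<integral>\<^sup>+x. ennreal (1 / (c * t)) * g t x \<partial>M)"
        by (intro nn_integral_mono)
      also have "\<dots> = ennreal (1 / (c * t)) * ennreal (c2 * t powr (1 - q / p)) * (\<integral>\<^sup>+y. ennreal (F t y) \<partial>M)"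
        by (simp add: nn_integral_cmult g_le[OF t] mult.assoc)
      also have "ennreal (1 / (c * t)) * ennreal (c2 * t powr (1 - q / p)) \<le> ennreal (t powr (- q / p))"
      proof -
        have "t powr (1 - q / p) = t * t powr (- q / p)"
          using t powr_add[of t 1 "- q / p"] by simp
        then have "1 / (c * t) * (c2 * t powr (1 - q / p)) = c2 / c * t powr (- q / p)"
          using t by simp
        also have "\<dots> \<le> 1 * t powr (- q / p)"
          using c by (intro mult_right_mono) auto
        finally show ?thesis
          using c t by (simp flip: ennreal_mult)
      qed
      finally show ?thesis by (simp add: mult_right_mono)
    qed
    have "(\<integral>\<^sup>+x. epow (z x) q \<partial>M)
        = (\<integral>\<^sup>+x. (\<integral>\<^sup>+t. ennreal (q * t powr (q - 1)) * (indicator {0<..} t * (if ennreal t \<le> z x then 1 else 0)) \<partial>lborel) \<partial>M)"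
      using q by (intro nn_integral_cong, subst epow_layer_cake)
        (auto intro!: nn_integral_cong split: split_indicator)
    also have "\<dots> = (\<integral>\<^sup>+t. (\<integral>\<^sup>+x. ennreal (q * t powr (q - 1)) * (indicator {0<..} t * (if ennreal t \<le> z x then 1 else 0)) \<partial>M) \<partial>lborel)"
      by (rule MB.Fubini'[symmetric]) measurable
    also have "\<dots> \<le> (\<integral>\<^sup>+t. (\<integral>\<^sup>+y. ennreal (q * t powr (q - q / p - 1)) * indicator {0<..} t * ennreal (F t y) \<partial>M) \<partial>lborel)"
    proof (rule nn_integral_mono)
      fix t :: real
      show "(\<integral>\<^sup>+x. ennreal (q * t powr (q - 1)) * (indicator {0<..} t * (if ennreal t \<le> z x then 1 else 0)) \<partial>M)
        \<le> (\<integral>\<^sup>+y. ennreal (q * t powr (q - q / p - 1)) * indicator {0<..} t * ennreal (F t y) \<partial>M)"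
      proof (cases "t > 0")
        case True
        then have "(\<integral>\<^sup>+x. ennreal (q * t powr (q - 1)) * (indicator {0<..} t * (if ennreal t \<le> z x then 1 else 0)) \<partial>M)
            = ennreal (q * t powr (q - 1)) * (\<integral>\<^sup>+x. (if ennreal t \<le> z x then 1 else 0) \<partial>M)"
          by (simp add: nn_integral_cmult)
        also have "\<dots> \<le> ennreal (q * t powr (q - 1)) * (ennreal (t powr (- q / p)) * (\<integral>\<^sup>+y. ennreal (F t y) \<partial>M))"
          by (intro mult_left_mono level True) simp
        also have "\<dots> = ennreal (q * t powr (q - q / p - 1)) * (\<integral>\<^sup>+y. ennreal (F t y) \<partial>M)"
        proof -
          have "ennreal (q * t powr (q - 1)) * ennreal (t powr (- q / p))
              = ennreal (q * (t powr (q - 1) * t powr (- q / p)))"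
            using q by (simp add: mult.assoc flip: ennreal_mult)
          also have "t powr (q - 1) * t powr (- q / p) = t powr (q - q / p - 1)"
            by (simp add: algebra_simps flip: powr_add)
          finally show ?thesis by (simp only: mult.assoc[symmetric])
        qed
        finally show ?thesis using True by (simp add: nn_integral_cmult)
      qed simp
    qed
    also have "\<dots> = (\<integral>\<^sup>+y. (\<integral>\<^sup>+t. ennreal (q * t powr (q - q / p - 1)) * indicator {0<..} t * ennreal (F t y) \<partial>lborel) \<partial>M)"
      unfolding F_def by (rule MB.Fubini') measurable
    also have "\<dots> \<le> (\<integral>\<^sup>+y. ennreal (q / (q - q / p)) * ennreal (f y powr p) \<partial>M)"
    proof (rule nn_integral_mono)
      fix y
      have "(\<integral>\<^sup>+t. ennreal (q * t powr (q - q / p - 1)) * indicator {0<..} t * ennreal (F t y) \<partial>lborel)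
          \<le> (\<integral>\<^sup>+t. ennreal (q * f y) * (ennreal (t powr (q - q / p - 1)) * indicator {0<..f y powr (p / q)} t) \<partial>lborel)"
      proof (rule nn_integral_mono)
        fix t :: real
        \<comment> \<open>For fixed \<open>y\<close>, \<open>F t y\<close> vanishes beyond this
          bound. The weight \<open>t powr (q - q / p - 1)\<close> integrated up to it leaves a
          multiple of \<open>f y powr (p - 1)\<close>, and the factor \<open>f y\<close> completes
          the power \<open>p\<close>.\<close>
        have "t \<le> f y powr (p / q)" if "t > 0" "t powr (q / p) < f y"
        proof -
          have "(t powr (q / p)) powr (p / q) \<le> f y powr (p / q)"
            using that p q by (intro powr_mono2) auto
          then show ?thesis using that p q by (simp add: powr_powr)
        qed
        then show "ennreal (q * t powr (q - q / p - 1)) * indicator {0<..} t * ennreal (F t y)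
            \<le> ennreal (q * f y) * (ennreal (t powr (q - q / p - 1)) * indicator {0<..f y powr (p / q)} t)"
          using q f0[of y] by (auto simp: F_def mult_ac split: split_indicator simp flip: ennreal_mult)
      qed
      also have "\<dots> = ennreal (q * f y) * ennreal ((f y powr (p / q)) powr (q - q / p) / (q - q / p))"
        by (subst nn_integral_cmult) (simp_all add: nn_integral_powr_from_0[OF e])
      also have "\<dots> = ennreal (q / (q - q / p) * f y powr p)"
      proof -
        have "p / q * (q - q / p) = p - 1"
          using p q by (simp add: field_simps)
        moreover have "f y * f y powr (p - 1) = f y powr p"
          using f0[of y] by (cases "f y = 0") (auto simp: powr_diff)
        ultimately show ?thesis
          using q e f0[of y] by (simp add: powr_powr mult_ac flip: ennreal_mult)
      qed
      finally show "(\<integral>\<^sup>+t. ennreal (q * t powr (q - q / p - 1)) * indicator {0<..} t * ennreal (F t y) \<partial>lborel)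
          \<le> ennreal (q / (q - q / p)) * ennreal (f y powr p)"
        using q e by (simp flip: ennreal_mult)
    qed
    also have "\<dots> = ennreal (q / (q - q / p)) * (\<integral>\<^sup>+y. ennreal (f y powr p) \<partial>M)"
      by (rule nn_integral_cmult) measurable
    also have "\<dots> \<le> ennreal (q / (q - q / p)) * 1"
      by (intro mult_left_mono f1) simp
    finally have z_le: "(\<integral>\<^sup>+x. epow (z x) q \<partial>M) \<le> ennreal (q / (q - q / p))" by simp
    have "epow (T x) q = ennreal ((2 * c) powr q) * epow (z x) q" for x
    proof -
      have "T x = ennreal (2 * c) * z x"
        using c unfolding z_def by (simp flip: mult.assoc ennreal_mult)
      then show ?thesis
        using q c by (simp add: epow_mult epow_ennreal)
    qed
    then have "(\<integral>\<^sup>+x. epow (T x) q \<partial>M) = ennreal ((2 * c) powr q) * (\<integral>\<^sup>+x. epow (z x) q \<partial>M)"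
      by (simp add: nn_integral_cmult)
    also have "\<dots> \<le> ennreal ((2 * c) powr q) * ennreal (q / (q - q / p))"
      by (intro mult_left_mono z_le) simp
    finally show ?thesis
      using q e by (simp add: T_def C_def flip: ennreal_mult)
  qed
  moreover have "C \<ge> 0"
    using q e by (simp add: C_def)
  ultimately show ?thesis by blast
qed

end


section \<open>The Stein-Weiss inequality\<close>

context radial_space
begin

text \<open>If \<open>2 A d x y\<close> is smaller than \<open>max (N x) (N y)\<close>, then \<open>N x\<close> and \<open>N y\<close> are comparable.\<close>

lemma weighted_kernel_le:
  assumes "l > 0"
  shows "N x powr (- b) * d x y powr (- l) * N y powr (- a)
    \<le> ((2 * A) powr l + (2 * A) powr \<bar>a\<bar>) *
      (N x powr (- (b + l)) * N y powr (- a) * indicator {..N x} (N y) +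
       N x powr (- b) * N y powr (- (a + l)) * indicator {N x..} (N y) +
       N x powr (- (a + b)) * d x y powr (- l) *
         (indicator {..N x} (d x y) * indicator {..2 * A * N y} (N x) * indicator {..2 * A * N x} (N y)))"
    (is "?K \<le> (?P + ?R) * (?K1 + ?K3 + ?K2)")
\<comment> \<open>Where one of the three quantities vanishes, the convention that powers of 0 are 0
  makes the left side 0.\<close>
proof (cases "N x = 0 \<or> N y = 0 \<or> d x y = 0")
  case True
  then have "?K = 0" by auto
  moreover have "0 \<le> (?P + ?R) * (?K1 + ?K3 + ?K2)"
    by (intro mult_nonneg_nonneg add_nonneg_nonneg) auto
  ultimately show ?thesis by linarith
next
  case False
  then have pos: "N x > 0" "N y > 0" "d x y > 0"
    by (auto simp: less_le)
  have nn: "?K1 \<ge> 0" "?K3 \<ge> 0" "?K2 \<ge> 0" "?P \<ge> 0" "?R \<ge> 0"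
    by auto
  have far: "d x y powr (- l) \<le> ?P * r powr (- l)" if "r > 0" "r \<le> 2 * A * d x y" for r
  proof -
    have "d x y powr (- l) \<le> (r / (2 * A)) powr (- l)"
      using that A_pos assms by (intro powr_mono2') (auto simp: field_simps)
    also have "\<dots> = ?P * r powr (- l)"
      using that A_pos by (simp add: powr_divide powr_minus field_simps)
    finally show ?thesis .
  qed
  \<comment> \<open>The larger norm is either at most \<open>2 * A * d x y\<close>, which leads to
    one of the Hardy kernels, or at least that, which leads to the middle kernel.\<close>
  consider "N y \<le> N x" "N x \<le> 2 * A * d x y" | "N x \<le> N y" "N y \<le> 2 * A * d x y"
    | "2 * A * d x y \<le> max (N x) (N y)"
    by linarith
  then have "?K \<le> ?P * ?K1 \<or> ?K \<le> ?P * ?K3 \<or> ?K \<le> ?R * ?K2"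
  proof cases
    case 1
    have "?K \<le> N x powr (- b) * (?P * N x powr (- l)) * N y powr (- a)"
      using far[OF pos(1) 1(2)] by (intro mult_right_mono mult_left_mono) auto
    also have "\<dots> = ?P * ?K1"
      using 1 by (simp add: powr_add minus_add_distrib mult_ac powr_diff powr_minus divide_simps)
    finally show ?thesis by blast
  next
    case 2
    have "?K \<le> N x powr (- b) * (?P * N y powr (- l)) * N y powr (- a)"
      using far[OF pos(2) 2(2)] by (intro mult_right_mono mult_left_mono) auto
    also have "\<dots> = ?P * ?K3"
      using 2 by (simp add: powr_add minus_add_distrib mult_ac powr_diff powr_minus divide_simps)
    finally show ?thesis by blast
  next
    case 3
    have tri: "N x \<le> A * N y + A * d x y" "N y \<le> A * N x + A * d x y"
      using quasi_triangle[of x y] quasi_triangle(2)[of y x] by (simp_all add: distrib_left)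
    have mono: "N x \<le> A * N x" "N y \<le> A * N y"
      using A_ge_1 pos by simp_all
    \<comment> \<open>In the quasi-triangle inequalities \<open>A * d x y\<close> is thus at most
      half of the larger norm and can be absorbed; this is the origin of the factor 2 in
      \<open>2 * A\<close>.\<close>
    have max: "2 * (A * d x y) \<le> N x \<or> 2 * (A * d x y) \<le> N y"
      using 3 by (simp add: mult.assoc le_max_iff_disj)
    from max have "N x \<le> 2 * (A * N y) \<and> N y \<le> 2 * (A * N x)"
    proof
      assume "2 * (A * d x y) \<le> N x"
      with tri mono pos show ?thesis by linarith
    next
      assume "2 * (A * d x y) \<le> N y"
      with tri mono pos show ?thesis by linarith
    qed
    then have comp: "N x \<le> 2 * A * N y" "N y \<le> 2 * A * N x"
      by (simp_all add: mult.assoc)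
    have "A * d x y \<le> A * N x"
      using max comp mono pos unfolding mult.assoc by linarith
    then have near: "d x y \<le> N x"
      using A_pos by simp
    \<comment> \<open>The sign of \<open>a\<close> decides which side of the comparability is used;
      the absolute value in \<open>?R\<close> covers both.\<close>
    have "N y powr (- a) \<le> ?R * N x powr (- a)"
    proof (cases "a \<ge> 0")
      case True
      have "N y powr (- a) \<le> (N x / (2 * A)) powr (- a)"
        using comp pos A_pos True by (intro powr_mono2') (auto simp: field_simps)
      then show ?thesis
        using True pos A_pos by (simp add: powr_divide powr_minus field_simps)
    next
      case False
      have "N y powr (- a) \<le> (2 * A * N x) powr (- a)"
        using comp pos A_pos False by (intro powr_mono2) auto
      then show ?thesis
        using False pos A_pos by (simp add: powr_mult)
    qed
    then have "?K \<le> N x powr (- b) * d x y powr (- l) * (?R * N x powr (- a))"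
      by (intro mult_left_mono) auto
    also have "\<dots> = ?R * ?K2"
      using comp near by (simp add: mult_ac powr_diff powr_minus divide_simps)
    finally show ?thesis by blast
  qed
  moreover have "?P * ?K1 \<le> (?P + ?R) * (?K1 + ?K3 + ?K2)"
    using nn by (intro mult_mono) auto
  moreover have "?P * ?K3 \<le> (?P + ?R) * (?K1 + ?K3 + ?K2)"
    using nn by (intro mult_mono) auto
  moreover have "?R * ?K2 \<le> (?P + ?R) * (?K1 + ?K3 + ?K2)"
    using nn by (intro mult_mono) auto
  ultimately show ?thesis by linarith
qed

text \<open>Because \<open>d x y \<le> N x\<close> and \<open>a + b \<ge> 0\<close>, the factor
  \<open>N x powr (- (a + b))\<close> is at most \<open>d x y powr (- (a + b))\<close>, which leaves
  a convolution kernel of exponent \<open>a + b + l\<close>. For \<open>p = q\<close> this exponent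
  equals \<open>Q\<close>, the borderline case excluded there, but then
  \<open>- (a + b) = l - Q\<close> is precisely the power treated in
  \<open>middle_Schur\<close>.\<close>

lemma stein_weiss_middle:
  assumes p: "p > 1" "1 / p + 1 / p' = 1" "p \<le> q"
    and l: "0 < l" "l < Q" and ab: "a + b \<ge> 0" "a + b + l = Q / q + Q / p'"
  shows "\<exists>C\<ge>0. \<forall>f. f \<in> borel_measurable M \<longrightarrow> (\<forall>x. f x \<ge> 0) \<longrightarrow>
    (\<integral>\<^sup>+y. ennreal (f y powr p) \<partial>M) \<le> 1 \<longrightarrow>
    (\<integral>\<^sup>+x. epow (\<integral>\<^sup>+y. ennreal (N x powr (- (a + b)) * d x y powr (- l) *
         (indicator {..N x} (d x y) * indicator {..2 * A * N y} (N x) * indicator {..2 * A * N x} (N y)) * f y) \<partial>M) q \<partial>M)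
      \<le> ennreal C"
proof (cases "p = q")
  case True
  have "a + b + l = Q"
    using ab(2) conjugate_exponent_split[OF p(2), of Q] True by simp
  then have eq: "l - Q = - (a + b)" by simp
  obtain C where C: "C \<ge> 0" "\<And>f. f \<in> borel_measurable M \<Longrightarrow> (\<And>x. f x \<ge> 0) \<Longrightarrow>
    (\<integral>\<^sup>+x. epow (\<integral>\<^sup>+y. ennreal (N x powr (- (a + b)) * d x y powr (- l) *
         (indicator {..N x} (d x y) * indicator {..2 * A * N y} (N x) * indicator {..2 * A * N x} (N y)) * f y) \<partial>M) p \<partial>M)
      \<le> ennreal C * (\<integral>\<^sup>+y. ennreal (f y powr p) \<partial>M)"
    using middle_Schur[OF p(1,2) l(2)] unfolding eq by blast
  show ?thesis
  proof (intro exI[of _ C] conjI allI impI C(1))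
    fix f :: "'a \<Rightarrow> real"
    assume f: "f \<in> borel_measurable M" "\<forall>x. f x \<ge> 0" "(\<integral>\<^sup>+y. ennreal (f y powr p) \<partial>M) \<le> 1"
    have "ennreal C * (\<integral>\<^sup>+y. ennreal (f y powr p) \<partial>M) \<le> ennreal C"
      using mult_left_mono[OF f(3), of "ennreal C"] by simp
    with C(2)[OF f(1)] f(2) show "(\<integral>\<^sup>+x. epow (\<integral>\<^sup>+y. ennreal (N x powr (- (a + b)) * d x y powr (- l) *
         (indicator {..N x} (d x y) * indicator {..2 * A * N y} (N x) * indicator {..2 * A * N x} (N y)) * f y) \<partial>M) q \<partial>M)
      \<le> ennreal C"
      unfolding True by (meson order_trans)
  qed
next
  case False
  then have pq: "p < q" using p by simp
  obtain C where C: "C \<ge> 0" "\<And>f. f \<in> borel_measurable M \<Longrightarrow> (\<And>x. f x \<ge> 0) \<Longrightarrow>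
    (\<integral>\<^sup>+y. ennreal (f y powr p) \<partial>M) \<le> 1 \<Longrightarrow>
    (\<integral>\<^sup>+x. epow (\<integral>\<^sup>+y. ennreal (d x y powr (- (a + b + l)) * f y) \<partial>M) q \<partial>M) \<le> ennreal C"
    using hardy_littlewood_sobolev[OF p(1,2) pq ab(2)] by blast
  have le: "N x powr (- (a + b)) * d x y powr (- l) *
      (indicator {..N x} (d x y) * indicator {..2 * A * N y} (N x) * indicator {..2 * A * N x} (N y))
      \<le> d x y powr (- (a + b + l))" for x y
  proof (cases "d x y = 0 \<or> \<not> d x y \<le> N x")
    case False
    then have "N x powr (- (a + b)) \<le> d x y powr (- (a + b))"
      using ab(1) by (intro powr_mono2') (auto simp: less_le)
    then have "N x powr (- (a + b)) * d x y powr (- l) \<le> d x y powr (- (a + b)) * d x y powr (- l)"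
      by (intro mult_right_mono) auto
    also have "\<dots> = d x y powr (- (a + b + l))"
      by (simp add: algebra_simps flip: powr_add)
    finally show ?thesis
      by (auto split: split_indicator)
  qed (auto split: split_indicator)
  show ?thesis
  proof (intro exI[of _ C] conjI allI impI C(1))
    fix f :: "'a \<Rightarrow> real"
    assume f: "f \<in> borel_measurable M" "\<forall>x. f x \<ge> 0" "(\<integral>\<^sup>+y. ennreal (f y powr p) \<partial>M) \<le> 1"
    have "(\<integral>\<^sup>+x. epow (\<integral>\<^sup>+y. ennreal (N x powr (- (a + b)) * d x y powr (- l) *
         (indicator {..N x} (d x y) * indicator {..2 * A * N y} (N x) * indicator {..2 * A * N x} (N y)) * f y) \<partial>M) q \<partial>M)
      \<le> (\<integral>\<^sup>+x. epow (\<integral>\<^sup>+y. ennreal (d x y powr (- (a + b + l)) * f y) \<partial>M) q \<partial>M)"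
      using p f(2) by (intro nn_integral_mono epow_mono ennreal_leI mult_right_mono le) auto
    also have "\<dots> \<le> ennreal C"
      using C(2) f by blast
    finally show "(\<integral>\<^sup>+x. epow (\<integral>\<^sup>+y. ennreal (N x powr (- (a + b)) * d x y powr (- l) *
         (indicator {..N x} (d x y) * indicator {..2 * A * N y} (N x) * indicator {..2 * A * N x} (N y)) * f y) \<partial>M) q \<partial>M)
      \<le> ennreal C" .
  qed
qed

text \<open>The inner Hardy kernel carries \<open>b + l\<close> in place of \<open>b\<close>, the
  outer one \<open>a + l\<close> in place of \<open>a\<close>, so the total degree is the same and
  only \<open>a < Q / p'\<close>, respectively \<open>b < Q / q\<close>, remains to be satisfied.
  The function is normalised because the splitting levels in the Hardy-Littlewood-Sobolev inequality
  are not homogeneous in \<open>f\<close>.\<close>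

lemma stein_weiss_le_1:
  assumes p: "p > 1" "1 / p + 1 / p' = 1" "p \<le> q"
    and l: "0 < l" "l < Q" and ab: "a < Q / p'" "b < Q / q" "a + b \<ge> 0" "a + b + l = Q / q + Q / p'"
  shows "\<exists>C\<ge>0. \<forall>f. f \<in> borel_measurable M \<longrightarrow> (\<forall>x. f x \<ge> 0) \<longrightarrow>
    (\<integral>\<^sup>+y. ennreal (f y powr p) \<partial>M) \<le> 1 \<longrightarrow>
    (\<integral>\<^sup>+x. epow (\<integral>\<^sup>+y. ennreal (N x powr (- b) * d x y powr (- l) * N y powr (- a) * f y) \<partial>M) q \<partial>M)
      \<le> ennreal C"
proof -
  define K1 where "K1 x y = N x powr (- (b + l)) * N y powr (- a) * indicator {..N x} (N y)" for x y
  define K3 where "K3 x y = N x powr (- b) * N y powr (- (a + l)) * indicator {N x..} (N y)" for x y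
  define K2 where "K2 x y = N x powr (- (a + b)) * d x y powr (- l) *
    (indicator {..N x} (d x y) * indicator {..2 * A * N y} (N x) * indicator {..2 * A * N x} (N y))" for x y
  define D where "D = (2 * A) powr l + (2 * A) powr \<bar>a\<bar>"
  have D: "D \<ge> 0" by (simp add: D_def)
  have q: "q > 0" using p by simp
  have [measurable (raw)]: "(\<lambda>z. K1 (u z) (v z)) \<in> borel_measurable L" "(\<lambda>z. K2 (u z) (v z)) \<in> borel_measurable L"
    "(\<lambda>z. K3 (u z) (v z)) \<in> borel_measurable L"
    if [measurable]: "u \<in> L \<rightarrow>\<^sub>M M" "v \<in> L \<rightarrow>\<^sub>M M" for u v and L :: "'a measure"
    unfolding K1_def K2_def K3_def by measurable
  have [measurable (raw)]: "(\<lambda>z. K1 (u z) (v z)) \<in> borel_measurable L" "(\<lambda>z. K2 (u z) (v z)) \<in> borel_measurable L"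
    "(\<lambda>z. K3 (u z) (v z)) \<in> borel_measurable L"
    if [measurable]: "u \<in> L \<rightarrow>\<^sub>M M" "v \<in> L \<rightarrow>\<^sub>M M" for u v and L :: "('a \<times> 'a) measure"
    unfolding K1_def K2_def K3_def by measurable
  have K: "N x powr (- b) * d x y powr (- l) * N y powr (- a) \<le> D * (K1 x y + K3 x y + K2 x y)"
    "K1 x y \<ge> 0" "K2 x y \<ge> 0" "K3 x y \<ge> 0" for x y
    using weighted_kernel_le[OF l(1), of x b y a] by (simp_all add: K1_def K2_def K3_def D_def)
  obtain C1 where C1: "C1 \<ge> 0" "\<And>f. f \<in> borel_measurable M \<Longrightarrow> (\<And>x. f x \<ge> 0) \<Longrightarrow>
      (\<integral>\<^sup>+y. ennreal (f y powr p) \<partial>M) \<le> 1 \<Longrightarrow>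
      (\<integral>\<^sup>+x. epow (\<integral>\<^sup>+y. ennreal (K1 x y * f y) \<partial>M) q \<partial>M) \<le> ennreal C1"
    using hardy_inner[OF p, of a "b + l"] ab unfolding K1_def by (auto simp: add_ac)
  obtain C3 where C3: "C3 \<ge> 0" "\<And>f. f \<in> borel_measurable M \<Longrightarrow> (\<And>x. f x \<ge> 0) \<Longrightarrow>
      (\<integral>\<^sup>+y. ennreal (f y powr p) \<partial>M) \<le> 1 \<Longrightarrow>
      (\<integral>\<^sup>+x. epow (\<integral>\<^sup>+y. ennreal (K3 x y * f y) \<partial>M) q \<partial>M) \<le> ennreal C3"
    using hardy_outer[OF p, of "a + l" b] ab unfolding K3_def by (auto simp: add_ac)
  obtain C2 where C2: "C2 \<ge> 0" "\<And>f. f \<in> borel_measurable M \<Longrightarrow> (\<And>x. f x \<ge> 0) \<Longrightarrow>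
      (\<integral>\<^sup>+y. ennreal (f y powr p) \<partial>M) \<le> 1 \<Longrightarrow>
      (\<integral>\<^sup>+x. epow (\<integral>\<^sup>+y. ennreal (K2 x y * f y) \<partial>M) q \<partial>M) \<le> ennreal C2"
    using stein_weiss_middle[OF p l ab(3,4)] unfolding K2_def by blast
  define C where "C = D powr q * (3 powr q * (C1 + C3 + C2))"
  have "(\<integral>\<^sup>+x. epow (\<integral>\<^sup>+y. ennreal (N x powr (- b) * d x y powr (- l) * N y powr (- a) * f y) \<partial>M) q \<partial>M) \<le> ennreal C"
    if f[measurable]: "f \<in> borel_measurable M" and f0: "\<And>x. f x \<ge> 0"
      and f1: "(\<integral>\<^sup>+y. ennreal (f y powr p) \<partial>M) \<le> 1" for f
  proof -
    have "epow (\<integral>\<^sup>+y. ennreal (N x powr (- b) * d x y powr (- l) * N y powr (- a) * f y) \<partial>M) q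
        \<le> ennreal (D powr q * 3 powr q) * (epow (\<integral>\<^sup>+y. ennreal (K1 x y * f y) \<partial>M) q +
            epow (\<integral>\<^sup>+y. ennreal (K3 x y * f y) \<partial>M) q + epow (\<integral>\<^sup>+y. ennreal (K2 x y * f y) \<partial>M) q)" for x
    proof -
      have "(\<integral>\<^sup>+y. ennreal (N x powr (- b) * d x y powr (- l) * N y powr (- a) * f y) \<partial>M)
          \<le> (\<integral>\<^sup>+y. ennreal D * (ennreal (K1 x y * f y) + ennreal (K3 x y * f y) + ennreal (K2 x y * f y)) \<partial>M)"
      proof (rule nn_integral_mono)
        fix y
        have "N x powr (- b) * d x y powr (- l) * N y powr (- a) * f y
            \<le> D * (K1 x y * f y + K3 x y * f y + K2 x y * f y)"
          using mult_right_mono[OF K(1)[of x y] f0[of y]] by (simp add: algebra_simps)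
        then show "ennreal (N x powr (- b) * d x y powr (- l) * N y powr (- a) * f y)
            \<le> ennreal D * (ennreal (K1 x y * f y) + ennreal (K3 x y * f y) + ennreal (K2 x y * f y))"
          using K(2-)[of x y] f0[of y] D by (simp flip: ennreal_mult ennreal_plus)
      qed
      also have "\<dots> = ennreal D * ((\<integral>\<^sup>+y. ennreal (K1 x y * f y) \<partial>M) + (\<integral>\<^sup>+y. ennreal (K3 x y * f y) \<partial>M)
          + (\<integral>\<^sup>+y. ennreal (K2 x y * f y) \<partial>M))"
        by (simp add: nn_integral_cmult nn_integral_add)
      finally have "epow (\<integral>\<^sup>+y. ennreal (N x powr (- b) * d x y powr (- l) * N y powr (- a) * f y) \<partial>M) q
          \<le> epow (ennreal D * ((\<integral>\<^sup>+y. ennreal (K1 x y * f y) \<partial>M) + (\<integral>\<^sup>+y. ennreal (K3 x y * f y) \<partial>M)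
          + (\<integral>\<^sup>+y. ennreal (K2 x y * f y) \<partial>M))) q"
        using q by (rule epow_mono)
      also have "\<dots> \<le> ennreal (D powr q) * (ennreal (3 powr q) * (epow (\<integral>\<^sup>+y. ennreal (K1 x y * f y) \<partial>M) q +
            epow (\<integral>\<^sup>+y. ennreal (K3 x y * f y) \<partial>M) q + epow (\<integral>\<^sup>+y. ennreal (K2 x y * f y) \<partial>M) q))"
        unfolding epow_mult[OF q] epow_ennreal[OF D] by (intro mult_left_mono epow_add3_le q) simp
      finally show ?thesis by (simp add: ennreal_mult mult.assoc)
    qed
    then have "(\<integral>\<^sup>+x. epow (\<integral>\<^sup>+y. ennreal (N x powr (- b) * d x y powr (- l) * N y powr (- a) * f y) \<partial>M) q \<partial>M)
        \<le> (\<integral>\<^sup>+x. ennreal (D powr q * 3 powr q) * (epow (\<integral>\<^sup>+y. ennreal (K1 x y * f y) \<partial>M) q +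
            epow (\<integral>\<^sup>+y. ennreal (K3 x y * f y) \<partial>M) q + epow (\<integral>\<^sup>+y. ennreal (K2 x y * f y) \<partial>M) q) \<partial>M)"
      by (intro nn_integral_mono)
    also have "\<dots> = ennreal (D powr q * 3 powr q) * ((\<integral>\<^sup>+x. epow (\<integral>\<^sup>+y. ennreal (K1 x y * f y) \<partial>M) q \<partial>M) +
            (\<integral>\<^sup>+x. epow (\<integral>\<^sup>+y. ennreal (K3 x y * f y) \<partial>M) q \<partial>M) + (\<integral>\<^sup>+x. epow (\<integral>\<^sup>+y. ennreal (K2 x y * f y) \<partial>M) q \<partial>M))"
      by (simp add: nn_integral_cmult nn_integral_add)
    also have "\<dots> \<le> ennreal (D powr q * 3 powr q) * (ennreal C1 + ennreal C3 + ennreal C2)"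
      using f0 f1 by (intro mult_left_mono add_mono C1 C2 C3) auto
    also have "\<dots> = ennreal C"
      using C1(1) C2(1) C3(1) by (simp add: C_def mult.assoc flip: ennreal_mult ennreal_plus)
    finally show ?thesis .
  qed
  moreover have "C \<ge> 0"
    using C1(1) C2(1) C3(1) by (simp add: C_def)
  ultimately show ?thesis by blast
qed

text \<open>Homogeneity removes the normalisation: divide by the norm \<open>W powr (1 / p)\<close>
  if \<open>W\<close> is positive, and note that \<open>f\<close> vanishes almost everywhere if
  \<open>W = 0\<close>. The witness is the former constant plus 1, to make it positive.\<close>

theorem stein_weiss:
  assumes p: "p > 1" "1 / p + 1 / p' = 1" "p \<le> q"
    and l: "0 < l" "l < Q" and ab: "a < Q / p'" "b < Q / q" "a + b \<ge> 0" "a + b + l = Q / q + Q / p'"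
  shows "\<exists>C>0. \<forall>f W. f \<in> borel_measurable M \<longrightarrow> (\<forall>x. f x \<ge> 0) \<longrightarrow> W \<ge> 0 \<longrightarrow>
    (\<integral>\<^sup>+y. ennreal (f y powr p) \<partial>M) = ennreal W \<longrightarrow>
    (\<integral>\<^sup>+x. epow (\<integral>\<^sup>+y. ennreal (N x powr (- b) * d x y powr (- l) * N y powr (- a) * f y) \<partial>M) q \<partial>M)
      \<le> ennreal (C * W powr (q / p))"
proof -
  define T where "T f x = (\<integral>\<^sup>+y. ennreal (N x powr (- b) * d x y powr (- l) * N y powr (- a) * f y) \<partial>M)"
    for f x
  obtain C where C: "C \<ge> 0" "\<And>f. f \<in> borel_measurable M \<Longrightarrow> (\<And>x. f x \<ge> 0) \<Longrightarrow>
      (\<integral>\<^sup>+y. ennreal (f y powr p) \<partial>M) \<le> 1 \<Longrightarrow> (\<integral>\<^sup>+x. epow (T f x) q \<partial>M) \<le> ennreal C"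
    using stein_weiss_le_1[OF p l ab] unfolding T_def by blast
  have "(\<integral>\<^sup>+x. epow (T f x) q \<partial>M) \<le> ennreal ((C + 1) * W powr (q / p))"
    if f[measurable]: "f \<in> borel_measurable M" and f0: "\<And>x. f x \<ge> 0" and W: "W \<ge> 0"
      and fW: "(\<integral>\<^sup>+y. ennreal (f y powr p) \<partial>M) = ennreal W" for f W
  proof (cases "W = 0")
    case True
    then have "AE y in M. ennreal (f y powr p) = 0"
      using fW nn_integral_0_iff_AE[of "\<lambda>y. ennreal (f y powr p)" M] by auto
    then have "AE y in M. f y = 0"
      by eventually_elim (auto simp: ennreal_eq_0_iff)
    then have "T f x = (\<integral>\<^sup>+y. 0 \<partial>M)" for x
      unfolding T_def by (intro nn_integral_cong_AE) auto
    then show ?thesis by simp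
  next
    case False
    with W have pos: "W > 0" by simp
    define w where "w = W powr (1 / p)"
    have w: "w > 0" using pos by (simp add: w_def)
    define g where "g y = f y / w" for y
    have g[measurable]: "g \<in> borel_measurable M" and g0: "g y \<ge> 0" for y
      unfolding g_def using f0 w by auto
    have "(\<integral>\<^sup>+y. ennreal (g y powr p) \<partial>M) = (\<integral>\<^sup>+y. ennreal (1 / W) * ennreal (f y powr p) \<partial>M)"
      using f0 w pos p by (intro nn_integral_cong) (simp add: g_def w_def powr_divide powr_powr flip: ennreal_mult)
    also have "\<dots> = ennreal (1 / W) * ennreal W"
      unfolding fW[symmetric] by (rule nn_integral_cmult) measurable
    also have "\<dots> = 1"
      using pos by (simp flip: ennreal_mult)
    finally have "(\<integral>\<^sup>+x. epow (T g x) q \<partial>M) \<le> ennreal C"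
      using C(2)[OF g g0] by simp
    have Tfg: "T f x = ennreal w * T g x" for x
    proof -
      have "T f x = (\<integral>\<^sup>+y. ennreal w * ennreal (N x powr (- b) * d x y powr (- l) * N y powr (- a) * g y) \<partial>M)"
        unfolding T_def using w f0 by (intro nn_integral_cong) (simp add: g_def flip: ennreal_mult)
      then show ?thesis
        unfolding T_def by (simp add: nn_integral_cmult)
    qed
    have "T g \<in> borel_measurable M"
      unfolding T_def by measurable
    then have "(\<integral>\<^sup>+x. epow (T f x) q \<partial>M) = ennreal (w powr q) * (\<integral>\<^sup>+x. epow (T g x) q \<partial>M)"
      using w p by (simp add: Tfg epow_mult epow_ennreal nn_integral_cmult)
    also have "\<dots> \<le> ennreal (w powr q) * ennreal (C + 1)"
      using \<open>(\<integral>\<^sup>+x. epow (T g x) q \<partial>M) \<le> ennreal C\<close> C(1)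
      by (intro mult_left_mono) (auto intro: order_trans)
    also have "\<dots> = ennreal ((C + 1) * W powr (q / p))"
      using C(1) by (simp add: w_def powr_powr mult.commute flip: ennreal_mult del: ennreal_plus)
    finally show ?thesis .
  qed
  then show ?thesis
    using C(1) unfolding T_def by (intro exI[of _ "C + 1"]) auto
qed

end

section \<open>Transfer to Haar measure and complex-valued functions\<close>

context homogeneous_quasi_norm
begin

text \<open>The law of |y^-1 x| in \<open>x\<close> is left invariance of \<open>M\<close>; in
  \<open>y\<close> it is inversion and right translation, known for \<open>lborel\<close> and hence
  for its multiple \<open>M\<close>. The quasi-triangle inequalities come from x = y (y^-1 x) and y
  = x (x^-1 y), where both factors in brackets have the same quasi-norm.\<close>

lemma haar_measure_radial_space:
  assumes haar: "haar_measure G M"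
  shows "\<exists>V A. radial_space M qn (\<lambda>x y. qn (inv y \<otimes> x)) V (homogeneous_dim \<nu>) A"
proof -
  obtain c where c: "0 < c" "c < \<infinity>" "M = density lborel (\<lambda>_. c)"
    using haar_measure_eq_lborel[OF haar] by blast
  obtain V where V: "V \<ge> 0" "distr M borel qn = radial V (homogeneous_dim \<nu>)"
    using distr_qn_radial[OF c(1,2)] unfolding c(3) by blast
  obtain A where A: "\<And>x y. qn (x \<otimes> y) \<le> A * (qn x + qn y)"
    using qn_quasi_triangle by blast
  \<comment> \<open>Enlarged because \<open>radial_space\<close> asks for
    \<open>1 \<le> A\<close>.\<close>
  have A': "qn (x \<otimes> y) \<le> max A 1 * (qn x + qn y)" for x y
    by (rule order_trans[OF A]) (intro mult_right_mono add_nonneg_nonneg qn_nonneg, simp)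
  have sets [measurable_cong, simp]: "sets M = sets borel"
    and left: "\<And>a. distr M borel (\<lambda>x. a \<otimes> x) = M"
    using haar by (auto simp: haar_measure_def)
  have space [simp]: "space M = UNIV"
    using sets_eq_imp_space_eq[OF sets] by simp
  have right: "distr M borel (\<lambda>y. inv y \<otimes> x) = M" for x
  proof (rule measure_eqI)
    fix B assume "B \<in> sets (distr M borel (\<lambda>y. inv y \<otimes> x))"
    then have [measurable]: "B \<in> sets borel" by simp
    have "emeasure (distr M borel (\<lambda>y. inv y \<otimes> x)) B = (\<integral>\<^sup>+y. indicator B (inv y \<otimes> x) \<partial>M)"
      by (simp add: nn_integral_distr flip: nn_integral_indicator)
    also have "\<dots> = c * (\<integral>\<^sup>+y. indicator B (inv y \<otimes> x) \<partial>lborel)"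
      unfolding c(3) by (simp add: nn_integral_density nn_integral_cmult)
    also have "\<dots> = c * (\<integral>\<^sup>+y. indicator B y \<partial>lborel)"
      by (simp only: nn_integral_inv_mult[of "indicator B"] borel_measurable_indicator[OF \<open>B \<in> sets borel\<close>])
    also have "\<dots> = emeasure M B"
      unfolding c(3) by (simp add: emeasure_density nn_integral_cmult)
    finally show "emeasure (distr M borel (\<lambda>y. inv y \<otimes> x)) B = emeasure M B" .
  qed simp
  interpret sigma_finite_measure M
    by (rule haar_measure_sigma_finite[OF haar])
  have "radial_space M qn (\<lambda>x y. qn (inv y \<otimes> x)) V (homogeneous_dim \<nu>) (max A 1)"
  proof
    show "qn \<in> borel_measurable M" "(\<lambda>(x, y). qn (inv y \<otimes> x)) \<in> borel_measurable (M \<Otimes>\<^sub>M M)"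
      by measurable
    show "distr M borel (\<lambda>y. qn (inv y \<otimes> x)) = radial V (homogeneous_dim \<nu>)" for x
    proof -
      have "distr M borel (\<lambda>y. qn (inv y \<otimes> x)) = distr (distr M borel (\<lambda>y. inv y \<otimes> x)) borel qn"
        by (subst distr_distr) (simp_all add: o_def)
      then show ?thesis by (simp add: right V)
    qed
    show "distr M borel (\<lambda>x. qn (inv y \<otimes> x)) = radial V (homogeneous_dim \<nu>)" for y
    proof -
      have "distr M borel (\<lambda>x. qn (inv y \<otimes> x)) = distr (distr M borel (\<lambda>x. inv y \<otimes> x)) borel qn"
        by (subst distr_distr) (simp_all add: o_def)
      then show ?thesis by (simp add: left V)
    qed
    show "qn x \<le> max A 1 * (qn y + qn (inv y \<otimes> x))" for x y
      using A'[of y "inv y \<otimes> x"] by simp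
    show "qn y \<le> max A 1 * (qn x + qn (inv y \<otimes> x))" for x y
    proof -
      have "inv (inv y \<otimes> x) = inv x \<otimes> y"
        using inv_mult_group[of "inv y" x] by simp
      then show ?thesis
        using A'[of x "inv x \<otimes> y"] qn_inv[of "inv y \<otimes> x"] by simp
    qed
  qed (use V homogeneous_dim_pos qn_nonneg in auto)
  then show ?thesis by blast
qed

end

lemma completion_ex_borel_measurable_complex:
  fixes u :: "'a \<Rightarrow> complex"
  assumes [measurable]: "u \<in> borel_measurable (completion M)"
  shows "\<exists>u'\<in>borel_measurable M. AE x in M. u x = u' x"
proof -
  have "(\<lambda>x. Re (u x)) \<in> borel_measurable (completion M)" "(\<lambda>x. Im (u x)) \<in> borel_measurable (completion M)"
    by measurable
  from this[THEN completion_ex_borel_measurable_real]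
  obtain r i where [measurable]: "r \<in> borel_measurable M" "i \<in> borel_measurable M"
    and ae: "AE x in M. Re (u x) = r x" "AE x in M. Im (u x) = i x"
    by blast
  show ?thesis
  proof (intro bexI[of _ "\<lambda>x. complex_of_real (r x) + \<i> * complex_of_real (i x)"])
    show "AE x in M. u x = complex_of_real (r x) + \<i> * complex_of_real (i x)"
      using ae by eventually_elim (simp add: complex_eq_iff)
  qed measurable
qed

theorem theorem2p7:
  fixes G :: "(real ^ 'n) monoid" and \<nu> :: "'n \<Rightarrow> real"
    and qn :: "real ^ 'n \<Rightarrow> real"
    and M :: "(real ^ 'n) measure"
    and Q l p q p' \<alpha> \<beta> :: real
  assumes "homogeneous_group G \<nu>"
    and "homogeneous_quasi_norm G \<nu> qn"
    and "haar_measure G M"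
    and "Q = homogeneous_dim \<nu>"
    and "0 < l" and "l < Q"
    and "1 < p" and "p \<le> q"
    and "1 / p + 1 / p' = 1"
    and "\<alpha> < Q / p'" and "\<beta> < Q / q" and "\<alpha> + \<beta> \<ge> 0"
    and "1 / q = 1 / p + (\<alpha> + \<beta> + l) / Q - 1"
  shows "\<exists>C>0. \<forall>u :: real ^ 'n \<Rightarrow> complex.
    u \<in> borel_measurable (completion M) \<longrightarrow>
    Lp_member (completion M) p (weighted qn \<alpha> u) \<longrightarrow>
      (AE x in completion M. integrable (completion M) (riesz_integrand G qn l u x)) \<and>
      Lp_member (completion M) q (weighted qn (- \<beta>) (riesz_potential G (completion M) qn l u)) \<and>
      Lp_norm (completion M) q (weighted qn (- \<beta>) (riesz_potential G (completion M) qn l u))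
        \<le> C * Lp_norm (completion M) p (weighted qn \<alpha> u)"
proof -
  interpret H: homogeneous_quasi_norm G \<nu> qn by fact
  define d where "d x y = qn (inv\<^bsub>G\<^esub> y \<otimes>\<^bsub>G\<^esub> x)" for x y
  obtain V A where "radial_space M qn d V Q A"
    using H.haar_measure_radial_space[OF assms(3)] unfolding d_def assms(4) by blast
  then interpret R: radial_space M qn d V Q A .
  have p: "p > 1" "1 / p + 1 / p' = 1" "p \<le> q" and q: "q > 0"
    using assms by auto
  have sets [measurable_cong]: "sets M = sets borel"
    using assms(3) by (simp add: haar_measure_def)
  have frac: "(\<alpha> + \<beta> + l) / Q = 1 / q + 1 / p'"
    using assms(13) p(2) by linarith
  have "\<alpha> + \<beta> + l = (\<alpha> + \<beta> + l) / Q * Q"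
    using R.Q_pos by simp
  also have "\<dots> = Q / q + Q / p'"
    unfolding frac by (simp add: distrib_right)
  finally have sum: "\<alpha> + \<beta> + l = Q / q + Q / p'" .
  from R.stein_weiss[OF p assms(5,6,10,11,12) sum]
  obtain C where C: "C > 0" "\<And>f W. f \<in> borel_measurable M \<Longrightarrow> (\<And>x. f x \<ge> 0) \<Longrightarrow> W \<ge> 0 \<Longrightarrow>
    (\<integral>\<^sup>+y. ennreal (f y powr p) \<partial>M) = ennreal W \<Longrightarrow>
    (\<integral>\<^sup>+x. epow (\<integral>\<^sup>+y. ennreal (qn x powr (- \<beta>) * d x y powr (- l) * qn y powr (- \<alpha>) * f y) \<partial>M) q \<partial>M)
      \<le> ennreal (C * W powr (q / p))"
    by blast
  \<comment> \<open>The law of \<open>qn\<close> has no mass at 0, so the conventional value of the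
    weights at the origin does not matter.\<close>
  have "emeasure M {x. qn x \<le> 0} = emeasure (distr M borel qn) {..0}"
    by (subst emeasure_distr) (auto simp: vimage_def)
  also have "\<dots> = 0"
    by (simp add: R.distr_N emeasure_radial_atMost R.V_nonneg R.Q_pos)
  finally have "AE x in M. \<not> qn x \<le> 0"
    by (intro AE_I[where N = "{x. qn x \<le> 0}"]) (auto simp: sets)
  then have qn_pos: "AE x in M. qn x > 0"
    by (simp add: not_le)
  have "(AE x in completion M. integrable (completion M) (riesz_integrand G qn l u x)) \<and>
      Lp_member (completion M) q (weighted qn (- \<beta>) (riesz_potential G (completion M) qn l u)) \<and>
      Lp_norm (completion M) q (weighted qn (- \<beta>) (riesz_potential G (completion M) qn l u))
        \<le> C powr (1 / q) * Lp_norm (completion M) p (weighted qn \<alpha> u)"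
    if u[measurable]: "u \<in> borel_measurable (completion M)"
      and Lp: "Lp_member (completion M) p (weighted qn \<alpha> u)" for u
  proof -
    \<comment> \<open>A Borel representative is taken because Tonelli's theorem is applied to
      products of \<open>M\<close>, not of its completion. Changing \<open>u\<close> on a null set
      leaves the integral over \<open>y\<close> unchanged for every \<open>x\<close>.\<close>
    obtain v where v[measurable]: "v \<in> borel_measurable M" and uv: "AE y in M. u y = v y"
      using completion_ex_borel_measurable_complex[OF u] by blast
    define W where "W = (LINT y|completion M. norm (weighted qn \<alpha> u y) powr p)"
    have W: "W \<ge> 0" unfolding W_def by simp
    define f where "f y = norm (weighted qn \<alpha> v y)" for y
    have [measurable]: "f \<in> borel_measurable M"
      unfolding f_def weighted_def by measurable
    have "(\<integral>\<^sup>+y. ennreal (f y powr p) \<partial>M) = (\<integral>\<^sup>+y. ennreal (norm (weighted qn \<alpha> u y) powr p) \<partial>M)"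
      using uv by (intro nn_integral_cong_AE) (auto simp: f_def weighted_def)
    also have "\<dots> = (\<integral>\<^sup>+y. ennreal (norm (weighted qn \<alpha> u y) powr p) \<partial>completion M)"
      by (simp add: nn_integral_completion)
    also have "\<dots> = ennreal W"
      unfolding W_def using Lp by (intro nn_integral_eq_integral) (auto simp: Lp_member_def)
    finally have fW: "(\<integral>\<^sup>+y. ennreal (f y powr p) \<partial>M) = ennreal W" .
    have riesz_m [measurable]: "(\<lambda>(x, y). riesz_integrand G qn l v x y) \<in> borel_measurable (M \<Otimes>\<^sub>M M)"
      unfolding riesz_integrand_def by measurable
    have [measurable]: "riesz_integrand G qn l v x \<in> borel_measurable M" for x
      unfolding riesz_integrand_def by measurable
    have [measurable]: "riesz_integrand G qn l u x \<in> borel_measurable (completion M)" for x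
    proof -
      have "(\<lambda>y. complex_of_real (qn (inv\<^bsub>G\<^esub> y \<otimes>\<^bsub>G\<^esub> x) powr l)) \<in> borel_measurable M"
        by measurable
      then have [measurable]: "(\<lambda>y. complex_of_real (qn (inv\<^bsub>G\<^esub> y \<otimes>\<^bsub>G\<^esub> x) powr l)) \<in> borel_measurable (completion M)"
        by (rule measurable_completion)
      show ?thesis
        unfolding riesz_integrand_def by measurable
    qed
    have riesz_cong: "AE y in completion M. riesz_integrand G qn l u x y = riesz_integrand G qn l v x y" for x
      using AE_completion[OF uv] by eventually_elim (simp add: riesz_integrand_def)
    \<comment> \<open>The potential of the absolute value. In the kernel estimate the factor
      |y|^-\<alpha> undoes the weight in \<open>f\<close> off the origin, so \<open>J\<close> is the
      quantity that is controlled.\<close>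
    define J where "J x = (\<integral>\<^sup>+y. ennreal (norm (riesz_integrand G qn l v x y)) \<partial>M)" for x
    have J: "(\<integral>\<^sup>+y. ennreal (qn x powr (- \<beta>) * d x y powr (- l) * qn y powr (- \<alpha>) * f y) \<partial>M)
        = ennreal (qn x powr (- \<beta>)) * J x" for x
    proof -
      have "(\<integral>\<^sup>+y. ennreal (qn x powr (- \<beta>) * d x y powr (- l) * qn y powr (- \<alpha>) * f y) \<partial>M)
        = (\<integral>\<^sup>+y. ennreal (qn x powr (- \<beta>)) * ennreal (norm (riesz_integrand G qn l v x y)) \<partial>M)"
      proof (rule nn_integral_cong_AE, use qn_pos in eventually_elim)
        case (elim y)
        have "qn y powr (- \<alpha>) * f y = norm (v y)"
          using elim by (simp add: f_def weighted_def norm_mult powr_minus)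
        moreover have "norm (riesz_integrand G qn l v x y) = d x y powr (- l) * norm (v y)"
          by (simp add: riesz_integrand_def norm_divide powr_minus d_def field_simps)
        ultimately have "qn x powr (- \<beta>) * d x y powr (- l) * qn y powr (- \<alpha>) * f y
            = qn x powr (- \<beta>) * norm (riesz_integrand G qn l v x y)"
          by (simp add: mult.assoc)
        then show ?case
          by (simp only:) (simp add: ennreal_mult)
      qed
      then show ?thesis
        unfolding J_def by (simp add: nn_integral_cmult)
    qed
    have [measurable]: "J \<in> borel_measurable M"
      unfolding J_def by measurable
    have main: "(\<integral>\<^sup>+x. epow (ennreal (qn x powr (- \<beta>)) * J x) q \<partial>M) \<le> ennreal (C * W powr (q / p))"
      using C(2)[of f W] fW W unfolding J by (simp add: f_def)
    then have "(\<integral>\<^sup>+x. epow (ennreal (qn x powr (- \<beta>)) * J x) q \<partial>M) \<noteq> \<infinity>"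
      by (auto simp: top_unique)
    then have "AE x in M. epow (ennreal (qn x powr (- \<beta>)) * J x) q \<noteq> \<infinity>"
      by (intro nn_integral_PInf_AE) auto
    \<comment> \<open>The weight |x|^-\<beta> is positive off the origin, so finiteness of the
      product passes to \<open>J\<close>; this yields the integrability claim.\<close>
    then have J_finite: "AE x in M. J x < \<infinity>"
      using qn_pos
    proof eventually_elim
      case (elim x)
      have "J x \<noteq> \<infinity>"
      proof
        assume "J x = \<infinity>"
        with elim show False by (simp add: ennreal_mult_top)
      qed
      then show ?case by (simp add: less_top)
    qed
    have int: "AE x in completion M. integrable (completion M) (riesz_integrand G qn l u x)"
    proof (rule AE_completion, use J_finite in eventually_elim)
      case (elim x)
      then have "integrable M (riesz_integrand G qn l v x)"
        by (intro integrableI_bounded) (auto simp: J_def)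
      then have "integrable (completion M) (riesz_integrand G qn l v x)"
        by (simp add: integrable_completion)
      then show ?case
        using riesz_cong[of x] by (subst integrable_cong_AE) (auto intro: measurable_completion)
    qed
    define P where "P x = (LINT y|M. riesz_integrand G qn l v x y)" for x
    have [measurable]: "P \<in> borel_measurable M"
      unfolding P_def by measurable
    have pot: "riesz_potential G (completion M) qn l u = P"
    proof
      fix x
      have "riesz_potential G (completion M) qn l u x = (LINT y|completion M. riesz_integrand G qn l v x y)"
        unfolding riesz_potential_def
        by (intro integral_cong_AE riesz_cong) (auto intro: measurable_completion)
      then show "riesz_potential G (completion M) qn l u x = P x"
        by (simp add: P_def integral_completion)
    qed
    define w where "w x = weighted qn (- \<beta>) P x" for x
    have w_m [measurable]: "w \<in> borel_measurable M"
      unfolding w_def weighted_def by measurable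
    have w_le: "ennreal (norm (w x)) \<le> ennreal (qn x powr (- \<beta>)) * J x" for x
    proof -
      \<comment> \<open>Where the integrand is not integrable, \<open>P x\<close> is 0 by
        convention, so the bound holds at every \<open>x\<close>.\<close>
      have "ennreal (norm (P x)) \<le> J x"
        unfolding P_def J_def
        by (cases "integrable M (riesz_integrand G qn l v x)")
           (auto intro: integral_norm_bound_ennreal simp: not_integrable_integral_eq)
      then show ?thesis
        by (simp add: w_def weighted_def norm_mult ennreal_mult mult_left_mono)
    qed
    have w_int: "(\<integral>\<^sup>+x. ennreal (norm (w x) powr q) \<partial>completion M) \<le> ennreal (C * W powr (q / p))"
    proof -
      have "(\<integral>\<^sup>+x. ennreal (norm (w x) powr q) \<partial>completion M) = (\<integral>\<^sup>+x. epow (ennreal (norm (w x))) q \<partial>M)"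
        by (simp add: nn_integral_completion epow_ennreal)
      also have "\<dots> \<le> (\<integral>\<^sup>+x. epow (ennreal (qn x powr (- \<beta>)) * J x) q \<partial>M)"
        by (intro nn_integral_mono epow_mono w_le q)
      finally show ?thesis using main by simp
    qed
    have w_mc [measurable]: "w \<in> borel_measurable (completion M)"
      by (rule measurable_completion[OF w_m])
    have w_integrable: "integrable (completion M) (\<lambda>x. norm (w x) powr q)"
    proof (rule integrableI_bounded)
      show "(\<integral>\<^sup>+x. ennreal (norm (norm (w x) powr q)) \<partial>completion M) < \<infinity>"
        using w_int by (auto intro: le_less_trans)
    qed measurable
    have "(LINT x|completion M. norm (w x) powr q) \<le> C * W powr (q / p)"
      using w_int C(1) W nn_integral_eq_integral[OF w_integrable] by simp
    \<comment> \<open>The root of order \<open>q\<close> turns \<open>W powr (q / p)\<close> into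
      \<open>W powr (1 / p)\<close>, the L^p norm, and \<open>C\<close> into the final
      constant.\<close>
    then have "(LINT x|completion M. norm (w x) powr q) powr (1 / q) \<le> (C * W powr (q / p)) powr (1 / q)"
      using q by (intro powr_mono2) auto
    also have "\<dots> = C powr (1 / q) * W powr (1 / p)"
      using C(1) q by (simp add: powr_mult powr_powr)
    finally have "Lp_norm (completion M) q w \<le> C powr (1 / q) * Lp_norm (completion M) p (weighted qn \<alpha> u)"
      by (simp add: Lp_norm_def W_def)
    moreover have "Lp_member (completion M) q w"
      using w_integrable w_mc by (simp add: Lp_member_def)
    ultimately show ?thesis
      using int unfolding pot w_def[abs_def, symmetric] by simp
  qed
  then show ?thesis
    using C(1) by (intro exI[of _ "C powr (1 / q)"]) auto
qed

end
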